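(* Let $0\le\alpha,\beta<1$ and $n\in\mathbb{N}$. The defect spaces satisfy $$\mathcal{D}_+^{\mathbf{J},n}\dotplus\mathcal{D}_-^{\mathbf{J},n}=\mathbf{D}^n_-\dotplus\mathbf{D}^n_+ .$$
   Context: $\mathbb{N}=\{1,2,\dots\}$. Put $w(x)=(1-x)^\alpha(1+x)^\beta$ and $L^2_{\alpha,\beta}(-1,1)=L^2((-1,1),w\,dx)$. The Jacobi differential expression is $\ell_{\alpha,\beta}[f]=-\frac{1}{w}\left[(1-x)^{\alpha+1}(1+x)^{\beta+1}f'\right]'$, and $\ell^n_{\mathbf{J}}$ denotes its $n$-fold composition with itself. The maximal domain is $$\mathcal{D}_{\max}^{\mathbf{J},n}=\{f\in L^2_{\alpha,\beta}(-1,1): f,f',\dots,f^{(2n-1)}\in AC_{\mathrm{loc}}(-1,1),\ \ell^n_{\mathbf{J}}[f]\in L^2_{\alpha,\beta}(-1,1)\}.$$ For $f,g\in\mathcal{D}_{\max}^{\mathbf{J},n}$ put $[f,g]_n\big|_{-1}^1=\int_{-1}^1(\ell^n_{\mathbf{J}}[f]\overline g-f\,\overline{\ell^n_{\mathbf{J}}[g]})w\,dx$, and let $\mathcal{D}_{\min}^{\mathbf{J},n}=\{f\in\mathcal{D}_{\max}^{\mathbf{J},n}:[f,g]_n\big|_{-1}^1=0\ \forall g\in\mathcal{D}_{\max}^{\mathbf{J},n}\}$ be the minimal domain. The adjoint of $\{\ell^n_{\mathbf{J}},\mathcal{D}_{\min}^{\mathbf{J},n}\}$ is $\{\ell^n_{\mathbf{J}},\mathcal{D}_{\max}^{\mathbf{J},n}\}$,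 the defect spaces are $\mathcal{D}_\pm^{\mathbf{J},n}=\{f\in\mathcal{D}_{\max}^{\mathbf{J},n}:\ell^n_{\mathbf{J}}[f]=\pm if\}$, each of dimension $2n$, and von Neumann's formula reads $\mathcal{D}_{\max}^{\mathbf{J},n}=\mathcal{D}_{\min}^{\mathbf{J},n}\dotplus\mathcal{D}_+^{\mathbf{J},n}\dotplus\mathcal{D}_-^{\mathbf{J},n}$, where $\dotplus$ denotes direct sum. For $j\in\mathbb{N}_0$ the following are (fixed) functions, smooth on $(-1,1)$: $\varphi_j^+$ equals $(1-x)^j$ for $x$ near $1$ and $0$ for $x$ near $-1$; $\varphi_j^-$ equals $0$ near $1$ and $(1+x)^j$ near $-1$; $\psi_j^+$ equals $(1-x)^{-\alpha+j}$ near $1$ and $0$ near $-1$; $\psi_j^-$ equals $0$ near $1$ and $(1+x)^{-\beta+j}$ near $-1$. Define $$\mathbf{D}^n_\pm=\operatorname{span}\{\varphi_0^\pm,\dots,\varphi_{n-1}^\pm,\psi_0^\pm,\dots,\psi_{n-1}^\pm\}.$$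
   Formalization: The equality is proved modulo the minimal domain (both sums direct and complementary to it), as it fails literally; when α=0 or β=0, where ψ_j would coincide with φ_j near that endpoint, ψ_j is taken as t^j ln t, with t the distance to the endpoint. *)

theory Defs
  imports
    "HOL-Analysis.Analysis"
    "HOL-Library.Function_Algebras"
    "HOL-Library.Set_Algebras"
begin

text \<open>
  A function on $(-1,1)$ is represented by a map of type \<^typ>\<open>real \<Rightarrow> complex\<close> that vanishes
  off $(-1,1)$. With this convention distinct maps are distinct functions on $(-1,1)$, so that sums,
  intersections and equalities of function spaces have their usual meaning; they are written with
  the pointwise operations of Function Algebras and the elementwise sum of Set Algebras.
\<close>

definition jacobi_weight :: "real \<Rightarrow> real \<Rightarrow> real \<Rightarrow> real" where
  "jacobi_weight \<alpha> \<beta> x = (1 - x) powr \<alpha> * (1 + x) powr \<beta>"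

definition jacobi_measure :: "real \<Rightarrow> real \<Rightarrow> real measure" where
  "jacobi_measure \<alpha> \<beta> =
     density (restrict_space lebesgue {-1<..<1}) (\<lambda>x. ennreal (jacobi_weight \<alpha> \<beta> x))"

definition square_integrable :: "'a measure \<Rightarrow> ('a \<Rightarrow> complex) \<Rightarrow> bool" where
  "square_integrable M f \<longleftrightarrow> f \<in> borel_measurable M \<and> integrable M (\<lambda>x. (norm (f x))\<^sup>2)"

text \<open>The derivative of a function of a real variable; it is meaningful only where it exists.\<close>

definition rderiv :: "(real \<Rightarrow> complex) \<Rightarrow> real \<Rightarrow> complex" where
  "rderiv f = (\<lambda>x. vector_derivative f (at x))"

definition smooth_on_ivl :: "(real \<Rightarrow> complex) \<Rightarrow> bool" where
  "smooth_on_ivl f \<longleftrightarrow> (\<forall>k. \<forall>x\<in>{-1<..<1}. (rderiv ^^ k) f differentiable (at x))"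

definition AC_on :: "real \<Rightarrow> real \<Rightarrow> (real \<Rightarrow> complex) \<Rightarrow> bool" where
  "AC_on a b f \<longleftrightarrow>
     (\<forall>\<epsilon>>0. \<exists>\<delta>>0. \<forall>(m::nat) u v.
        (\<forall>i<m. a \<le> u i \<and> u i \<le> v i \<and> v i \<le> b) \<and>
        disjoint_family_on (\<lambda>i. {u i<..<v i}) {..<m} \<and>
        (\<Sum>i<m. v i - u i) < \<delta>
        \<longrightarrow> (\<Sum>i<m. norm (f (v i) - f (u i))) < \<epsilon>)"

definition AC_loc :: "(real \<Rightarrow> complex) \<Rightarrow> bool" where
  "AC_loc f \<longleftrightarrow> (\<forall>a b. -1 < a \<and> a \<le> b \<and> b < 1 \<longrightarrow> AC_on a b f)"

definition jacobi_expr ::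
    "real \<Rightarrow> real \<Rightarrow> (real \<Rightarrow> complex) \<Rightarrow> real \<Rightarrow> complex" where
  "jacobi_expr \<alpha> \<beta> f =
     (\<lambda>x. - ((1 / jacobi_weight \<alpha> \<beta> x) *\<^sub>R
            rderiv (\<lambda>y. ((1 - y) powr (\<alpha> + 1) * (1 + y) powr (\<beta> + 1)) *\<^sub>R rderiv f y) x))"

abbreviation jacobi_pow ::
    "real \<Rightarrow> real \<Rightarrow> nat \<Rightarrow> (real \<Rightarrow> complex) \<Rightarrow> real \<Rightarrow> complex" where
  "jacobi_pow \<alpha> \<beta> n f \<equiv> (jacobi_expr \<alpha> \<beta> ^^ n) f"

text \<open>
  The derivatives of order up to $2n-1$ are required to exist everywhere on $(-1,1)$. The derivative
  of order $2n$, and with it the $n$-th power of the expression, then exists only almost everywhere;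
  the arbitrary values on the exceptional null set do not affect any condition below.
\<close>

definition D_max :: "real \<Rightarrow> real \<Rightarrow> nat \<Rightarrow> (real \<Rightarrow> complex) set" where
  "D_max \<alpha> \<beta> n =
     {f. (\<forall>x. x \<notin> {-1<..<1} \<longrightarrow> f x = 0) \<and>
         square_integrable (jacobi_measure \<alpha> \<beta>) f \<and>
         (\<forall>k<2 * n - 1. \<forall>x\<in>{-1<..<1}. (rderiv ^^ k) f differentiable (at x)) \<and>
         (\<forall>k<2 * n. AC_loc ((rderiv ^^ k) f)) \<and>
         square_integrable (jacobi_measure \<alpha> \<beta>) (jacobi_pow \<alpha> \<beta> n f)}"

definition jacobi_bracket ::
    "real \<Rightarrow> real \<Rightarrow> nat \<Rightarrow> (real \<Rightarrow> complex) \<Rightarrow> (real \<Rightarrow> complex) \<Rightarrow> complex" where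
  "jacobi_bracket \<alpha> \<beta> n f g =
     (LINT x|jacobi_measure \<alpha> \<beta>.
        jacobi_pow \<alpha> \<beta> n f x * cnj (g x) - f x * cnj (jacobi_pow \<alpha> \<beta> n g x))"

definition D_min :: "real \<Rightarrow> real \<Rightarrow> nat \<Rightarrow> (real \<Rightarrow> complex) set" where
  "D_min \<alpha> \<beta> n =
     {f \<in> D_max \<alpha> \<beta> n. \<forall>g\<in>D_max \<alpha> \<beta> n. jacobi_bracket \<alpha> \<beta> n f g = 0}"

definition defect_plus :: "real \<Rightarrow> real \<Rightarrow> nat \<Rightarrow> (real \<Rightarrow> complex) set" where
  "defect_plus \<alpha> \<beta> n =
     {f \<in> D_max \<alpha> \<beta> n. AE x in jacobi_measure \<alpha> \<beta>. jacobi_pow \<alpha> \<beta> n f x = \<i> * f x}"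

definition defect_minus :: "real \<Rightarrow> real \<Rightarrow> nat \<Rightarrow> (real \<Rightarrow> complex) set" where
  "defect_minus \<alpha> \<beta> n =
     {f \<in> D_max \<alpha> \<beta> n. AE x in jacobi_measure \<alpha> \<beta>. jacobi_pow \<alpha> \<beta> n f x = - \<i> * f x}"

text \<open>
  The second family of endpoint profiles, in terms of the distance $t$ to the endpoint. For
  exponent $a = 0$ the powers $t^{-a+j}$ coincide with the profiles $t^j$ of the first family, and
  the second solution at the endpoint is logarithmic; the usual convention of inserting the factor
  $\ln t$ is used in that case.
\<close>

definition psi_profile :: "real \<Rightarrow> nat \<Rightarrow> real \<Rightarrow> real" where
  "psi_profile a j t = (if a = 0 then t ^ j * ln t else t powr (- a + real j))"

definition cutoff_at_1 :: "(real \<Rightarrow> real) \<Rightarrow> (real \<Rightarrow> complex) \<Rightarrow> bool" where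
  "cutoff_at_1 p f \<longleftrightarrow>
     (\<forall>x. x \<notin> {-1<..<1} \<longrightarrow> f x = 0) \<and> smooth_on_ivl f \<and>
     (\<forall>\<^sub>F x in at_left 1. f x = of_real (p (1 - x))) \<and>
     (\<forall>\<^sub>F x in at_right (-1). f x = 0)"

definition cutoff_at_m1 :: "(real \<Rightarrow> real) \<Rightarrow> (real \<Rightarrow> complex) \<Rightarrow> bool" where
  "cutoff_at_m1 p f \<longleftrightarrow>
     (\<forall>x. x \<notin> {-1<..<1} \<longrightarrow> f x = 0) \<and> smooth_on_ivl f \<and>
     (\<forall>\<^sub>F x in at_left 1. f x = 0) \<and>
     (\<forall>\<^sub>F x in at_right (-1). f x = of_real (p (1 + x)))"

definition cspan :: "(real \<Rightarrow> complex) set \<Rightarrow> (real \<Rightarrow> complex) set" where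
  "cspan = module.span (\<lambda>(c::complex) f x. c * f x)"

definition endpoint_space ::
    "nat \<Rightarrow> (nat \<Rightarrow> real \<Rightarrow> complex) \<Rightarrow> (nat \<Rightarrow> real \<Rightarrow> complex) \<Rightarrow> (real \<Rightarrow> complex) set" where
  "endpoint_space n \<phi> \<psi> = cspan (\<phi> ` {..<n} \<union> \<psi> ` {..<n})"

text \<open>
  Equality of the direct sums of \<open>A\<close>, \<open>B\<close> and of \<open>C\<close>, \<open>D\<close> modulo the subspace \<open>N\<close>: the sums are
  direct, each is a complement of \<open>N\<close> in its sum with \<open>N\<close>, and both have the same image
  in the quotient by \<open>N\<close>.
\<close>

definition direct_sums_eq_mod ::
    "'a::ab_group_add set \<Rightarrow> 'a set \<Rightarrow> 'a set \<Rightarrow> 'a set \<Rightarrow> 'a set \<Rightarrow> bool" where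
  "direct_sums_eq_mod N A B C D \<longleftrightarrow>
     A \<inter> B = {0} \<and> C \<inter> D = {0} \<and>
     N \<inter> (A + B) = {0} \<and> N \<inter> (C + D) = {0} \<and>
     N + (A + B) = N + (C + D)"

end

(* Write w for the weight, p for the leading coefficient and u for a solution of p u' = 1. Near an
   endpoint f = a + b u with b = p f' and a = f - u b, and if l[f] is square integrable then
   a' = w u l[f] and b' = - w l[f] are integrable, so a and b extend continuously to both endpoints.
   Applied to f, l[f], ..., l^(n-1)[f] this gives 4n boundary values on the maximal domain, and by
   Green's formula their common kernel K is contained in the minimal domain. Hence any 4n functions of
   the maximal domain that are linearly independent modulo K span a complement of K.
   For the defect spaces, take the two solutions of l[f] = m f for each of the 2n roots of
   m^(2n) = -1, for which m^n = i or -i. The bracket of f + g with f - g shows that the sum of the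
   defect spaces meets the minimal domain trivially, so these 4n functions are independent modulo K;
   this also forces the minimal domain to equal K.
   For the endpoint spaces, l acts triangularly on the coefficients of the endpoint profiles, and
   successive boundary values read off these coefficients. *)

theory Submission
  imports Defs "HOL-Real_Asymp.Real_Asymp"
begin

section \<open>Differentiability of absolutely continuous functions\<close>

text \<open>Between the ends the cut-off functions are arbitrary, while the defect spaces are fixed
  by a differential equation. The two sums can therefore only be compared modulo the minimal domain,
  which is what \<open>direct_sums_eq_mod\<close> expresses. The number 4n is forced: a boundary
  value is given by a power below n, one of two coefficients and one of two ends, and each family
  has just as many members, so independence modulo the kernel is all that must be checked for it. At
  the ends the obstacle is that u is unbounded. Because \<alpha>, \<beta> < 1, the function w (1 +
  u^2) is still integrable; this makes a and b converge and, through |f| \<le> |a| + |u| |b|,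
  carries square integrability from the n-th power down to f. Inside the interval the obstacle is
  that the derivative of order 2n exists only almost everywhere. Integration by parts therefore
  rests on Lebesgue's differentiation theorem and the fundamental theorem of calculus for absolutely
  continuous functions, derived here from the epsilon-delta definition by means of Vitali
  coverings.\<close>

definition incr :: "(real \<Rightarrow> 'a::real_normed_vector) \<Rightarrow> real set \<Rightarrow> 'a" where
  "incr f K = f (Sup K) - f (Inf K)"

lemma incr_Icc [simp]: "l \<le> r \<Longrightarrow> incr f {l..r} = f r - f l"
  by (simp add: incr_def)

section \<open>Divisions of an interval and the variation of a function\<close>

lemma division_of_Icc:
  fixes c d :: real
  assumes "D division_of {c..d}" "K \<in> D"
  obtains l r where "K = {l..r}" "l \<le> r" "c \<le> l" "r \<le> d"
proof -
  obtain l r where K: "K = {l..r}" using division_ofD(4)[OF assms] by (metis box_real(2))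
  then show thesis using that division_ofD(2,3)[OF assms] by auto
qed

lemma disjoint_Icc_division_of:
  assumes "finite p" "disjoint p" "\<And>J. J \<in> p \<Longrightarrow> \<exists>l r. J = {l..r::real} \<and> l < r"
  shows "p division_of \<Union>p"
proof (rule division_ofI)
  show "J \<noteq> {}" "\<exists>a b. J = cbox a b" if "J \<in> p" for J using assms(3)[OF that] by auto
  show "interior K1 \<inter> interior K2 = {}" if "K1 \<in> p" "K2 \<in> p" "K1 \<noteq> K2" for K1 K2
  proof -
    have "K1 \<inter> K2 = {}" using assms(2) that by (auto simp: disjoint_def)
    then show ?thesis using interior_subset[of K1] interior_subset[of K2] by blast
  qed
qed (use assms in auto)

lemma sum_incr_division:
  assumes "D division_of {c..d}" "c \<le> d"
  shows "(\<Sum>K\<in>D. incr f K) = f d - f c"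
proof -
  let ?p = "(\<lambda>K. (Inf K, K)) ` D"
  have K: "\<exists>l r. K = {l..r} \<and> l \<le> r" if "K \<in> D" for K
    using division_of_Icc[OF assms(1) that] by metis
  have "?p tagged_division_of {c..d}"
    unfolding tagged_division_of
  proof (intro conjI allI impI)
    show "finite ?p" using division_ofD(1)[OF assms(1)] by simp
    show "x \<in> L" "L \<subseteq> {c..d}" "\<exists>a b. L = cbox a b" if "(x, L) \<in> ?p" for x L
      using K[of L] division_ofD(2,4)[OF assms(1), of L] that by auto
    show "interior L \<inter> interior L' = {}" if "(x, L) \<in> ?p \<and> (x', L') \<in> ?p \<and> (x, L) \<noteq> (x', L')" for x L x' L'
      using division_ofD(5)[OF assms(1), of L L'] that by auto
    have "{L. \<exists>x. (x, L) \<in> ?p} = D" by auto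
    then show "\<Union>{L. \<exists>x. (x, L) \<in> ?p} = {c..d}" using division_ofD(6)[OF assms(1)] by simp
  qed
  from additive_tagged_division_1[OF assms(2) this, of f]
  show ?thesis
    by (subst (asm) sum.reindex) (auto simp: inj_on_def incr_def)
qed

text \<open>If f moves on J against its increment over the cell K, the rest of K has to make up for
  it. Cutting K at such intervals raises the sum of absolute increments by twice the increments over
  them, hence by at least 2 k times their length.\<close>

lemma division_refine_opposite:
  fixes f :: "real \<Rightarrow> real"
  assumes D: "D division_of {c..d}" and p: "finite p" "disjoint p"
    and pI: "\<And>J. J \<in> p \<Longrightarrow> \<exists>l r. J = {l..r} \<and> l < r"
    and pK: "\<And>J. J \<in> p \<Longrightarrow> \<exists>K\<in>D. J \<subseteq> interior K"
    and opp: "\<And>J K. J \<in> p \<Longrightarrow> K \<in> D \<Longrightarrow> J \<subseteq> interior K \<Longrightarrow>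
                (if incr f K < 0 then 0 \<le> incr f J else incr f J \<le> 0) \<and> k * measure lebesgue J \<le> \<bar>incr f J\<bar>"
  obtains D' where "D' division_of {c..d}"
    "(\<Sum>K\<in>D. \<bar>incr f K\<bar>) + 2 * k * (\<Sum>J\<in>p. measure lebesgue J) \<le> (\<Sum>K\<in>D'. \<bar>incr f K\<bar>)"
proof -
  define pp where "pp K = {J \<in> p. J \<subseteq> interior K}" for K
  have DI: "\<exists>l r. K = {l..r} \<and> l \<le> r" if "K \<in> D" for K
    using division_of_Icc[OF D that] by metis
  have pne: "J \<noteq> {}" if "J \<in> p" for J using pI[OF that] by auto
  have "\<exists>q. pp K \<subseteq> q \<and> q division_of K" if KD: "K \<in> D" for K
  proof -
    obtain l r where K: "K = {l..r}" "l \<le> r" using DI[OF KD] by blast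
    have "pp K division_of \<Union>(pp K)"
      using p pI by (intro disjoint_Icc_division_of) (auto simp: pp_def pairwise_def)
    moreover have "\<Union>(pp K) \<subseteq> cbox l r"
      using interior_subset[of K] K by (auto simp: pp_def)
    ultimately show ?thesis
      using partial_division_extend_interval[of "pp K" l r] K by (metis box_real(2))
  qed
  then obtain q where q: "\<And>K. K \<in> D \<Longrightarrow> pp K \<subseteq> q K" "\<And>K. K \<in> D \<Longrightarrow> q K division_of K"
    by metis
  have qI: "\<exists>l r. J = {l..r} \<and> l \<le> r" if "K \<in> D" "J \<in> q K" for K J
    using division_ofD(3,4)[OF q(2)[OF that(1)] that(2)] by (metis atLeastatMost_empty_iff2 box_real(2))
  have disj: "interior K1 \<inter> interior K2 = {}" if "K1 \<in> D" "K2 \<in> D" "K1 \<noteq> K2" for K1 K2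
    using division_ofD(5)[OF D] that by blast
  define D' where "D' = (\<Union>K\<in>D. q K)"
  have D': "D' division_of {c..d}"
  proof (rule division_ofI)
    show "finite D'" using division_ofD(1)[OF D] division_ofD(1)[OF q(2)] by (auto simp: D'_def)
    show "J \<subseteq> {c..d}" if "J \<in> D'" for J
      using that division_ofD(2)[OF D] division_ofD(2)[OF q(2)] unfolding D'_def by blast
    show "J \<noteq> {}" "\<exists>a b. J = cbox a b" if "J \<in> D'" for J
      using that division_ofD(3,4)[OF q(2)] unfolding D'_def by blast+
    show "interior J1 \<inter> interior J2 = {}" if J: "J1 \<in> D'" "J2 \<in> D'" "J1 \<noteq> J2" for J1 J2
    proof -
      obtain K1 K2 where K: "K1 \<in> D" "J1 \<in> q K1" "K2 \<in> D" "J2 \<in> q K2"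
        using J unfolding D'_def by blast
      show ?thesis
      proof (cases "K1 = K2")
        case True then show ?thesis using K J division_ofD(5)[OF q(2)] by blast
      next
        case False
        have "J1 \<subseteq> K1" "J2 \<subseteq> K2" using K division_ofD(2)[OF q(2)] by blast+
        then have "interior J1 \<subseteq> interior K1" "interior J2 \<subseteq> interior K2" by (simp_all add: interior_mono)
        then show ?thesis using disj[OF K(1,3) False] by blast
      qed
    qed
    have "\<Union>D' = (\<Union>K\<in>D. \<Union>(q K))" by (auto simp: D'_def)
    also have "\<dots> = \<Union>D" using division_ofD(6)[OF q(2)] by simp
    finally show "\<Union>D' = {c..d}" using division_ofD(6)[OF D] by simp
  qed
  have D'_sum: "(\<Sum>J\<in>D'. \<bar>incr f J\<bar>) = (\<Sum>K\<in>D. \<Sum>J\<in>q K. \<bar>incr f J\<bar>)"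
  proof -
    have "D' = snd ` Sigma D q" unfolding D'_def by (rule set_eqI) (auto simp: image_iff Bex_def)
    then have "(\<Sum>J\<in>D'. \<bar>incr f J\<bar>) = (\<Sum>J\<in>snd ` Sigma D q. \<bar>incr f J\<bar>)" by simp
    also have "\<dots> = (\<Sum>z\<in>Sigma D q. \<bar>incr f (snd z)\<bar>)"
    proof (subst sum.reindex_nontrivial)
      show "finite (Sigma D q)"
        using division_ofD(1)[OF D] division_ofD(1)[OF q(2)] by auto
      \<comment> \<open>A piece shared by two cells has empty interior, so it is a single point and
        contributes 0; the sum over the union may be taken cell by cell.\<close>
      fix z z' assume z: "z \<in> Sigma D q" "z' \<in> Sigma D q" "z \<noteq> z'" "snd z = snd z'"
      obtain K J K' where zz: "z = (K,J)" "z' = (K',J)" using prod.exhaust[of z] prod.exhaust[of z'] z(4) by (metis snd_conv)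
      have K: "K \<in> D" "K' \<in> D" "K \<noteq> K'" "J \<in> q K" "J \<in> q K'" using z zz by auto
      have "J \<subseteq> K" "J \<subseteq> K'" using K division_ofD(2)[OF q(2)] by blast+
      then have "interior J \<subseteq> interior K" "interior J \<subseteq> interior K'" by (simp_all add: interior_mono)
      then have "interior J = {}" using disj[OF K(1-3)] by blast
      moreover obtain l r where "J = {l..r}" "l \<le> r" using qI K by blast
      ultimately show "\<bar>incr f (snd z)\<bar> = 0" using zz by (auto simp: incr_def)
    qed simp
    also have "\<dots> = (\<Sum>K\<in>D. \<Sum>J\<in>q K. \<bar>incr f J\<bar>)"
      by (subst sum.Sigma) (use division_ofD(1)[OF D] division_ofD(1)[OF q(2)] in \<open>auto simp: case_prod_beta\<close>)
    finally show ?thesis .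
  qed
  have one: "\<bar>incr f K\<bar> + 2 * k * (\<Sum>J\<in>pp K. measure lebesgue J) \<le> (\<Sum>J\<in>q K. \<bar>incr f J\<bar>)" if K: "K \<in> D" for K
  proof -
    obtain l r where lr: "K = {l..r}" "l \<le> r" using DI[OF K] by blast
    have fin: "finite (q K)" using division_ofD(1)[OF q(2)[OF K]] .
    \<comment> \<open>Multiplying by the sign of the increment of K replaces the absolute value by a
      telescoping sum. The pieces in \<open>pp K\<close> enter it with the wrong sign and so lose
      twice their size.\<close>
    define s where "s = (if incr f K < 0 then -1 else 1::real)"
    have s: "\<bar>incr f K\<bar> = s * incr f K" "\<bar>s\<bar> = 1" by (auto simp: s_def)
    have "\<bar>incr f K\<bar> \<le> (\<Sum>J\<in>q K. s * incr f J)"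
      using sum_incr_division[of "q K" l r f] q(2)[OF K] lr s by (simp add: sum_distrib_left[symmetric])
    moreover have "s * incr f J \<le> \<bar>incr f J\<bar> - (if J \<in> pp K then 2 * k * measure lebesgue J else 0)" if "J \<in> q K" for J
    proof (cases "J \<in> pp K")
      case True
      then have o: "if incr f K < 0 then 0 \<le> incr f J else incr f J \<le> 0"
          "k * measure lebesgue J \<le> \<bar>incr f J\<bar>"
        using opp[of J K] K by (auto simp: pp_def)
      then have "s * incr f J = - \<bar>incr f J\<bar>"
        by (auto simp: s_def split: if_splits)
      then show ?thesis using o True by auto
    qed (auto simp: s_def)
    ultimately have "\<bar>incr f K\<bar> \<le> (\<Sum>J\<in>q K. \<bar>incr f J\<bar> - (if J \<in> pp K then 2 * k * measure lebesgue J else 0))"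
      by (meson order_trans sum_mono)
    also have "\<dots> = (\<Sum>J\<in>q K. \<bar>incr f J\<bar>) - 2 * k * (\<Sum>J\<in>pp K. measure lebesgue J)"
      using fin q(1)[OF K] by (simp add: sum_subtractf sum.inter_restrict[symmetric] Int_absorb1 sum_distrib_left)
    finally show ?thesis by simp
  qed
  show ?thesis
  proof (rule that[OF D'])
    have "(\<Sum>J\<in>p. measure lebesgue J) = (\<Sum>K\<in>D. \<Sum>J\<in>pp K. measure lebesgue J)"
    proof -
      have finpp: "\<forall>K\<in>D. finite (pp K)" using p by (simp add: pp_def)
      have "p = (\<Union>K\<in>D. pp K)" using pK by (auto simp: pp_def)
      moreover have "pp K \<inter> pp K' = {}" if "K \<in> D" "K' \<in> D" "K \<noteq> K'" for K K'
      proof -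
        have "J \<noteq> {}" if "J \<in> pp K" "J \<in> pp K'" for J using pne that by (simp add: pp_def)
        moreover have "J \<subseteq> interior K \<inter> interior K'" if "J \<in> pp K" "J \<in> pp K'" for J
          using that by (simp add: pp_def)
        ultimately show ?thesis unfolding disj[OF that] by blast
      qed
      ultimately show ?thesis
        using division_ofD(1)[OF D] p(1) finpp by (simp add: sum.UNION_disjoint)
    qed
    then show "(\<Sum>K\<in>D. \<bar>incr f K\<bar>) + 2 * k * (\<Sum>J\<in>p. measure lebesgue J) \<le> (\<Sum>K\<in>D'. \<bar>incr f K\<bar>)"
      unfolding D'_sum using sum_mono[of D "\<lambda>K. \<bar>incr f K\<bar> + 2 * k * (\<Sum>J\<in>pp K. measure lebesgue J)", OF one]
      by (simp add: sum.distrib sum_distrib_left)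
  qed
qed

text \<open>Vitali's theorem selects countably many disjoint members of \<open>\<J>\<close> that
  cover S up to a null set. The bound on finite subfamilies passes to their union, and T stands in
  for the outer measure of S.\<close>

lemma Vitali_outer_bound:
  fixes S :: "real set"
  assumes I: "\<And>J. J \<in> \<J> \<Longrightarrow> \<exists>l r. J = {l..r} \<and> l < r"
    and cov: "\<And>x \<delta>. x \<in> S \<Longrightarrow> 0 < \<delta> \<Longrightarrow> \<exists>J\<in>\<J>. x \<in> J \<and> measure lebesgue J < \<delta>"
    and B: "\<And>p. finite p \<Longrightarrow> p \<subseteq> \<J> \<Longrightarrow> disjoint p \<Longrightarrow> (\<Sum>J\<in>p. measure lebesgue J) \<le> B"
  obtains T where "S \<subseteq> T" "T \<in> lmeasurable" "measure lebesgue T \<le> B"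
proof -
  define a r where "a J = (Inf J + Sup J) / 2" and "r J = (Sup J - Inf J) / 2" for J :: "real set"
  have ball: "cball (a J) (r J) = J" "measure lebesgue J = 2 * r J" "r J > 0" if "J \<in> \<J>" for J
  proof -
    obtain u v where J: "J = {u..v}" "u < v" using I \<open>J \<in> \<J>\<close> by blast
    then show "r J > 0" "measure lebesgue J = 2 * r J" by (auto simp: r_def)
    show "cball (a J) (r J) = J"
      using J by (auto simp: cball_eq_atLeastAtMost a_def r_def field_simps)
  qed
  have cov': "\<exists>J. J \<in> \<J> \<and> x \<in> cball (a J) (r J) \<and> r J < \<delta>" if x: "x \<in> S" "0 < \<delta>" for x \<delta>
  proof -
    obtain J where J: "J \<in> \<J>" "x \<in> J" "measure lebesgue J < \<delta>" using cov[OF x] by blast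
    have "2 * r J < \<delta>" "0 < r J" using J ball(2,3)[OF J(1)] by simp_all
    then have "r J < \<delta>" by linarith
    then show ?thesis using J ball(1)[OF J(1)] by (intro exI[of _ J]) simp
  qed
  obtain C where C: "countable C" "C \<subseteq> \<J>"
     "pairwise (\<lambda>i j. disjnt (cball (a i) (r i)) (cball (a j) (r j))) C"
     "negligible (S - (\<Union>i\<in>C. cball (a i) (r i)))"
    by (rule Vitali_covering_theorem_cballs[of \<J> r S a]) (use ball(3) cov' in auto)
  have C_eq: "(\<Union>i\<in>C. cball (a i) (r i)) = \<Union>C" using ball(1) C(2) by auto
  have pw: "disjoint C"
  proof (rule pairwiseI)
    fix i j assume ij: "i \<in> C" "j \<in> C" "i \<noteq> j"
    then have "disjnt (cball (a i) (r i)) (cball (a j) (r j))" using C(3) by (simp add: pairwise_def)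
    moreover have "cball (a i) (r i) = i" "cball (a j) (r j) = j" using ij C(2) ball(1) by blast+
    ultimately show "disjnt i j" by simp
  qed
  have meas: "J \<in> lmeasurable" if "J \<in> C" for J
    using I[of J] C(2) that by auto
  have fin: "measure lebesgue (\<Union>p) \<le> B" if p: "p \<subseteq> C" "finite p" for p
  proof -
    have "measure lebesgue (\<Union>p) \<le> (\<Sum>J\<in>p. measure lebesgue J)"
      using p meas by (intro measure_Union_le) (auto simp: fmeasurableD)
    also have "\<dots> \<le> B" using B[of p] p C(2) pw pairwise_subset by blast
    finally show ?thesis .
  qed
  have "\<Union>C \<in> lmeasurable" "measure lebesgue (\<Union>C) \<le> B"
    using fmeasurable_Union_bound[OF C(1), of lebesgue B] measure_Union_bound[OF C(1), of lebesgue B] meas fin by blast+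
  moreover have N: "S - \<Union>C \<in> lmeasurable" "measure lebesgue (S - \<Union>C) = 0"
    using C(4) C_eq by (simp_all add: negligible_imp_measurable negligible_imp_measure0)
  ultimately have "(S - \<Union>C) \<union> \<Union>C \<in> lmeasurable" "measure lebesgue ((S - \<Union>C) \<union> \<Union>C) \<le> B"
    using measure_Un_le[of "S - \<Union>C" lebesgue "\<Union>C"] by (blast intro: fmeasurable.Un, simp add: fmeasurableD)
  then show ?thesis
    by (intro that) auto
qed

text \<open>Encodes information on the Dini derivates at x as a supply of arbitrarily short
  intervals around x, which is the input of a Vitali covering. The point x may be an end of the
  interval, so one-sided secants count as well.\<close>

definition arb_slope :: "(real \<Rightarrow> real) \<Rightarrow> real \<Rightarrow> (real \<Rightarrow> real \<Rightarrow> bool) \<Rightarrow> bool" where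
  "arb_slope f x Q \<longleftrightarrow> (\<forall>\<delta>>0. \<exists>l r. l < r \<and> l \<le> x \<and> x \<le> r \<and> r - l < \<delta> \<and> Q (f r - f l) (r - l))"

lemma arb_slope_within:
  assumes "arb_slope f x Q" "open U" "x \<in> U" "0 < \<delta>"
  obtains l r where "l < r" "x \<in> {l..r}" "{l..r} \<subseteq> U" "r - l < \<delta>" "Q (f r - f l) (r - l)"
proof -
  obtain e where e: "e > 0" "ball x e \<subseteq> U" using assms(2,3) openE by blast
  obtain l r where lr: "l < r" "l \<le> x" "x \<le> r" "r - l < min e \<delta>" "Q (f r - f l) (r - l)"
    using assms(1,4) e(1) unfolding arb_slope_def by (metis min_less_iff_conj)
  have "{l..r} \<subseteq> ball x e" using lr by (auto simp: dist_real_def)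
  then show ?thesis using that lr e by (metis atLeastAtMost_iff min_less_iff_conj order_trans)
qed

definition var_bound :: "(real \<Rightarrow> real) \<Rightarrow> real \<Rightarrow> real \<Rightarrow> real \<Rightarrow> bool" where
  "var_bound f c d B \<longleftrightarrow> (\<forall>D. D division_of {c..d} \<longrightarrow> (\<Sum>K\<in>D. \<bar>incr f K\<bar>) \<le> B)"

text \<open>A division almost attaining the total variation cannot be refined by many intervals on
  which \<open>f\<close> moves against the direction of its cell; Vitali's covering theorem turns this into
  a bound for the measure of the set of points with slopes of both signs.\<close>

lemma negligible_opposite_slopes:
  assumes B: "var_bound f c d B" and cd: "c < d" and k: "k > 0"
  shows "negligible {x \<in> {c<..<d}. arb_slope f x (\<lambda>y t. y \<ge> k * t) \<and> arb_slope f x (\<lambda>y t. y \<le> - k * t)}"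
    (is "negligible ?S")
  unfolding negligible_outer_le
proof (intro allI impI)
  fix e :: real assume e: "e > 0"
  define W where "W = {(\<Sum>K\<in>D. \<bar>incr f K\<bar>) |D. D division_of {c..d}}"
  have "{{c..d}} division_of {c..d}" using cd by (auto simp: division_of_def)
  then have W: "W \<noteq> {}" "bdd_above W" using B by (auto simp: W_def var_bound_def bdd_above_def)
  \<comment> \<open>The slack 2 k e is exactly what a refinement by opposite intervals of total
    length e would gain; more length than e would exceed the supremum.\<close>
  obtain w where "w \<in> W" "Sup W - 2 * k * e < w"
    using less_cSupE[of "Sup W - 2 * k * e" W] W k e by auto
  then obtain D where D: "D division_of {c..d}" "Sup W - 2 * k * e < (\<Sum>K\<in>D. \<bar>incr f K\<bar>)"
    unfolding W_def by blast
  \<comment> \<open>Off this finite set a point lies in the interior of its cell, so short intervals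
    around it stay inside one cell.\<close>
  define P where "P = (\<Union>K\<in>D. {Inf K, Sup K})"
  have P: "finite P" using division_ofD(1)[OF D(1)] by (simp add: P_def)
  define \<J> where "\<J> = {J. (\<exists>l r. J = {l..r} \<and> l < r \<and> k * (r - l) \<le> \<bar>f r - f l\<bar>) \<and>
      (\<exists>K\<in>D. J \<subseteq> interior K \<and> (if incr f K < 0 then 0 \<le> incr f J else incr f J \<le> 0))}"
  obtain T where T: "?S - P \<subseteq> T" "T \<in> lmeasurable" "measure lebesgue T \<le> e"
  proof (rule Vitali_outer_bound[of \<J> "?S - P" e])
    show "\<exists>l r. J = {l..r} \<and> l < r" if "J \<in> \<J>" for J using that by (auto simp: \<J>_def)
    show "\<exists>J\<in>\<J>. x \<in> J \<and> measure lebesgue J < \<delta>" if x: "x \<in> ?S - P" and \<delta>: "0 < \<delta>" for x \<delta>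
    proof -
      have "x \<in> \<Union>D" using x division_ofD(6)[OF D(1)] by auto
      then obtain K where K: "K \<in> D" "x \<in> K" by blast
      then obtain a b where ab: "K = {a..b}" using division_ofD(4)[OF D(1)] by (metis box_real(2))
      have "a \<noteq> x" "b \<noteq> x" using x K ab unfolding P_def by force+
      then have xi: "x \<in> interior K" using K ab by (auto simp: interior_atLeastAtMost_real)
      obtain l r where "l < r" "x \<in> {l..r}" "{l..r} \<subseteq> interior K" "r - l < \<delta>"
        "if incr f K < 0 then f r - f l \<ge> k * (r - l) else f r - f l \<le> - k * (r - l)"
      proof (cases "incr f K < 0")
        case True
        then show ?thesis
          using arb_slope_within[OF _ open_interior xi \<delta>, of f "\<lambda>y t. y \<ge> k * t"] x that by auto
      next
        case False
        then show ?thesis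
          using arb_slope_within[OF _ open_interior xi \<delta>, of f "\<lambda>y t. y \<le> - k * t"] x that by auto
      qed note lr = this
      have "k * (r - l) > 0" using lr k by simp
      then have "k * (r - l) \<le> \<bar>f r - f l\<bar>" using lr(5) by (auto split: if_splits)
      then have "{l..r} \<in> \<J>" using lr K \<open>k * (r - l) > 0\<close> by (auto simp: \<J>_def split: if_splits intro!: exI[of _ l] exI[of _ r] bexI[of _ K])
      then show ?thesis using lr by (intro bexI[of _ "{l..r}"]) auto
    qed
    show "(\<Sum>J\<in>p. measure lebesgue J) \<le> e" if p: "finite p" "p \<subseteq> \<J>" "disjoint p" for p
    proof -
      obtain D' where D': "D' division_of {c..d}"
        "(\<Sum>K\<in>D. \<bar>incr f K\<bar>) + 2 * k * (\<Sum>J\<in>p. measure lebesgue J) \<le> (\<Sum>K\<in>D'. \<bar>incr f K\<bar>)"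
      proof (rule division_refine_opposite[OF D(1) p(1,3), of f k])
        fix J assume J: "J \<in> p"
        then have J': "J \<in> \<J>" using p by blast
        then obtain l r K0 where lr: "J = {l..r}" "l < r" "k * (r - l) \<le> \<bar>f r - f l\<bar>"
          and K0: "K0 \<in> D" "J \<subseteq> interior K0" "if incr f K0 < 0 then 0 \<le> incr f J else incr f J \<le> 0"
          unfolding \<J>_def by blast
        show "\<exists>l r. J = {l..r} \<and> l < r" "\<exists>K\<in>D. J \<subseteq> interior K" using lr K0 by auto
        fix K assume K: "K \<in> D" "J \<subseteq> interior K"
        have "K = K0"
        proof (rule ccontr)
          assume "K \<noteq> K0"
          then have "J \<subseteq> {}" using division_ofD(5)[OF D(1) K(1) K0(1)] K(2) K0(2) by blast
          then show False using lr by auto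
        qed
        then show "(if incr f K < 0 then 0 \<le> incr f J else incr f J \<le> 0) \<and> k * measure lebesgue J \<le> \<bar>incr f J\<bar>"
          using K0 lr by auto
      qed
      have "(\<Sum>K\<in>D'. \<bar>incr f K\<bar>) \<le> Sup W" using W(2) D'(1) by (intro cSup_upper) (auto simp: W_def)
      then have "2 * k * (\<Sum>J\<in>p. measure lebesgue J) < 2 * k * e" using D' D by linarith
      then show ?thesis using k by simp
    qed
  qed
  have "negligible P" using P by (rule negligible_finite)
  then have "measure lebesgue (P \<union> T) \<le> e" "P \<union> T \<in> lmeasurable"
    using T measure_Un_le[of P lebesgue T]
    by (auto simp: negligible_imp_measurable negligible_imp_measure0 fmeasurableD intro!: fmeasurable.Un)
  then show "\<exists>T. ?S \<subseteq> T \<and> T \<in> lmeasurable \<and> measure lebesgue T \<le> e"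
    using T(1) by (intro exI[of _ "P \<union> T"]) blast
qed

text \<open>Disjoint intervals with slope at least k in absolute value extend to a division with
  variation at least k times their total length. That length is thus at most B / k, and k is
  arbitrary.\<close>

lemma negligible_infinite_slopes:
  assumes B: "var_bound f c d B" and cd: "c < d"
  shows "negligible {x \<in> {c<..<d}. \<forall>k>0. arb_slope f x (\<lambda>y t. \<bar>y\<bar> \<ge> k * t)}"
    (is "negligible ?S")
  unfolding negligible_outer_le
proof (intro allI impI)
  fix e :: real assume e: "e > 0"
  have "{{c..d}} division_of {c..d}" using cd by (auto simp: division_of_def)
  then have B0: "B \<ge> 0" using B cd unfolding var_bound_def by (metis (no_types, lifting) abs_ge_zero order_trans sum_nonneg)
  \<comment> \<open>Chosen so that B / k \<le> e; the summand 1 keeps k positive when B = 0.\<close>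
  define k where "k = B / e + 1"
  have k: "k > 0" "B \<le> k * e" using B0 e by (auto simp: k_def field_simps)
  define \<J> where "\<J> = {J. \<exists>l r. J = {l..r} \<and> l < r \<and> k * (r - l) \<le> \<bar>f r - f l\<bar> \<and> J \<subseteq> {c<..<d}}"
  obtain T where T: "?S \<subseteq> T" "T \<in> lmeasurable" "measure lebesgue T \<le> e"
  proof (rule Vitali_outer_bound[of \<J> "?S" e])
    show "\<exists>l r. J = {l..r} \<and> l < r" if "J \<in> \<J>" for J using that by (auto simp: \<J>_def)
    show "\<exists>J\<in>\<J>. x \<in> J \<and> measure lebesgue J < \<delta>" if x: "x \<in> ?S" and \<delta>: "0 < \<delta>" for x \<delta>
    proof -
      have as: "arb_slope f x (\<lambda>y t. \<bar>y\<bar> \<ge> k * t)" and xi: "x \<in> {c<..<d}" using x k by auto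
      obtain l r where lr: "l < r" "x \<in> {l..r}" "{l..r} \<subseteq> {c<..<d}" "r - l < \<delta>" "\<bar>f r - f l\<bar> \<ge> k * (r - l)"
        using arb_slope_within[OF as open_greaterThanLessThan xi \<delta>] by metis
      then have "{l..r} \<in> \<J>" unfolding \<J>_def by blast
      then show ?thesis using lr by (intro bexI[of _ "{l..r}"]) auto
    qed
    show "(\<Sum>J\<in>p. measure lebesgue J) \<le> e" if p: "finite p" "p \<subseteq> \<J>" "disjoint p" for p
    proof -
      have pI: "\<exists>l r. J = {l..r} \<and> l < r \<and> k * (r - l) \<le> \<bar>f r - f l\<bar> \<and> J \<subseteq> {c<..<d}" if "J \<in> p" for J
        using p that unfolding \<J>_def by blast
      have "p division_of \<Union>p" using pI by (intro disjoint_Icc_division_of p(1,3)) blast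
      moreover have "\<Union>p \<subseteq> cbox c d" using pI by force
      ultimately obtain q where q: "p \<subseteq> q" "q division_of {c..d}"
        using partial_division_extend_interval by (metis box_real(2))
      have "k * (\<Sum>J\<in>p. measure lebesgue J) \<le> (\<Sum>J\<in>p. \<bar>incr f J\<bar>)"
        unfolding sum_distrib_left
      proof (rule sum_mono)
        fix J assume "J \<in> p"
        then obtain l r where "J = {l..r}" "l < r" "k * (r - l) \<le> \<bar>f r - f l\<bar>" using pI by blast
        then show "k * measure lebesgue J \<le> \<bar>incr f J\<bar>" by simp
      qed
      also have "\<dots> \<le> (\<Sum>J\<in>q. \<bar>incr f J\<bar>)"
        using q division_ofD(1)[OF q(2)] by (intro sum_mono2) auto
      also have "\<dots> \<le> B" using B q by (simp add: var_bound_def)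
      finally have "k * (\<Sum>J\<in>p. measure lebesgue J) \<le> k * e" using k by linarith
      then show ?thesis using k by simp
    qed
  qed
  then show "\<exists>T. ?S \<subseteq> T \<and> T \<in> lmeasurable \<and> measure lebesgue T \<le> e" by blast
qed

lemma frequently_slope:
  fixes f :: "real \<Rightarrow> real"
  assumes "\<exists>\<^sub>F y in at x. P ((f y - f x) / (y - x))"
  shows "arb_slope f x (\<lambda>u t. P (u / t))"
  unfolding arb_slope_def
proof (intro allI impI)
  fix \<delta> :: real assume d: "\<delta> > 0"
  have "\<exists>y. y \<noteq> x \<and> dist y x < \<delta> \<and> P ((f y - f x) / (y - x))"
    using assms d by (auto simp: frequently_at)
  then obtain y where y: "y \<noteq> x" "\<bar>y - x\<bar> < \<delta>" "P ((f y - f x) / (y - x))" by (auto simp: dist_real_def)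
  show "\<exists>l r. l < r \<and> l \<le> x \<and> x \<le> r \<and> r - l < \<delta> \<and> P ((f r - f l) / (r - l))"
  proof (cases "x < y")
    case True then show ?thesis using y by (intro exI[of _ x] exI[of _ y]) auto
  next
    case False
    have "(f y - f x) / (y - x) = (f x - f y) / (x - y)"
      by (metis minus_diff_eq minus_divide_divide)
    then show ?thesis using y False by (intro exI[of _ y] exI[of _ x]) auto
  qed
qed

lemma arb_slope_mono:
  assumes "arb_slope f x Q" "\<And>l r. l < r \<Longrightarrow> Q (f r - f l) (r - l) \<Longrightarrow> R (g r - g l) (r - l)"
  shows "arb_slope g x R"
  unfolding arb_slope_def
proof (intro allI impI)
  fix \<delta> :: real assume "\<delta> > 0"
  then obtain l r where "l < r" "l \<le> x" "x \<le> r" "r - l < \<delta>" "Q (f r - f l) (r - l)"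
    using assms(1) unfolding arb_slope_def by blast
  then show "\<exists>l r. l < r \<and> l \<le> x \<and> x \<le> r \<and> r - l < \<delta> \<and> R (g r - g l) (r - l)"
    using assms(2) by blast
qed

text \<open>Either the lower and upper limit of the difference quotient differ and two rationals
  separate them, or they agree and the limit exists in the extended reals; then it fails to be a
  derivative only by being infinite. Rationals keep the later union countable.\<close>

lemma not_differentiable_slopes:
  fixes f :: "real \<Rightarrow> real"
  assumes nd: "\<not> f differentiable (at x)"
  shows "(\<forall>k>0. arb_slope f x (\<lambda>y t. \<bar>y\<bar> \<ge> k * t)) \<or>
    (\<exists>r s::rat. r < s \<and> arb_slope f x (\<lambda>y t. y \<le> of_rat r * t) \<and> arb_slope f x (\<lambda>y t. y \<ge> of_rat s * t))"
proof -
  let ?q = "\<lambda>y. (f y - f x) / (y - x)"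
  define L l where "L = Limsup (at x) (\<lambda>y. ereal (?q y))" and "l = Liminf (at x) (\<lambda>y. ereal (?q y))"
  have lL: "l \<le> L" unfolding l_def L_def by (rule Liminf_le_Limsup) simp
  show ?thesis
  proof (cases "l < L")
    case True
    then obtain r where r: "l < ereal (of_rat r)" "ereal (of_rat r) < L" using ereal_dense3 by blast
    then obtain s where s: "ereal (of_rat r) < ereal (of_rat s)" "ereal (of_rat s) < L" using ereal_dense3 by blast
    have "\<exists>\<^sub>F y in at x. ?q y < of_rat r"
    proof -
      have "\<not> ereal (of_rat r) \<le> l" using r by simp
      then obtain y where y: "y < ereal (of_rat r)" "\<not> (\<forall>\<^sub>F z in at x. y < ereal (?q z))"
        unfolding l_def le_Liminf_iff by blast
      then have "\<exists>\<^sub>F z in at x. ereal (?q z) \<le> y" by (simp add: frequently_def not_le)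
      then show ?thesis by (rule frequently_elim1) (use y in \<open>metis less_ereal.simps(1) order.strict_trans1\<close>)
    qed
    then have 1: "arb_slope f x (\<lambda>u t. u / t < of_rat r)" by (rule frequently_slope)
    have "\<exists>\<^sub>F y in at x. ?q y > of_rat s"
    proof -
      have "\<not> L \<le> ereal (of_rat s)" using s by simp
      then obtain y where y: "ereal (of_rat s) < y" "\<not> (\<forall>\<^sub>F z in at x. y > ereal (?q z))"
        unfolding L_def Limsup_le_iff by blast
      then have "\<exists>\<^sub>F z in at x. ereal (?q z) \<ge> y" by (simp add: frequently_def not_le)
      then show ?thesis by (rule frequently_elim1) (use y in \<open>metis less_ereal.simps(1) order.strict_trans2\<close>)
    qed
    then have 2: "arb_slope f x (\<lambda>u t. of_rat s < u / t)" by (rule frequently_slope)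
    have "r < s" using s by (simp add: of_rat_less)
    moreover have "arb_slope f x (\<lambda>y t. y \<le> of_rat r * t)"
      by (rule arb_slope_mono[OF 1]) (auto simp: field_simps)
    moreover have "arb_slope f x (\<lambda>y t. y \<ge> of_rat s * t)"
      by (rule arb_slope_mono[OF 2]) (auto simp: field_simps)
    ultimately show ?thesis by blast
  next
    case False
    then have eq: "l = L" using lL by simp
    then have lim: "((\<lambda>y. ereal (?q y)) \<longlongrightarrow> L) (at x)"
      using tendsto_iff_Liminf_eq_Limsup[of "at x" "\<lambda>y. ereal (?q y)" L] by (simp add: l_def L_def)
    have inf: "L = \<infinity> \<or> L = -\<infinity>"
    proof (rule ccontr)
      assume "\<not> ?thesis"
      then obtain D where "L = ereal D" by (cases L) auto
      then have "(?q \<longlongrightarrow> D) (at x)" using lim by simp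
      then have "(f has_field_derivative D) (at x)" by (simp add: has_field_derivative_iff)
      then show False using nd by (meson field_differentiable_def field_differentiable_imp_differentiable)
    qed
    have "arb_slope f x (\<lambda>y t. \<bar>y\<bar> \<ge> k * t)" if k: "k > 0" for k
    proof -
      have "\<forall>\<^sub>F y in at x. \<bar>?q y\<bar> \<ge> k"
        using inf
      proof
        assume "L = \<infinity>"
        then have "\<forall>\<^sub>F y in at x. ereal k < ereal (?q y)" using lim by (simp add: tendsto_PInfty)
        then show ?thesis by (rule eventually_mono) (metis abs_ge_self dual_order.trans less_ereal.simps(1) less_imp_le)
      next
        assume "L = -\<infinity>"
        then have "\<forall>\<^sub>F y in at x. ereal (?q y) < ereal (-k)" using lim tendsto_MInfty[of "\<lambda>y. ereal (?q y)" "at x"] by blast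
        then show ?thesis by (rule eventually_mono) (drule less_ereal.simps(1)[THEN iffD1], linarith)
      qed
      then have "\<exists>\<^sub>F y in at x. \<bar>?q y\<bar> \<ge> k" by (rule eventually_frequently[rotated]) simp
      then have "arb_slope f x (\<lambda>u t. \<bar>u / t\<bar> \<ge> k)" by (rule frequently_slope)
      then show ?thesis by (rule arb_slope_mono) (auto simp: field_simps)
    qed
    then show ?thesis by blast
  qed
qed

text \<open>Allows the graph to be tilted: subtracting the mean of two separated slopes makes them
  slopes of opposite sign.\<close>

lemma var_bound_diff_linear:
  assumes "var_bound f c d B" and cd: "c \<le> d"
  shows "var_bound (\<lambda>x. f x - m * x) c d (B + \<bar>m\<bar> * (d - c))"
  unfolding var_bound_def
proof (intro allI impI)
    fix D assume D: "D division_of {c..d}"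
    have I: "\<exists>l r. K = {l..r} \<and> l \<le> r" if "K \<in> D" for K
      using division_of_Icc[OF D that] by metis
    have "(\<Sum>K\<in>D. \<bar>incr (\<lambda>x. f x - m * x) K\<bar>) \<le> (\<Sum>K\<in>D. \<bar>incr f K\<bar> + \<bar>m\<bar> * incr (\<lambda>x. x) K)"
    proof (rule sum_mono)
      fix K assume "K \<in> D"
      then obtain l r where "K = {l..r}" "l \<le> r" using I by blast
      have "\<bar>(f r - f l) - m * (r - l)\<bar> \<le> \<bar>f r - f l\<bar> + \<bar>m\<bar> * (r - l)"
        using abs_triangle_ineq4[of "f r - f l" "m * (r - l)"] \<open>l \<le> r\<close> by (simp add: abs_mult)
      moreover have "incr (\<lambda>x. f x - m * x) K = (f r - f l) - m * (r - l)"
        using \<open>K = {l..r}\<close> \<open>l \<le> r\<close> by (simp add: right_diff_distrib)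
      ultimately show "\<bar>incr (\<lambda>x. f x - m * x) K\<bar> \<le> \<bar>incr f K\<bar> + \<bar>m\<bar> * incr (\<lambda>x. x) K"
        using \<open>K = {l..r}\<close> \<open>l \<le> r\<close> by simp
    qed
    also have "\<dots> \<le> B + \<bar>m\<bar> * (d - c)"
      using assms D sum_incr_division[OF D cd, of "\<lambda>x. x"]
      by (simp add: sum.distrib sum_distrib_left[symmetric] var_bound_def)
    finally show "(\<Sum>K\<in>D. \<bar>incr (\<lambda>x. f x - m * x) K\<bar>) \<le> B + \<bar>m\<bar> * (d - c)" .
qed

text \<open>Lebesgue's theorem for functions of bounded variation. For rationals r < s, subtracting
  (r + s) / 2 times x leaves slopes of both signs of size (s - r) / 2, and there are only countably
  many such pairs.\<close>

lemma var_bound_differentiable: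
  assumes B: "var_bound f c d B" and cd: "c < d"
  shows "negligible {x \<in> {c<..<d}. \<not> f differentiable (at x)}"
proof (rule negligible_subset)
  let ?A = "{x \<in> {c<..<d}. \<forall>k>0. arb_slope f x (\<lambda>y t. \<bar>y\<bar> \<ge> k * t)}"
  let ?m = "\<lambda>(r::rat, s::rat). (of_rat r + of_rat s) / 2 :: real"
  let ?k = "\<lambda>(r::rat, s::rat). (of_rat s - of_rat r) / 2 :: real"
  let ?g = "\<lambda>z x. f x - ?m z * x"
  let ?C = "\<lambda>z. {x \<in> {c<..<d}. arb_slope (?g z) x (\<lambda>y t. y \<ge> ?k z * t) \<and> arb_slope (?g z) x (\<lambda>y t. y \<le> - ?k z * t)}"
  have "negligible (?C z)" if "z \<in> {(r, s). r < s}" for z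
    using that by (intro negligible_opposite_slopes[OF var_bound_diff_linear[OF B] cd]) (use cd in \<open>auto simp: of_rat_less\<close>)
  then show "negligible (?A \<union> (\<Union>z\<in>{(r, s). r < s}. ?C z))"
    using negligible_infinite_slopes[OF B cd] by (intro negligible_Un negligible_countable_Union) auto
  show "{x \<in> {c<..<d}. \<not> f differentiable (at x)} \<subseteq> ?A \<union> (\<Union>z\<in>{(r, s). r < s}. ?C z)"
  proof
    fix x assume x: "x \<in> {x \<in> {c<..<d}. \<not> f differentiable (at x)}"
    then consider "\<forall>k>0. arb_slope f x (\<lambda>y t. \<bar>y\<bar> \<ge> k * t)" | r s :: rat where "r < s"
      "arb_slope f x (\<lambda>y t. y \<le> of_rat r * t)" "arb_slope f x (\<lambda>y t. y \<ge> of_rat s * t)"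
      using not_differentiable_slopes by blast
    then show "x \<in> ?A \<union> (\<Union>z\<in>{(r, s). r < s}. ?C z)"
    proof cases
      case 1 then show ?thesis using x by blast
    next
      case 2
      have "arb_slope (?g (r,s)) x (\<lambda>y t. y \<ge> ?k (r,s) * t)"
        by (rule arb_slope_mono[OF 2(3)]) (auto simp: field_simps)
      moreover have "arb_slope (?g (r,s)) x (\<lambda>y t. y \<le> - ?k (r,s) * t)"
        by (rule arb_slope_mono[OF 2(2)]) (auto simp: field_simps)
      ultimately have "x \<in> ?C (r,s)" using x by blast
      then show ?thesis using 2(1) by blast
    qed
  qed
qed

section \<open>Absolutely continuous functions: continuity, differentiability almost everywhere,
  fundamental theorem\<close>

lemma AC_onD:
  assumes "AC_on a b f" "\<epsilon> > 0"
  obtains \<delta> where "\<delta> > 0"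
    "\<And>(I::'i set) u v. finite I \<Longrightarrow> (\<And>i. i \<in> I \<Longrightarrow> a \<le> u i \<and> u i \<le> v i \<and> v i \<le> b) \<Longrightarrow>
        disjoint_family_on (\<lambda>i. {u i<..<v i}) I \<Longrightarrow> (\<Sum>i\<in>I. v i - u i) < \<delta> \<Longrightarrow>
        (\<Sum>i\<in>I. norm (f (v i) - f (u i))) < \<epsilon>"
proof -
  obtain \<delta> where \<delta>: "\<delta> > 0" and *: "\<And>(m::nat) u v.
        (\<forall>i<m. a \<le> u i \<and> u i \<le> v i \<and> v i \<le> b) \<Longrightarrow>
        disjoint_family_on (\<lambda>i. {u i<..<v i}) {..<m} \<Longrightarrow>
        (\<Sum>i<m. v i - u i) < \<delta> \<Longrightarrow> (\<Sum>i<m. norm (f (v i) - f (u i))) < \<epsilon>"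
    using assms unfolding AC_on_def by meson
  show thesis
  proof (rule that[OF \<delta>])
    fix I :: "'i set" and u v
    assume I: "finite I" "\<And>i. i \<in> I \<Longrightarrow> a \<le> u i \<and> u i \<le> v i \<and> v i \<le> b"
      and disj: "disjoint_family_on (\<lambda>i. {u i<..<v i}) I" and less: "(\<Sum>i\<in>I. v i - u i) < \<delta>"
    obtain h where h: "bij_betw h {..<card I} I"
      using ex_bij_betw_nat_finite[OF I(1)] by (auto simp: atLeast0LessThan)
    have mem: "h i \<in> I" if "i < card I" for i using h that by (auto simp: bij_betw_def)
    have "(\<Sum>i<card I. norm (f (v (h i)) - f (u (h i)))) < \<epsilon>"
    proof (rule *)
      show "\<forall>i<card I. a \<le> u (h i) \<and> u (h i) \<le> v (h i) \<and> v (h i) \<le> b" using I mem by blast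
      show "disjoint_family_on (\<lambda>i. {u (h i)<..<v (h i)}) {..<card I}"
        using disj h mem unfolding disjoint_family_on_def bij_betw_def inj_on_def by (metis lessThan_iff)
      show "(\<Sum>i<card I. v (h i) - u (h i)) < \<delta>"
        using less sum.reindex_bij_betw[OF h, of "\<lambda>i. v i - u i"] by simp
    qed
    then show "(\<Sum>i\<in>I. norm (f (v i) - f (u i))) < \<epsilon>"
      using sum.reindex_bij_betw[OF h, of "\<lambda>i. norm (f (v i) - f (u i))"] by simp
  qed
qed

lemma AC_on_continuous_on:
  assumes "AC_on a b f"
  shows "continuous_on {a..b} f"
  unfolding continuous_on_iff
proof (intro ballI allI impI)
  fix x and e :: real assume x: "x \<in> {a..b}" and e: "e > 0"
  obtain \<delta> where \<delta>: "\<delta> > 0" "\<And>(I::unit set) u v. finite I \<Longrightarrow>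
      (\<And>i. i \<in> I \<Longrightarrow> a \<le> u i \<and> u i \<le> v i \<and> v i \<le> b) \<Longrightarrow>
        disjoint_family_on (\<lambda>i. {u i<..<v i}) I \<Longrightarrow> (\<Sum>i\<in>I. v i - u i) < \<delta> \<Longrightarrow>
        (\<Sum>i\<in>I. norm (f (v i) - f (u i))) < e"
    using AC_onD[OF assms e] by blast
  have "dist (f y) (f x) < e" if y: "y \<in> {a..b}" "dist y x < \<delta>" for y
  proof -
    have "norm (f (max x y) - f (min x y)) < e"
      using \<delta>(2)[of UNIV "\<lambda>_. min x y" "\<lambda>_. max x y"] x y
      by (auto simp: UNIV_unit disjoint_family_on_def dist_real_def max_def min_def split: if_splits)
    then show ?thesis
      by (auto simp: dist_norm max_def norm_minus_commute split: if_splits)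
  qed
  then show "\<exists>d>0. \<forall>y\<in>{a..b}. dist y x < d \<longrightarrow> dist (f y) (f x) < e" using \<delta>(1) by blast
qed

text \<open>Congruence, sums, products and continuously differentiable functions are all reduced to
  this comparison of increments.\<close>

lemma AC_on_dominated:
  assumes "AC_on a b f" "AC_on a b g" "C \<ge> 0" "D \<ge> 0"
    and le: "\<And>x y. x \<in> {a..b} \<Longrightarrow> y \<in> {a..b} \<Longrightarrow> x \<le> y \<Longrightarrow>
      norm (h y - h x) \<le> C * norm (f y - f x) + D * norm (g y - g x)"
  shows "AC_on a b h"
  unfolding AC_on_def
proof (intro allI impI)
  fix \<epsilon> :: real assume e: "\<epsilon> > 0"
  define e1 e2 where "e1 = \<epsilon> / (2 * (C + 1))" and "e2 = \<epsilon> / (2 * (D + 1))"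
  have e12: "e1 > 0" "e2 > 0" "C * e1 \<le> \<epsilon> / 2" "D * e2 \<le> \<epsilon> / 2"
    using e assms(3,4) by (auto simp: e1_def e2_def field_simps)
  obtain d1 where d1: "d1 > 0" "\<And>(I::nat set) u v. finite I \<Longrightarrow> (\<And>i. i \<in> I \<Longrightarrow> a \<le> u i \<and> u i \<le> v i \<and> v i \<le> b) \<Longrightarrow>
        disjoint_family_on (\<lambda>i. {u i<..<v i}) I \<Longrightarrow> (\<Sum>i\<in>I. v i - u i) < d1 \<Longrightarrow>
        (\<Sum>i\<in>I. norm (f (v i) - f (u i))) < e1"
    using AC_onD[OF assms(1) e12(1)] by blast
  obtain d2 where d2: "d2 > 0" "\<And>(I::nat set) u v. finite I \<Longrightarrow> (\<And>i. i \<in> I \<Longrightarrow> a \<le> u i \<and> u i \<le> v i \<and> v i \<le> b) \<Longrightarrow>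
        disjoint_family_on (\<lambda>i. {u i<..<v i}) I \<Longrightarrow> (\<Sum>i\<in>I. v i - u i) < d2 \<Longrightarrow>
        (\<Sum>i\<in>I. norm (g (v i) - g (u i))) < e2"
    using AC_onD[OF assms(2) e12(2)] by blast
  have main: "(\<Sum>i<m. norm (h (v i) - h (u i))) \<le> C * (\<Sum>i<m. norm (f (v i) - f (u i))) + D * (\<Sum>i<m. norm (g (v i) - g (u i)))"
    if "\<forall>i<m. a \<le> u i \<and> u i \<le> v i \<and> v i \<le> b" for m :: nat and u v
  proof -
    have "(\<Sum>i<m. norm (h (v i) - h (u i))) \<le> (\<Sum>i<m. C * norm (f (v i) - f (u i)) + D * norm (g (v i) - g (u i)))"
      using that by (intro sum_mono le) fastforce+
    then show ?thesis by (simp add: sum.distrib sum_distrib_left)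
  qed
  show "\<exists>\<delta>>0. \<forall>(m::nat) u v.
        (\<forall>i<m. a \<le> u i \<and> u i \<le> v i \<and> v i \<le> b) \<and>
        disjoint_family_on (\<lambda>i. {u i<..<v i}) {..<m} \<and>
        (\<Sum>i<m. v i - u i) < \<delta>
        \<longrightarrow> (\<Sum>i<m. norm (h (v i) - h (u i))) < \<epsilon>"
  proof (intro exI[of _ "min d1 d2"] conjI allI impI)
    fix m :: nat and u v
    assume A: "(\<forall>i<m. a \<le> u i \<and> u i \<le> v i \<and> v i \<le> b) \<and>
        disjoint_family_on (\<lambda>i. {u i<..<v i}) {..<m} \<and> (\<Sum>i<m. v i - u i) < min d1 d2"
    have 1: "C * (\<Sum>i<m. norm (f (v i) - f (u i))) \<le> C * e1"
      using A d1(2)[of "{..<m}" u v] assms(3) by (intro mult_left_mono) auto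
    have 2: "D * (\<Sum>i<m. norm (g (v i) - g (u i))) \<le> D * e2"
      using A d2(2)[of "{..<m}" u v] assms(4) by (intro mult_left_mono) auto
    show "(\<Sum>i<m. norm (h (v i) - h (u i))) < \<epsilon>"
    proof (cases "C = 0 \<and> D = 0")
      case True
      then show ?thesis using main[of m u v] A e by auto
    next
      case False
      then have "C * e1 < \<epsilon> / 2 \<or> D * e2 < \<epsilon> / 2"
        using e assms(3,4) by (auto simp: e1_def e2_def field_simps)
      then show ?thesis using main[OF conjunct1[OF A]] 1 2 e12 by linarith
    qed
  qed (use d1 d2 in auto)
qed

text \<open>On an interval shorter than the delta belonging to epsilon = 1, the cells of any
  division form an admissible family, so the variation is at most 1. The function g is meant to be
  the real or imaginary part of f.\<close>

lemma AC_on_var_bound: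
  assumes "AC_on a b f" "a < b" "x \<in> {a..b}"
    and le: "\<And>x y. \<bar>g y - g x\<bar> \<le> norm (f y - f x)"
  obtains \<delta> where "\<delta> > 0" "\<And>c d. a \<le> c \<Longrightarrow> d \<le> b \<Longrightarrow> c \<le> d \<Longrightarrow> d - c < \<delta> \<Longrightarrow> var_bound g c d 1"
proof -
  obtain \<delta> where \<delta>: "\<delta> > 0" "\<And>(I::real set set) u v. finite I \<Longrightarrow>
      (\<And>i. i \<in> I \<Longrightarrow> a \<le> u i \<and> u i \<le> v i \<and> v i \<le> b) \<Longrightarrow>
        disjoint_family_on (\<lambda>i. {u i<..<v i}) I \<Longrightarrow> (\<Sum>i\<in>I. v i - u i) < \<delta> \<Longrightarrow>
        (\<Sum>i\<in>I. norm (f (v i) - f (u i))) < 1"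
    using AC_onD[OF assms(1) zero_less_one] by blast
  show thesis
  proof (rule that[OF \<delta>(1)])
    fix c d assume cd: "a \<le> c" "d \<le> b" "c \<le> d" "d - c < \<delta>"
    show "var_bound g c d 1"
      unfolding var_bound_def
    proof (intro allI impI)
      fix D assume D: "D division_of {c..d}"
      have DI: "\<exists>l r. K = {l..r} \<and> l \<le> r" if "K \<in> D" for K
        using division_of_Icc[OF D that] by metis
      have "(\<Sum>K\<in>D. norm (f (Sup K) - f (Inf K))) < 1"
      proof (rule \<delta>(2))
        show "finite D" using division_ofD(1)[OF D] .
        show "a \<le> Inf K \<and> Inf K \<le> Sup K \<and> Sup K \<le> b" if "K \<in> D" for K
          using DI[OF that] division_ofD(2)[OF D that] cd by auto
        show "disjoint_family_on (\<lambda>K. {Inf K<..<Sup K}) D"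
          unfolding disjoint_family_on_def
        proof (intro ballI impI)
          fix K L assume KL: "K \<in> D" "L \<in> D" "K \<noteq> L"
          have "interior K = {Inf K<..<Sup K}" "interior L = {Inf L<..<Sup L}"
            using DI[OF KL(1)] DI[OF KL(2)] by (auto simp: interior_atLeastAtMost_real)
          then show "{Inf K<..<Sup K} \<inter> {Inf L<..<Sup L} = {}" using division_ofD(5)[OF D KL] by simp
        qed
        show "(\<Sum>K\<in>D. Sup K - Inf K) < \<delta>"
          using sum_incr_division[OF D cd(3), of "\<lambda>x. x"] cd by (simp add: incr_def)
      qed
      moreover have "(\<Sum>K\<in>D. \<bar>incr g K\<bar>) \<le> (\<Sum>K\<in>D. norm (f (Sup K) - f (Inf K)))"
        by (intro sum_mono) (simp add: incr_def le)
      ultimately show "(\<Sum>K\<in>D. \<bar>incr g K\<bar>) \<le> 1" by simp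
    qed
  qed
qed

text \<open>The variation is controlled only on short intervals, hence the detour through local
  negligibility.\<close>

lemma AC_on_negligible_not_differentiable_real:
  assumes f: "AC_on a b f" and le: "\<And>x y. \<bar>g y - g x\<bar> \<le> norm (f y - f x)"
  shows "negligible {x \<in> {a<..<b}. \<not> g differentiable (at x)}"
    (is "negligible ?S")
  unfolding locally_negligible_alt[of ?S]
proof
  fix x assume x: "x \<in> ?S"
  then have ab: "a < b" "x \<in> {a..b}" by auto
  obtain \<delta> where \<delta>: "\<delta> > 0" "\<And>c d. a \<le> c \<Longrightarrow> d \<le> b \<Longrightarrow> c \<le> d \<Longrightarrow> d - c < \<delta> \<Longrightarrow> var_bound g c d 1"
    using AC_on_var_bound[OF f ab le] by metis
  define c d where "c = max a (x - \<delta> / 3)" and "d = min b (x + \<delta> / 3)"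
  have cd: "a \<le> c" "d \<le> b" "c < x" "x < d" "d - c < \<delta>" using x \<delta>(1) by (auto simp: c_def d_def)
  have "negligible {x \<in> {c<..<d}. \<not> g differentiable (at x)}"
    using \<delta>(2)[of c d] cd by (intro var_bound_differentiable[of g c d 1]) auto
  moreover have "{x \<in> {c<..<d}. \<not> g differentiable (at x)} = ?S \<inter> {c<..<d}" using cd by auto
  ultimately have "negligible (?S \<inter> {c<..<d})" by simp
  moreover have "openin (top_of_set ?S) (?S \<inter> {c<..<d})" by (rule openin_open_Int) simp
  moreover have "x \<in> ?S \<inter> {c<..<d}" using cd x by simp
  ultimately show "\<exists>U. openin (top_of_set ?S) U \<and> x \<in> U \<and> negligible U" by blast
qed

lemma AC_on_negligible_not_differentiable:
  assumes f: "AC_on a b f"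
  shows "negligible {x \<in> {a<..<b}. \<not> f differentiable (at x)}"
proof (rule negligible_subset)
  let ?N = "\<lambda>g. {x \<in> {a<..<b}. \<not> g differentiable (at x)}"
  show "negligible (?N (\<lambda>x. Re (f x)) \<union> ?N (\<lambda>x. Im (f x)))"
    by (intro negligible_Un AC_on_negligible_not_differentiable_real[OF f])
      (use abs_Re_le_cmod[of "f _ - f _"] abs_Im_le_cmod[of "f _ - f _"] in auto)
  show "?N f \<subseteq> ?N (\<lambda>x. Re (f x)) \<union> ?N (\<lambda>x. Im (f x))"
  proof -
    have "f differentiable (at x)" if "(\<lambda>x. Re (f x)) differentiable (at x)" "(\<lambda>x. Im (f x)) differentiable (at x)" for x
    proof -
      have "(\<lambda>x. complex_of_real (Re (f x)) + \<i> * complex_of_real (Im (f x))) differentiable (at x)"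
        using that by (intro derivative_intros) (auto simp: differentiable_def intro: bounded_linear.has_derivative[OF bounded_linear_of_real])
      then show ?thesis by (simp add: complex_eq[symmetric])
    qed
    then show ?thesis by blast
  qed
qed

text \<open>The tags in the exceptional null set are confined to an open set of small measure, where
  absolute continuity controls the increments.\<close>

lemma AC_on_FTC:
  assumes f: "AC_on a b f" and ab: "a \<le> b" and N: "negligible N"
    and deriv: "\<And>x. x \<in> {a..b} - N \<Longrightarrow> (f has_vector_derivative g x) (at x within {a..b})"
  shows "(g has_integral (f b - f a)) {a..b}"
proof -
  \<comment> \<open>Set to 0 on the exceptional set, so that a tag in N contributes nothing but an
    increment of f.\<close>
  define h where "h x = (if x \<in> N then 0 else g x)" for x
  have "(h has_integral (f b - f a)) {a..b}"
    unfolding has_integral_real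
  proof (intro allI impI)
    fix e :: real assume e: "e > 0"
    obtain \<delta> where \<delta>: "\<delta> > 0" "\<And>(I::(real \<times> real set) set) u v. finite I \<Longrightarrow>
        (\<And>i. i \<in> I \<Longrightarrow> a \<le> u i \<and> u i \<le> v i \<and> v i \<le> b) \<Longrightarrow>
          disjoint_family_on (\<lambda>i. {u i<..<v i}) I \<Longrightarrow> (\<Sum>i\<in>I. v i - u i) < \<delta> \<Longrightarrow>
          (\<Sum>i\<in>I. norm (f (v i) - f (u i))) < e / 2"
      using AC_onD[OF f half_gt_zero[OF e]] by blast
    obtain U where U: "open U" "N \<subseteq> U" "U - N \<in> lmeasurable" "emeasure lebesgue (U - N) < ennreal \<delta>"
      using sets_lebesgue_outer_open[OF negligible_imp_sets[OF N] \<delta>(1)] by metis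
    have Um: "U \<in> lmeasurable" "measure lebesgue U < \<delta>"
    proof -
      have eq: "(U - N) \<union> N = U" using U(2) by auto
      show 1: "U \<in> lmeasurable"
        using fmeasurable.Un[OF U(3) negligible_imp_measurable[OF N]] unfolding eq .
      have "measure lebesgue U \<le> measure lebesgue (U - N) + measure lebesgue N"
        using measure_Un_le[OF fmeasurableD[OF U(3)] negligible_imp_sets[OF N]] unfolding eq .
      also have "\<dots> < \<delta>"
        using U(3,4) \<delta>(1) N by (simp add: negligible_imp_measure0 emeasure_eq_measure2 ennreal_less_iff)
      finally show "measure lebesgue U < \<delta>" .
    qed
    \<comment> \<open>The error e' times length must sum to less than e / 2; the summand 1 covers
      the case a = b.\<close>
    define e' where "e' = e / (2 * (b - a + 1))"
    have e': "e' > 0" "e' * (b - a) < e / 2" using e ab by (auto simp: e'_def field_simps)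
    have "\<exists>d>0. \<forall>y\<in>{a..b}. \<bar>y - x\<bar> < d \<longrightarrow> norm (f y - f x - (y - x) *\<^sub>R g x) \<le> e' * \<bar>y - x\<bar>"
      if "x \<in> {a..b} - N" for x
      using deriv[OF that] e' unfolding has_vector_derivative_def has_derivative_within_alt by auto
    then obtain d where d: "\<And>x. x \<in> {a..b} - N \<Longrightarrow> d x > 0"
      "\<And>x y. x \<in> {a..b} - N \<Longrightarrow> y \<in> {a..b} \<Longrightarrow> \<bar>y - x\<bar> < d x \<Longrightarrow> norm (f y - f x - (y - x) *\<^sub>R g x) \<le> e' * \<bar>y - x\<bar>"
      by metis
    define \<gamma> where "\<gamma> x = (if x \<in> N then U else if x \<in> {a..b} then ball x (d x) else UNIV)" for x
    have gauge: "gauge \<gamma>" unfolding gauge_def \<gamma>_def using U d(1) by auto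
    have "norm ((\<Sum>(x,K)\<in>p. measure lborel K *\<^sub>R h x) - (f b - f a)) < e"
      if p: "p tagged_division_of {a..b}" "\<gamma> fine p" for p
    proof -
      have fin: "finite p" using p(1) by blast
      have tag: "\<exists>l r. K = {l..r} \<and> l \<le> x \<and> x \<le> r \<and> a \<le> l \<and> r \<le> b" if "(x, K) \<in> p" for x K
      proof -
        have K: "x \<in> K" "K \<subseteq> {a..b}" "\<exists>l r. K = cbox l r" using tagged_division_ofD(2-4)[OF p(1) that] by auto
        then obtain l r where "K = {l..r}" by auto
        then show ?thesis using K by auto
      qed
      define p1 where "p1 = {z \<in> p. fst z \<in> N}"
      define p2 where "p2 = p - p1"
      have pp: "p = p1 \<union> p2" "p1 \<inter> p2 = {}" "finite p1" "finite p2" using fin by (auto simp: p1_def p2_def)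
      let ?t = "\<lambda>z. measure lborel (snd z) *\<^sub>R h (fst z) - (f (Sup (snd z)) - f (Inf (snd z)))"
      have eq: "(\<Sum>(x,K)\<in>p. measure lborel K *\<^sub>R h x) - (f b - f a) = (\<Sum>z\<in>p1. ?t z) + (\<Sum>z\<in>p2. ?t z)"
        using additive_tagged_division_1[OF ab p(1), of f] pp sum.union_disjoint[of p1 p2 ?t]
        by (simp add: sum_subtractf case_prod_beta)
      have dis: "disjoint_family_on (\<lambda>z. {Inf (snd z)<..<Sup (snd z)}) p"
        unfolding disjoint_family_on_def
      proof (intro ballI impI)
        fix z z' assume z: "z \<in> p" "z' \<in> p" "z \<noteq> z'"
        have "interior (snd z) = {Inf (snd z)<..<Sup (snd z)}" "interior (snd z') = {Inf (snd z')<..<Sup (snd z')}"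
          using tag[of "fst z" "snd z"] tag[of "fst z'" "snd z'"] z by (auto simp: interior_atLeastAtMost_real)
        moreover have "interior (snd z) \<inter> interior (snd z') = {}"
          using tagged_division_ofD(5)[OF p(1), of "fst z" "snd z" "fst z'" "snd z'"] z by auto
        ultimately show "{Inf (snd z)<..<Sup (snd z)} \<inter> {Inf (snd z')<..<Sup (snd z')} = {}" by simp
      qed
      have "norm (\<Sum>z\<in>p1. ?t z) < e / 2"
      proof -
        have "norm (\<Sum>z\<in>p1. ?t z) \<le> (\<Sum>z\<in>p1. norm (f (Sup (snd z)) - f (Inf (snd z))))"
          by (rule order_trans[OF norm_sum sum_mono]) (auto simp: p1_def h_def norm_minus_commute)
        also have "\<dots> < e / 2"
        proof (rule \<delta>(2)[OF pp(3)])
          show "a \<le> Inf (snd z) \<and> Inf (snd z) \<le> Sup (snd z) \<and> Sup (snd z) \<le> b" if "z \<in> p1" for z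
            using tag[of "fst z" "snd z"] that by (auto simp: p1_def)
          show dis1: "disjoint_family_on (\<lambda>z. {Inf (snd z)<..<Sup (snd z)}) p1"
            by (rule disjoint_family_on_mono[OF _ dis]) (auto simp: p1_def)
          have "(\<Sum>z\<in>p1. Sup (snd z) - Inf (snd z)) = (\<Sum>z\<in>p1. measure lebesgue {Inf (snd z)<..<Sup (snd z)})"
            by (rule sum.cong) (use tag in \<open>force simp: p1_def\<close>)+
          also have "\<dots> = measure lebesgue (\<Union>z\<in>p1. {Inf (snd z)<..<Sup (snd z)})"
          proof (intro measure_finite_Union[symmetric])
            show "emeasure lebesgue {Inf (snd z)<..<Sup (snd z)} \<noteq> \<infinity>" if "z \<in> p1" for z
              using tag[of "fst z" "snd z"] that by (auto simp: p1_def)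
          qed (use dis1 pp(3) in auto)
          also have "\<dots> \<le> measure lebesgue U"
          proof (rule measure_mono_fmeasurable[OF _ _ Um(1)])
            show "(\<Union>z\<in>p1. {Inf (snd z)<..<Sup (snd z)}) \<subseteq> U"
            proof
              fix y assume "y \<in> (\<Union>z\<in>p1. {Inf (snd z)<..<Sup (snd z)})"
              then obtain x K where xK: "(x,K) \<in> p" "x \<in> N" "y \<in> {Inf K<..<Sup K}" by (auto simp: p1_def)
              then have "y \<in> K" using tag[OF xK(1)] by auto
              then show "y \<in> U" using p(2) xK unfolding fine_def \<gamma>_def by fastforce
            qed
          qed (use pp in auto)
          finally show "(\<Sum>z\<in>p1. Sup (snd z) - Inf (snd z)) < \<delta>" using Um(2) by simp
        qed
        finally show ?thesis .
      qed
      moreover have "norm (\<Sum>z\<in>p2. ?t z) < e / 2"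
      proof -
        have "norm (?t z) \<le> e' * measure lborel (snd z)" if "z \<in> p2" for z
        proof -
          obtain x K where z: "z = (x,K)" by (cases z)
          then have xK: "(x,K) \<in> p" "x \<notin> N" using that by (auto simp: p2_def p1_def)
          obtain l r where lr: "K = {l..r}" "l \<le> x" "x \<le> r" "a \<le> l" "r \<le> b" using tag[OF xK(1)] by blast
          then have xab: "x \<in> {a..b} - N" using xK by auto
          then have "K \<subseteq> ball x (d x)" using p(2) xK unfolding fine_def \<gamma>_def by fastforce
          moreover have "l \<in> K" "r \<in> K" using lr by auto
          ultimately have "\<bar>l - x\<bar> < d x" "\<bar>r - x\<bar> < d x" by (auto simp: dist_real_def abs_minus_commute)
          then have "norm (f l - f x - (l - x) *\<^sub>R g x) \<le> e' * (x - l)" "norm (f r - f x - (r - x) *\<^sub>R g x) \<le> e' * (r - x)"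
            using d(2)[OF xab, of l] d(2)[OF xab, of r] lr by auto
          \<comment> \<open>The tag lies between l and r, so the errors of the two one-sided
            expansions add up to e' (r - l).\<close>
          then have "norm ((f l - f x - (l - x) *\<^sub>R g x) - (f r - f x - (r - x) *\<^sub>R g x)) \<le> e' * (r - l)"
            using norm_triangle_ineq4[of "f l - f x - (l - x) *\<^sub>R g x" "f r - f x - (r - x) *\<^sub>R g x"]
            by (simp add: algebra_simps)
          moreover have "(f l - f x - (l - x) *\<^sub>R g x) - (f r - f x - (r - x) *\<^sub>R g x) = ?t z"
            using lr z xK by (simp add: h_def scaleR_diff_left)
          ultimately show ?thesis using lr z by simp
        qed
        then have "norm (\<Sum>z\<in>p2. ?t z) \<le> (\<Sum>z\<in>p2. e' * measure lborel (snd z))"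
          by (rule sum_norm_le)
        also have "\<dots> \<le> (\<Sum>z\<in>p. e' * measure lborel (snd z))"
          using e' fin by (intro sum_mono2) (auto simp: p2_def)
        also have "\<dots> = e' * (b - a)"
          using additive_content_tagged_division[of p a b] p(1) ab by (simp add: sum_distrib_left[symmetric] case_prod_beta)
        finally show ?thesis using e' by simp
      qed
      ultimately show ?thesis
        unfolding eq using norm_triangle_ineq[of "\<Sum>z\<in>p1. ?t z" "\<Sum>z\<in>p2. ?t z"] by linarith
    qed
    then show "\<exists>\<gamma>. gauge \<gamma> \<and> (\<forall>\<D>. \<D> tagged_division_of {a..b} \<and> \<gamma> fine \<D> \<longrightarrow>
          norm ((\<Sum>(x,k)\<in>\<D>. measure lborel k *\<^sub>R h x) - (f b - f a)) < e)"
      using gauge by (intro exI[of _ \<gamma>]) simp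
  qed
  then show ?thesis
    by (rule has_integral_spike[OF N, rotated]) (auto simp: h_def)
qed

lemma AC_locD: "AC_loc f \<Longrightarrow> -1 < a \<Longrightarrow> a \<le> b \<Longrightarrow> b < 1 \<Longrightarrow> AC_on a b f"
  unfolding AC_loc_def by blast

lemma AC_loc_negligible:
  assumes f: "AC_loc f"
  shows "negligible {x \<in> {-1<..<1}. \<not> f differentiable (at x)}"
    (is "negligible ?S")
  unfolding locally_negligible_alt[of ?S]
proof
  fix x assume x: "x \<in> ?S"
  define c d where "c = (x - 1) / 2" and "d = (x + 1) / 2"
  have cd: "-1 < c" "d < 1" "c < x" "x < d" using x by (auto simp: c_def d_def)
  have "negligible {x \<in> {c<..<d}. \<not> f differentiable (at x)}"
    using cd by (intro AC_on_negligible_not_differentiable AC_locD[OF f]) auto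
  moreover have "{x \<in> {c<..<d}. \<not> f differentiable (at x)} = ?S \<inter> {c<..<d}" using cd by auto
  ultimately have "negligible (?S \<inter> {c<..<d})" by simp
  moreover have "openin (top_of_set ?S) (?S \<inter> {c<..<d})" by (rule openin_open_Int) simp
  moreover have "x \<in> ?S \<inter> {c<..<d}" using cd x by simp
  ultimately show "\<exists>U. openin (top_of_set ?S) U \<and> x \<in> U \<and> negligible U" by blast
qed

lemma AC_loc_FTC:
  assumes f: "AC_loc f" and xy: "-1 < x" "x \<le> y" "y < 1"
  shows "(rderiv f has_integral (f y - f x)) {x..y}"
proof (rule AC_on_FTC[OF AC_locD[OF f xy] xy(2) AC_loc_negligible[OF f]])
  fix t assume t: "t \<in> {x..y} - {x \<in> {-1<..<1}. \<not> f differentiable (at x)}"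
  then have "f differentiable (at t)" using xy by auto
  then show "(f has_vector_derivative rderiv f t) (at t within {x..y})"
    unfolding rderiv_def by (simp add: vector_derivative_works has_vector_derivative_at_within)
qed

section \<open>Functions with absolutely continuous derivatives\<close>

abbreviation unit_ivl :: "real set" where "unit_ivl \<equiv> {-1<..<1}"

lemma rderiv_cong:
  assumes "\<And>y. y \<in> unit_ivl \<Longrightarrow> f y = g y" "x \<in> unit_ivl"
  shows "rderiv f x = rderiv g x"
proof -
  have "\<forall>\<^sub>F y in nhds x. f y = g y"
    using assms by (intro eventually_nhds_in_open[THEN eventually_mono, of unit_ivl]) auto
  then show ?thesis
    unfolding rderiv_def by (intro vector_derivative_cong_eq) (auto simp: eventually_mono)
qed

lemma has_vector_derivative_cong_ivl:
  assumes "\<And>y. y \<in> unit_ivl \<Longrightarrow> f y = g y" "x \<in> unit_ivl"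
  shows "(f has_vector_derivative D) (at x) \<longleftrightarrow> (g has_vector_derivative D) (at x)"
  using assms has_vector_derivative_transform_within_open[of f D x unit_ivl g]
    has_vector_derivative_transform_within_open[of g D x unit_ivl f] by auto

lemma differentiable_cong_ivl:
  fixes f g :: "real \<Rightarrow> complex"
  assumes "\<And>y. y \<in> unit_ivl \<Longrightarrow> f y = g y" "x \<in> unit_ivl"
  shows "f differentiable (at x) \<longleftrightarrow> g differentiable (at x)"
proof
  assume "f differentiable (at x)"
  then have "(g has_vector_derivative vector_derivative f (at x)) (at x)"
    using has_vector_derivative_cong_ivl[OF assms] by (simp add: vector_derivative_works)
  then show "g differentiable (at x)" by (rule differentiableI_vector)
next
  assume "g differentiable (at x)"
  then have "(f has_vector_derivative vector_derivative g (at x)) (at x)"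
    using has_vector_derivative_cong_ivl[OF assms] by (simp add: vector_derivative_works)
  then show "f differentiable (at x)" by (rule differentiableI_vector)
qed

lemma rderiv_works: "f differentiable (at x) \<Longrightarrow> (f has_vector_derivative rderiv f x) (at x)"
  unfolding rderiv_def by (simp add: vector_derivative_works)

lemma rderiv_eq: "(f has_vector_derivative D) (at x) \<Longrightarrow> rderiv f x = D"
  unfolding rderiv_def by (rule vector_derivative_at)

lemma AC_loc_cong:
  assumes "\<And>y. y \<in> unit_ivl \<Longrightarrow> f y = g y" "AC_loc f"
  shows "AC_loc g"
  unfolding AC_loc_def
proof (intro allI impI)
  fix a b :: real assume ab: "-1 < a \<and> a \<le> b \<and> b < 1"
  have "AC_on a b f" using AC_locD[OF assms(2)] ab by blast
  then show "AC_on a b g"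
    by (rule AC_on_dominated[where C = 1 and D = 0]) (use ab assms(1) \<open>AC_on a b f\<close> in auto)
qed

lemma AC_loc_continuous_on:
  assumes "AC_loc f" shows "continuous_on unit_ivl f"
proof (rule continuous_at_imp_continuous_on, rule ballI)
  fix x :: real assume x: "x \<in> unit_ivl"
  have "continuous_on {(x-1)/2..(x+1)/2} f"
    using x by (intro AC_on_continuous_on AC_locD[OF assms]) auto
  then show "isCont f x"
    by (rule continuous_on_interior) (use x in \<open>auto simp: interior_atLeastAtMost_real\<close>)
qed

lemma AC_loc_bounded:
  assumes "AC_loc f" "-1 < a" "b < 1"
  obtains B where "B \<ge> 0" "\<And>x. x \<in> {a..b} \<Longrightarrow> norm (f x) \<le> B"
proof -
  have "compact (f ` {a..b})"
    using assms(2,3)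
    by (intro compact_continuous_image continuous_on_subset[OF AC_loc_continuous_on[OF assms(1)]]) auto
  then obtain B where B: "\<forall>y\<in>f ` {a..b}. norm y \<le> B" using compact_imp_bounded bounded_iff by blast
  show thesis by (rule that[of "max B 0"]) (use B in \<open>auto simp: le_max_iff_disj\<close>)
qed

lemma AC_loc_mult:
  assumes f: "AC_loc f" and g: "AC_loc g"
  shows "AC_loc (\<lambda>x. f x * g x)"
  unfolding AC_loc_def
proof (intro allI impI)
  fix a b :: real assume ab: "-1 < a \<and> a \<le> b \<and> b < 1"
  obtain B where B: "B \<ge> 0" "\<And>x. x \<in> {a..b} \<Longrightarrow> norm (f x) \<le> B" using AC_loc_bounded[OF f] ab by blast
  obtain C where C: "C \<ge> 0" "\<And>x. x \<in> {a..b} \<Longrightarrow> norm (g x) \<le> C" using AC_loc_bounded[OF g] ab by blast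
  show "AC_on a b (\<lambda>x. f x * g x)"
  proof (rule AC_on_dominated[where C = C and D = B])
    show "AC_on a b f" "AC_on a b g" using ab AC_locD[OF f] AC_locD[OF g] by auto
    fix x y assume xy: "x \<in> {a..b}" "y \<in> {a..b}"
    have "f y * g y - f x * g x = g y * (f y - f x) + f x * (g y - g x)" by (simp add: algebra_simps)
    then have "norm (f y * g y - f x * g x) \<le> norm (g y) * norm (f y - f x) + norm (f x) * norm (g y - g x)"
      by (metis norm_mult norm_triangle_ineq)
    also have "\<dots> \<le> C * norm (f y - f x) + B * norm (g y - g x)"
      using B C xy by (intro add_mono mult_right_mono) auto
    finally show "norm (f y * g y - f x * g x) \<le> C * norm (f y - f x) + B * norm (g y - g x)" .
  qed (use B C in auto)
qed

lemma AC_loc_add: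
  assumes f: "AC_loc f" and g: "AC_loc g"
  shows "AC_loc (\<lambda>x. f x + g x)"
  unfolding AC_loc_def
proof (intro allI impI)
  fix a b :: real assume ab: "-1 < a \<and> a \<le> b \<and> b < 1"
  show "AC_on a b (\<lambda>x. f x + g x)"
  proof (rule AC_on_dominated[where C = 1 and D = 1])
    fix x y
    have "f y + g y - (f x + g x) = (f y - f x) + (g y - g x)" by simp
    then show "norm (f y + g y - (f x + g x)) \<le> 1 * norm (f y - f x) + 1 * norm (g y - g x)"
      by (metis mult_1 norm_triangle_ineq)
  qed (use ab AC_locD[OF f] AC_locD[OF g] in auto)
qed

lemma AC_loc_cnj: "AC_loc f \<Longrightarrow> AC_loc (\<lambda>x. cnj (f x))"
proof -
  have "norm (cnj (f y) - cnj (f x)) = norm (f y - f x)" for x y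
    by (metis complex_cnj_diff complex_mod_cnj)
  then show "AC_loc f \<Longrightarrow> AC_loc (\<lambda>x. cnj (f x))"
    unfolding AC_loc_def AC_on_def by simp
qed

text \<open>By the mean value inequality f is Lipschitz on compact subintervals, so its increments
  are dominated by those of the identity.\<close>

lemma AC_loc_C1:
  assumes "\<And>x. x \<in> unit_ivl \<Longrightarrow> (f has_vector_derivative f' x) (at x)" "continuous_on unit_ivl f'"
  shows "AC_loc f"
  unfolding AC_loc_def
proof (intro allI impI)
  fix a b :: real assume ab: "-1 < a \<and> a \<le> b \<and> b < 1"
  have "compact (f' ` {a..b})"
    using ab by (intro compact_continuous_image continuous_on_subset[OF assms(2)]) auto
  then obtain B where B: "\<forall>y\<in>f' ` {a..b}. norm y \<le> B" using compact_imp_bounded bounded_iff by blast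
  have id: "AC_on a b (\<lambda>x. complex_of_real x)"
    unfolding AC_on_def
  proof (intro allI impI)
    fix \<epsilon> :: real assume "\<epsilon> > 0"
    then show "\<exists>\<delta>>0. \<forall>(m::nat) u v.
        (\<forall>i<m. a \<le> u i \<and> u i \<le> v i \<and> v i \<le> b) \<and>
        disjoint_family_on (\<lambda>i. {u i<..<v i}) {..<m} \<and>
        (\<Sum>i<m. v i - u i) < \<delta>
        \<longrightarrow> (\<Sum>i<m. norm (complex_of_real (v i) - complex_of_real (u i))) < \<epsilon>"
    proof (intro exI[of _ \<epsilon>] conjI allI impI)
      fix m :: nat and u v
      assume A: "(\<forall>i<m. a \<le> u i \<and> u i \<le> v i \<and> v i \<le> b) \<and>
        disjoint_family_on (\<lambda>i. {u i<..<v i}) {..<m} \<and> (\<Sum>i<m. v i - u i) < \<epsilon>"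
      have "(\<Sum>i<m. norm (complex_of_real (v i) - complex_of_real (u i))) = (\<Sum>i<m. v i - u i)"
        using A by (intro sum.cong) (auto simp flip: of_real_diff)
      then show "(\<Sum>i<m. norm (complex_of_real (v i) - complex_of_real (u i))) < \<epsilon>" using A by simp
    qed
  qed
  show "AC_on a b f"
  proof (rule AC_on_dominated[OF id id, where C = "max B 0" and D = 0])
    fix x y :: real assume xy: "x \<in> {a..b}" "y \<in> {a..b}" "x \<le> y"
    have "norm (f y - f x) \<le> max B 0 * norm (y - x)"
    proof (rule differentiable_bound[where S = "{a..b}" and f' = "\<lambda>x h. h *\<^sub>R f' x"])
      show "(f has_derivative (\<lambda>h. h *\<^sub>R f' x)) (at x within {a..b})" if "x \<in> {a..b}" for x
        using assms(1)[of x] that ab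
        by (auto simp: has_vector_derivative_def intro: has_derivative_at_withinI)
      show "onorm (\<lambda>h. h *\<^sub>R f' x) \<le> max B 0" if "x \<in> {a..b}" for x
      proof (rule onorm_le)
        fix h :: real
        have "norm (f' x) \<le> max B 0" using B that by (simp add: le_max_iff_disj)
        then show "norm (h *\<^sub>R f' x) \<le> max B 0 * norm h" by (simp add: mult.commute mult_left_mono)
      qed
    qed (use xy in auto)
    then show "norm (f y - f x) \<le> max B 0 * norm (complex_of_real y - complex_of_real x) +
        0 * norm (complex_of_real y - complex_of_real x)" by (simp flip: of_real_diff)
  qed auto
qed

lemma AC_loc_const: "AC_loc (\<lambda>_. c)"
  by (rule AC_loc_C1[where f' = "\<lambda>_. 0"]) (auto intro: derivative_eq_intros)

lemma rderiv_add:
  assumes "f differentiable (at x)" "g differentiable (at x)"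
  shows "rderiv (\<lambda>x. f x + g x) x = rderiv f x + rderiv g x"
  using assms by (intro rderiv_eq has_vector_derivative_add rderiv_works)

lemma rderiv_mult:
  assumes "f differentiable (at x)" "g differentiable (at x)"
  shows "rderiv (\<lambda>x. f x * g x) x = f x * rderiv g x + rderiv f x * g x"
  using assms by (intro rderiv_eq has_vector_derivative_mult rderiv_works)

text \<open>\<open>reg (2 * n - 1)\<close> is the regularity required in \<open>D_max\<close>:
  derivatives up to order m exist everywhere, and the last one is merely absolutely continuous. The
  recursion through the derivative suits inductions; \<open>reg_iff\<close> is the link to iterated
  derivatives.\<close>

primrec reg :: "nat \<Rightarrow> (real \<Rightarrow> complex) \<Rightarrow> bool" where
  "reg 0 f \<longleftrightarrow> AC_loc f"
| "reg (Suc m) f \<longleftrightarrow> AC_loc f \<and> (\<forall>x\<in>unit_ivl. f differentiable (at x)) \<and> reg m (rderiv f)"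

lemma reg_AC_loc: "reg m f \<Longrightarrow> AC_loc f"
  by (cases m) auto

lemma reg_Suc: "reg (Suc m) f \<Longrightarrow> reg m f"
  by (induction m arbitrary: f) (auto dest: reg_AC_loc)

lemma reg_le: "reg m f \<Longrightarrow> k \<le> m \<Longrightarrow> reg k f"
  by (induction m) (auto simp del: reg.simps simp: le_Suc_eq dest: reg_Suc)

lemma reg_iff:
  "reg m f \<longleftrightarrow> (\<forall>k<m. \<forall>x\<in>unit_ivl. (rderiv ^^ k) f differentiable (at x)) \<and>
              (\<forall>k\<le>m. AC_loc ((rderiv ^^ k) f))"
proof (induction m arbitrary: f)
  case (Suc m)
  have "(\<forall>k<Suc m. \<forall>x\<in>unit_ivl. (rderiv ^^ k) f differentiable (at x)) \<longleftrightarrow>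
     (\<forall>x\<in>unit_ivl. f differentiable (at x)) \<and> (\<forall>k<m. \<forall>x\<in>unit_ivl. (rderiv ^^ k) (rderiv f) differentiable (at x))"
    by (subst All_less_Suc2) (simp add: funpow_swap1)
  moreover have "(\<forall>k\<le>Suc m. AC_loc ((rderiv ^^ k) f)) \<longleftrightarrow> AC_loc f \<and> (\<forall>k\<le>m. AC_loc ((rderiv ^^ k) (rderiv f)))"
    using All_less_Suc2[of "Suc m" "\<lambda>k. AC_loc ((rderiv ^^ k) f)"] by (simp add: funpow_swap1 less_Suc_eq_le)
  ultimately show ?case using Suc.IH[of "rderiv f"] by auto
qed simp

lemma reg_cong:
  assumes "\<And>y. y \<in> unit_ivl \<Longrightarrow> f y = g y" "reg m f"
  shows "reg m g"
  using assms
proof (induction m arbitrary: f g)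
  case 0 show ?case using AC_loc_cong[OF 0(1)] 0(2) by simp
next
  case (Suc m)
  have "reg m (rderiv g)"
  proof (rule Suc.IH)
    show "rderiv f y = rderiv g y" if "y \<in> unit_ivl" for y by (rule rderiv_cong[OF Suc.prems(1) that])
    show "reg m (rderiv f)" using Suc.prems(2) by simp
  qed
  moreover have "AC_loc g" "\<forall>x\<in>unit_ivl. g differentiable (at x)"
    using Suc.prems AC_loc_cong[OF Suc.prems(1)] differentiable_cong_ivl[OF Suc.prems(1)] by simp_all
  ultimately show ?case by simp
qed

lemma reg_const: "reg m (\<lambda>_. c)"
proof (induction m arbitrary: c)
  case (Suc m)
  have "rderiv (\<lambda>_. c) = (\<lambda>_. 0)" by (rule ext) (auto intro: rderiv_eq derivative_eq_intros)
  then show ?case using Suc.IH[of 0] by (simp add: AC_loc_const)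
qed (simp add: AC_loc_const)

lemma reg_of_real: "reg m of_real"
proof -
  have d: "(complex_of_real has_vector_derivative 1) (at x)" for x
    using has_vector_derivative_of_real[OF DERIV_ident] by simp
  then have "rderiv of_real = (\<lambda>_. 1)" by (intro ext rderiv_eq)
  moreover have "AC_loc of_real" by (rule AC_loc_C1[OF d]) auto
  ultimately show ?thesis
    using reg_const[of _ 1] d by (cases m) (auto intro: differentiableI_vector)
qed

lemma reg_add: "reg m f \<Longrightarrow> reg m g \<Longrightarrow> reg m (\<lambda>x. f x + g x)"
proof (induction m arbitrary: f g)
  case (Suc m)
  have "reg m (rderiv (\<lambda>x. f x + g x))"
    by (rule reg_cong[OF _ Suc.IH[of "rderiv f" "rderiv g"]]) (use Suc.prems in \<open>auto simp: rderiv_add\<close>)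
  then show ?case using Suc.prems by (auto intro: AC_loc_add)
qed (simp add: AC_loc_add)

lemma reg_mult: "reg m f \<Longrightarrow> reg m g \<Longrightarrow> reg m (\<lambda>x. f x * g x)"
proof (induction m arbitrary: f g)
  case (Suc m)
  have "reg m (\<lambda>x. f x * rderiv g x + rderiv f x * g x)"
    using Suc.prems Suc.IH reg_add reg_Suc[OF Suc.prems(1)] reg_Suc[OF Suc.prems(2)] by simp
  then have "reg m (rderiv (\<lambda>x. f x * g x))"
    by (rule reg_cong[rotated]) (use Suc.prems in \<open>auto simp: rderiv_mult\<close>)
  then show ?case using Suc.prems by (auto intro: AC_loc_mult)
qed (simp add: AC_loc_mult)

lemma reg_cmult: "reg m f \<Longrightarrow> reg m (\<lambda>x. c * f x)"
  by (rule reg_mult[OF reg_const])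

lemma smooth_reg:
  assumes "smooth_on_ivl f" shows "reg m f"
proof -
  have "AC_loc ((rderiv ^^ k) f)" for k
  proof (rule AC_loc_C1[where f' = "(rderiv ^^ Suc k) f"])
    show "((rderiv ^^ k) f has_vector_derivative (rderiv ^^ Suc k) f x) (at x)" if "x \<in> unit_ivl" for x
      using assms that rderiv_works[of "(rderiv ^^ k) f" x] by (auto simp: smooth_on_ivl_def)
    show "continuous_on unit_ivl ((rderiv ^^ Suc k) f)"
      using assms by (intro continuous_at_imp_continuous_on)
        (metis smooth_on_ivl_def differentiable_imp_continuous_within)
  qed
  then show ?thesis using assms by (auto simp: reg_iff smooth_on_ivl_def)
qed

lemma smooth_on_ivl_iff_reg: "smooth_on_ivl f \<longleftrightarrow> (\<forall>m. reg m f)"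
proof
  assume R: "\<forall>m. reg m f"
  show "smooth_on_ivl f"
    unfolding smooth_on_ivl_def
  proof (intro allI ballI)
    fix k x assume "x \<in> unit_ivl"
    then show "(rderiv ^^ k) f differentiable (at x)" using R[rule_format, of "Suc k"] unfolding reg_iff by blast
  qed
qed (simp add: smooth_reg)

section \<open>Powers of the Jacobi expression\<close>

definition jacobi_p :: "real \<Rightarrow> real \<Rightarrow> real \<Rightarrow> real" where
  "jacobi_p \<alpha> \<beta> y = (1 - y) powr (\<alpha> + 1) * (1 + y) powr (\<beta> + 1)"

text \<open>The quasi-derivative p f'. It is absolutely continuous already when f' is, and together
  with f it forms the natural Cauchy data of the equation.\<close>

definition qder :: "real \<Rightarrow> real \<Rightarrow> (real \<Rightarrow> complex) \<Rightarrow> real \<Rightarrow> complex" where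
  "qder \<alpha> \<beta> f = (\<lambda>y. jacobi_p \<alpha> \<beta> y *\<^sub>R rderiv f y)"

lemma jacobi_expr_qder:
  "jacobi_expr \<alpha> \<beta> f x = - ((1 / jacobi_weight \<alpha> \<beta> x) *\<^sub>R rderiv (qder \<alpha> \<beta> f) x)"
  by (simp add: jacobi_expr_def qder_def jacobi_p_def)

lemma jacobi_weight_pos: "x \<in> unit_ivl \<Longrightarrow> 0 < jacobi_weight \<alpha> \<beta> x"
  by (simp add: jacobi_weight_def)

lemma jacobi_p_weight: "x \<in> unit_ivl \<Longrightarrow> jacobi_p \<alpha> \<beta> x = (1 - x\<^sup>2) * jacobi_weight \<alpha> \<beta> x"
  by (simp add: jacobi_p_def jacobi_weight_def powr_add power2_eq_square algebra_simps)

lemma jacobi_p_pos: "x \<in> unit_ivl \<Longrightarrow> 0 < jacobi_p \<alpha> \<beta> x"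
  by (simp add: jacobi_p_def)

lemma jacobi_p_deriv:
  assumes "x \<in> unit_ivl"
  shows "(jacobi_p \<alpha> \<beta> has_real_derivative
      jacobi_weight \<alpha> \<beta> x * (\<beta> - \<alpha> - (\<alpha> + \<beta> + 2) * x)) (at x)"
proof -
  have "((\<lambda>y. (1 - y) powr (\<alpha> + 1) * (1 + y) powr (\<beta> + 1)) has_real_derivative
      jacobi_weight \<alpha> \<beta> x * (\<beta> - \<alpha> - (\<alpha> + \<beta> + 2) * x)) (at x)"
  proof (rule DERIV_cong)
    have "((\<lambda>y. (1 - y) powr (\<alpha> + 1)) has_real_derivative (\<alpha> + 1) * (1 - x) powr (\<alpha> + 1 - of_nat 1) * (- 1)) (at x)"
      using assms by (intro DERIV_fun_powr) (auto intro!: derivative_eq_intros)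
    moreover have "((\<lambda>y. (1 + y) powr (\<beta> + 1)) has_real_derivative (\<beta> + 1) * (1 + x) powr (\<beta> + 1 - of_nat 1) * 1) (at x)"
      using assms by (intro DERIV_fun_powr) (auto intro!: derivative_eq_intros)
    ultimately show "((\<lambda>y. (1 - y) powr (\<alpha> + 1) * (1 + y) powr (\<beta> + 1)) has_real_derivative
        (\<alpha> + 1) * (1 - x) powr (\<alpha> + 1 - of_nat 1) * (- 1) * (1 + x) powr (\<beta> + 1) +
        (\<beta> + 1) * (1 + x) powr (\<beta> + 1 - of_nat 1) * 1 * (1 - x) powr (\<alpha> + 1)) (at x)"
      by (rule DERIV_mult)
  qed (use assms in \<open>simp add: jacobi_weight_def powr_add algebra_simps\<close>)
  then show ?thesis by (simp add: jacobi_p_def[abs_def])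
qed

lemma jacobi_expr_cong:
  assumes "\<And>y. y \<in> unit_ivl \<Longrightarrow> f y = g y" "x \<in> unit_ivl"
  shows "jacobi_expr \<alpha> \<beta> f x = jacobi_expr \<alpha> \<beta> g x"
proof -
  have "rderiv (qder \<alpha> \<beta> f) x = rderiv (qder \<alpha> \<beta> g) x"
    using assms by (intro rderiv_cong) (auto simp: qder_def intro: rderiv_cong)
  then show ?thesis by (simp add: jacobi_expr_qder)
qed

lemma jacobi_pow_cong:
  assumes "\<And>y. y \<in> unit_ivl \<Longrightarrow> f y = g y" "x \<in> unit_ivl"
  shows "jacobi_pow \<alpha> \<beta> k f x = jacobi_pow \<alpha> \<beta> k g x"
  using assms(2) by (induction k arbitrary: x) (auto simp: assms(1) intro: jacobi_expr_cong)

lemma qder_has_vector_derivative: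
  assumes "(f has_vector_derivative rderiv f x) (at x)" "(rderiv f has_vector_derivative f2) (at x)" "x \<in> unit_ivl"
  shows "(qder \<alpha> \<beta> f has_vector_derivative
     jacobi_weight \<alpha> \<beta> x *\<^sub>R ((1 - x\<^sup>2) *\<^sub>R f2 + (\<beta> - \<alpha> - (\<alpha> + \<beta> + 2) * x) *\<^sub>R rderiv f x)) (at x)"
  unfolding qder_def
  by (rule has_vector_derivative_scaleR[OF jacobi_p_deriv assms(2), THEN has_vector_derivative_eq_rhs])
     (use assms(3) in \<open>auto simp: jacobi_p_weight algebra_simps scaleR_add_right\<close>)

text \<open>Since p' is w times a linear polynomial, the weight cancels and the coefficients become
  polynomials. In this form one application visibly costs two derivatives and nothing else.\<close>

lemma jacobi_expr_eq:
  assumes "f differentiable (at x)" "(rderiv f has_vector_derivative f2) (at x)" "x \<in> unit_ivl"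
  shows "jacobi_expr \<alpha> \<beta> f x = (x\<^sup>2 - 1) *\<^sub>R f2 + ((\<alpha> + \<beta> + 2) * x + (\<alpha> - \<beta>)) *\<^sub>R rderiv f x"
proof -
  have "rderiv (qder \<alpha> \<beta> f) x = jacobi_weight \<alpha> \<beta> x *\<^sub>R ((1 - x\<^sup>2) *\<^sub>R f2 + (\<beta> - \<alpha> - (\<alpha> + \<beta> + 2) * x) *\<^sub>R rderiv f x)"
    by (rule rderiv_eq qder_has_vector_derivative rderiv_works assms)+
  moreover have "(1 / jacobi_weight \<alpha> \<beta> x) *\<^sub>R (jacobi_weight \<alpha> \<beta> x *\<^sub>R z) = z" for z :: complex
    using jacobi_weight_pos[OF assms(3), of \<alpha> \<beta>] by simp
  ultimately show ?thesis
    by (simp only: jacobi_expr_qder) (simp add: algebra_simps)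
qed

lemma reg_jacobi_expr:
  assumes "reg (Suc (Suc m)) f"
  shows "reg m (jacobi_expr \<alpha> \<beta> f)"
proof -
  define g where "g x = (of_real x * of_real x + (-1)) * rderiv (rderiv f) x +
      (of_real (\<alpha> + \<beta> + 2) * of_real x + of_real (\<alpha> - \<beta>)) * rderiv f x" for x :: real
  have "reg m (rderiv (rderiv f))" "reg m (rderiv f)" using assms reg_Suc[of m "rderiv f"] by simp_all
  then have "reg m g"
    unfolding g_def[abs_def] by (intro reg_add reg_mult reg_const reg_of_real)
  then show ?thesis
  proof (rule reg_cong[rotated])
    fix x :: real assume x: "x \<in> unit_ivl"
    then have "f differentiable (at x)" "(rderiv f has_vector_derivative rderiv (rderiv f) x) (at x)"
      using assms by (auto intro: rderiv_works)
    from jacobi_expr_eq[OF this x] show "g x = jacobi_expr \<alpha> \<beta> f x"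
      by (simp add: g_def scaleR_conv_of_real power2_eq_square)
  qed
qed

lemma reg_jacobi_pow: "reg (2 * k + m) f \<Longrightarrow> reg m (jacobi_pow \<alpha> \<beta> k f)"
proof (induction k arbitrary: m)
  case (Suc k)
  then have "reg (Suc (Suc m)) (jacobi_pow \<alpha> \<beta> k f)" by (intro Suc.IH) simp
  then show ?case using reg_jacobi_expr[of m "jacobi_pow \<alpha> \<beta> k f"] by simp
qed simp

lemma smooth_jacobi_pow: "smooth_on_ivl f \<Longrightarrow> smooth_on_ivl (jacobi_pow \<alpha> \<beta> k f)"
  unfolding smooth_on_ivl_iff_reg using reg_jacobi_pow by blast

lemma AC_loc_qder:
  assumes "reg 1 f" shows "AC_loc (qder \<alpha> \<beta> f)"
proof -
  have "AC_loc (\<lambda>x. of_real (jacobi_p \<alpha> \<beta> x))"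
  proof (rule AC_loc_C1[OF has_vector_derivative_of_real])
    show "(jacobi_p \<alpha> \<beta> has_real_derivative
      jacobi_weight \<alpha> \<beta> x * (\<beta> - \<alpha> - (\<alpha> + \<beta> + 2) * x)) (at x)" if "x \<in> unit_ivl" for x
      using jacobi_p_deriv[OF that] .
    show "continuous_on unit_ivl (\<lambda>x. complex_of_real (jacobi_weight \<alpha> \<beta> x * (\<beta> - \<alpha> - (\<alpha> + \<beta> + 2) * x)))"
      unfolding jacobi_weight_def by (intro continuous_intros) auto
  qed
  then have "AC_loc (\<lambda>x. of_real (jacobi_p \<alpha> \<beta> x) * rderiv f x)"
    using assms by (intro AC_loc_mult) auto
  then show ?thesis by (simp add: qder_def scaleR_conv_of_real)
qed

lemma qder_lincomb:
  assumes "f differentiable (at x)" "g differentiable (at x)"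
  shows "qder \<alpha> \<beta> (\<lambda>x. c * f x + d * g x) x = c * qder \<alpha> \<beta> f x + d * qder \<alpha> \<beta> g x"
proof -
  have "rderiv (\<lambda>x. c * f x + d * g x) x = c * rderiv f x + d * rderiv g x"
    by (intro rderiv_eq has_vector_derivative_add has_vector_derivative_mult_right rderiv_works assms)
  then show ?thesis by (simp add: qder_def algebra_simps)
qed

text \<open>Differentiability of the quasi-derivatives is demanded at the single point x, because at
  the top level of the maximal domain it holds only almost everywhere.\<close>

lemma jacobi_expr_lincomb:
  assumes fg: "reg 1 f" "reg 1 g" and x: "x \<in> unit_ivl"
    and d: "qder \<alpha> \<beta> f differentiable (at x)" "qder \<alpha> \<beta> g differentiable (at x)"
  shows "jacobi_expr \<alpha> \<beta> (\<lambda>x. c * f x + d * g x) x = c * jacobi_expr \<alpha> \<beta> f x + d * jacobi_expr \<alpha> \<beta> g x"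
proof -
  have "rderiv (qder \<alpha> \<beta> (\<lambda>x. c * f x + d * g x)) x = rderiv (\<lambda>x. c * qder \<alpha> \<beta> f x + d * qder \<alpha> \<beta> g x) x"
    using fg x by (intro rderiv_cong qder_lincomb) auto
  also have "\<dots> = c * rderiv (qder \<alpha> \<beta> f) x + d * rderiv (qder \<alpha> \<beta> g) x"
    by (intro rderiv_eq has_vector_derivative_add has_vector_derivative_mult_right rderiv_works d)
  finally show ?thesis by (simp add: jacobi_expr_qder algebra_simps)
qed

lemma qder_differentiable:
  assumes "reg 2 f" "x \<in> unit_ivl"
  shows "qder \<alpha> \<beta> f differentiable (at x)"
proof (rule differentiableI_vector, rule qder_has_vector_derivative)
  have "f differentiable (at x)" "rderiv f differentiable (at x)"
    using assms by (auto simp: numeral_2_eq_2)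
  then show "(f has_vector_derivative rderiv f x) (at x)" "(rderiv f has_vector_derivative rderiv (rderiv f) x) (at x)"
    by (auto intro: rderiv_works)
qed fact

lemma jacobi_pow_lincomb:
  assumes "reg (2 * k) f" "reg (2 * k) g" "x \<in> unit_ivl"
  shows "jacobi_pow \<alpha> \<beta> k (\<lambda>x. c * f x + d * g x) x = c * jacobi_pow \<alpha> \<beta> k f x + d * jacobi_pow \<alpha> \<beta> k g x"
  using assms
proof (induction k arbitrary: x)
  case (Suc k)
  have r: "reg 2 (jacobi_pow \<alpha> \<beta> k f)" "reg 2 (jacobi_pow \<alpha> \<beta> k g)"
    using Suc.prems reg_jacobi_pow[of k 2] by simp_all
  have "jacobi_pow \<alpha> \<beta> (Suc k) (\<lambda>x. c * f x + d * g x) x =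
     jacobi_expr \<alpha> \<beta> (\<lambda>x. c * jacobi_pow \<alpha> \<beta> k f x + d * jacobi_pow \<alpha> \<beta> k g x) x"
    using Suc.prems reg_le[of "2 * Suc k" _ "2 * k"] by (auto intro!: jacobi_expr_cong Suc.IH)
  also have "\<dots> = c * jacobi_pow \<alpha> \<beta> (Suc k) f x + d * jacobi_pow \<alpha> \<beta> (Suc k) g x"
    using jacobi_expr_lincomb[OF reg_le[OF r(1)] reg_le[OF r(2)] Suc.prems(3) qder_differentiable qder_differentiable]
      r Suc.prems(3) by simp
  finally show ?case .
qed simp

section \<open>The weighted space of square integrable functions\<close>

lemma lebesgue_sets_unit_ivl: "unit_ivl \<in> sets lebesgue" by simp

lemma continuous_measurable_unit_ivl:
  "continuous_on unit_ivl f \<Longrightarrow> f \<in> borel_measurable (lebesgue_on unit_ivl)"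
  by (rule continuous_imp_measurable_on_sets_lebesgue) auto

lemma jacobi_weight_nonneg [simp]: "0 \<le> jacobi_weight \<alpha> \<beta> x"
  by (simp add: jacobi_weight_def)

lemma jacobi_weight_continuous: "continuous_on unit_ivl (jacobi_weight \<alpha> \<beta>)"
  unfolding jacobi_weight_def[abs_def] by (intro continuous_intros) auto

lemma jacobi_weight_measurable [measurable]: "jacobi_weight \<alpha> \<beta> \<in> borel_measurable (lebesgue_on unit_ivl)"
  by (intro continuous_measurable_unit_ivl jacobi_weight_continuous)

lemma sets_jacobi_measure [simp]: "sets (jacobi_measure \<alpha> \<beta>) = sets (lebesgue_on unit_ivl)"
  by (simp add: jacobi_measure_def)

lemma space_jacobi_measure [simp]: "space (jacobi_measure \<alpha> \<beta>) = unit_ivl"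
  by (simp add: jacobi_measure_def space_restrict_space)

lemma measurable_jacobi_measure [simp]:
  "borel_measurable (jacobi_measure \<alpha> \<beta>) = borel_measurable (lebesgue_on unit_ivl)"
  by (intro measurable_cong_sets) simp_all

lemma AE_lebesgue_on_iff: "(AE x in lebesgue_on unit_ivl. P x) \<longleftrightarrow> negligible {x \<in> unit_ivl. \<not> P x}"
proof -
  have "(AE x in lebesgue_on unit_ivl. P x) \<longleftrightarrow> (AE x in lebesgue. x \<in> unit_ivl \<longrightarrow> P x)"
    by (intro AE_restrict_space_iff) simp
  also have "\<dots> \<longleftrightarrow> {x. \<not> (x \<in> unit_ivl \<longrightarrow> P x)} \<in> null_sets lebesgue"
    by (subst completion.AE_iff_null_sets) (simp add: Collect_neg_eq[symmetric])
  also have "{x. \<not> (x \<in> unit_ivl \<longrightarrow> P x)} = {x \<in> unit_ivl. \<not> P x}" by auto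
  finally show ?thesis by (simp add: negligible_iff_null_sets)
qed

lemma AE_jacobi_measure_iff: "(AE x in jacobi_measure \<alpha> \<beta>. P x) \<longleftrightarrow> negligible {x \<in> unit_ivl. \<not> P x}"
proof -
  have "(AE x in jacobi_measure \<alpha> \<beta>. P x) \<longleftrightarrow> (AE x in lebesgue_on unit_ivl. 0 < jacobi_weight \<alpha> \<beta> x \<longrightarrow> P x)"
    unfolding jacobi_measure_def by (subst AE_density) auto
  also have "\<dots> \<longleftrightarrow> negligible {x \<in> unit_ivl. \<not> P x}"
    using jacobi_weight_pos[of _ \<alpha> \<beta>] unfolding AE_lebesgue_on_iff by (intro arg_cong[of _ _ negligible]) auto
  finally show ?thesis .
qed

lemma measurable_spike_unit_ivl:
  fixes f g :: "real \<Rightarrow> 'b::euclidean_space"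
  assumes f: "f \<in> borel_measurable (lebesgue_on unit_ivl)" and N: "negligible N"
    and eq: "\<And>x. x \<in> unit_ivl - N \<Longrightarrow> g x = f x"
  shows "g \<in> borel_measurable (lebesgue_on unit_ivl)"
proof (rule borel_measurable_if_D)
  have "AE x in lebesgue. (if x \<in> unit_ivl then f x else 0) = (if x \<in> unit_ivl then g x else 0)"
  proof (rule AE_I'[of N])
    show "{x \<in> space lebesgue. (if x \<in> unit_ivl then f x else 0) \<noteq> (if x \<in> unit_ivl then g x else 0)} \<subseteq> N"
    proof (rule subsetI, rule ccontr)
      fix x assume "x \<in> {x \<in> space lebesgue. (if x \<in> unit_ivl then f x else 0) \<noteq> (if x \<in> unit_ivl then g x else 0)}" "x \<notin> N"
      then show False using eq[of x] by (simp split: if_splits)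
    qed
  qed (use N in \<open>simp add: negligible_iff_null_sets\<close>)
  then show "(\<lambda>x. if x \<in> unit_ivl then g x else 0) \<in> borel_measurable lebesgue"
    by (rule borel_measurable_AE[rotated]) (intro borel_measurable_if_I f lebesgue_sets_unit_ivl)
qed

lemma integrable_jacobi_measure_iff:
  fixes f :: "real \<Rightarrow> 'b::euclidean_space"
  assumes f: "f \<in> borel_measurable (lebesgue_on unit_ivl)"
  shows "integrable (jacobi_measure \<alpha> \<beta>) f \<longleftrightarrow> (\<lambda>x. jacobi_weight \<alpha> \<beta> x *\<^sub>R f x) absolutely_integrable_on unit_ivl"
proof -
  have "integrable (jacobi_measure \<alpha> \<beta>) f \<longleftrightarrow> integrable (lebesgue_on unit_ivl) (\<lambda>x. jacobi_weight \<alpha> \<beta> x *\<^sub>R f x)"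
    unfolding jacobi_measure_def
    by (intro integrable_density f jacobi_weight_measurable) simp
  also have "\<dots> \<longleftrightarrow> (\<lambda>x. jacobi_weight \<alpha> \<beta> x *\<^sub>R f x) absolutely_integrable_on unit_ivl"
    by (subst integrable_restrict_space) (auto simp: set_integrable_def)
  finally show ?thesis .
qed

lemma integral_jacobi_measure:
  fixes f :: "real \<Rightarrow> 'b::euclidean_space"
  assumes f: "f \<in> borel_measurable (lebesgue_on unit_ivl)"
    and i: "(\<lambda>x. jacobi_weight \<alpha> \<beta> x *\<^sub>R f x) absolutely_integrable_on unit_ivl"
  shows "integral\<^sup>L (jacobi_measure \<alpha> \<beta>) f = integral unit_ivl (\<lambda>x. jacobi_weight \<alpha> \<beta> x *\<^sub>R f x)"
proof -
  have "integral\<^sup>L (jacobi_measure \<alpha> \<beta>) f = integral\<^sup>L (lebesgue_on unit_ivl) (\<lambda>x. jacobi_weight \<alpha> \<beta> x *\<^sub>R f x)"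
    unfolding jacobi_measure_def
    by (intro integral_density f jacobi_weight_measurable) simp
  also have "\<dots> = integral unit_ivl (\<lambda>x. jacobi_weight \<alpha> \<beta> x *\<^sub>R f x)"
    using i by (subst integral_restrict_space) (auto simp: set_lebesgue_integral_eq_integral(2)[symmetric] set_lebesgue_integral_def)
  finally show ?thesis .
qed

lemma square_integrable_iff:
  "square_integrable (jacobi_measure \<alpha> \<beta>) f \<longleftrightarrow> f \<in> borel_measurable (lebesgue_on unit_ivl) \<and>
     (\<lambda>x. jacobi_weight \<alpha> \<beta> x * (norm (f x))\<^sup>2) absolutely_integrable_on unit_ivl"
  using integrable_jacobi_measure_iff[of "\<lambda>x. (norm (f x))\<^sup>2" \<alpha> \<beta>] by (auto simp: square_integrable_def)

lemma square_integrable_dominated: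
  assumes f: "f \<in> borel_measurable (lebesgue_on unit_ivl)"
    and h: "(\<lambda>x. jacobi_weight \<alpha> \<beta> x * h x) absolutely_integrable_on unit_ivl"
    and le: "\<And>x. x \<in> unit_ivl \<Longrightarrow> (norm (f x))\<^sup>2 \<le> h x"
  shows "square_integrable (jacobi_measure \<alpha> \<beta>) f"
  unfolding square_integrable_iff
proof (intro conjI f measurable_bounded_by_integrable_imp_absolutely_integrable)
  show "(\<lambda>x. jacobi_weight \<alpha> \<beta> x * (norm (f x))\<^sup>2) \<in> borel_measurable (lebesgue_on unit_ivl)"
    using f by measurable
  show "(\<lambda>x. jacobi_weight \<alpha> \<beta> x * h x) integrable_on unit_ivl"
    using h by (simp add: absolutely_integrable_on_def)
  show "norm (jacobi_weight \<alpha> \<beta> x * (norm (f x))\<^sup>2) \<le> jacobi_weight \<alpha> \<beta> x * h x" if "x \<in> unit_ivl" for x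
    using jacobi_weight_pos[OF that, of \<alpha> \<beta>] le[OF that] by (simp add: abs_mult mult_left_mono)
qed simp

lemma square_integrable_spike:
  assumes f: "square_integrable (jacobi_measure \<alpha> \<beta>) f" and N: "negligible N"
    and eq: "\<And>x. x \<in> unit_ivl - N \<Longrightarrow> g x = f x"
  shows "square_integrable (jacobi_measure \<alpha> \<beta>) g"
  unfolding square_integrable_iff
proof
  show "g \<in> borel_measurable (lebesgue_on unit_ivl)"
    using f by (intro measurable_spike_unit_ivl[OF _ N eq]) (auto simp: square_integrable_iff)
  show "(\<lambda>x. jacobi_weight \<alpha> \<beta> x * (norm (g x))\<^sup>2) absolutely_integrable_on unit_ivl"
    by (rule absolutely_integrable_spike[OF _ N, where f = "\<lambda>x. jacobi_weight \<alpha> \<beta> x * (norm (f x))\<^sup>2"])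
      (use f eq in \<open>auto simp: square_integrable_iff\<close>)
qed

lemma square_integrable_add:
  assumes f: "square_integrable (jacobi_measure \<alpha> \<beta>) f" and g: "square_integrable (jacobi_measure \<alpha> \<beta>) g"
  shows "square_integrable (jacobi_measure \<alpha> \<beta>) (\<lambda>x. f x + g x)"
proof (rule square_integrable_dominated[where h = "\<lambda>x. 2 * ((norm (f x))\<^sup>2 + (norm (g x))\<^sup>2)"])
  show "(\<lambda>x. f x + g x) \<in> borel_measurable (lebesgue_on unit_ivl)"
    using f g by (auto simp: square_integrable_iff)
  have "(\<lambda>x. 2 * (jacobi_weight \<alpha> \<beta> x * (norm (f x))\<^sup>2 + jacobi_weight \<alpha> \<beta> x * (norm (g x))\<^sup>2)) absolutely_integrable_on unit_ivl"
    using f g by (intro set_integrable_mult_right set_integral_add(1)) (auto simp: square_integrable_iff)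
  then show "(\<lambda>x. jacobi_weight \<alpha> \<beta> x * (2 * ((norm (f x))\<^sup>2 + (norm (g x))\<^sup>2))) absolutely_integrable_on unit_ivl"
    by (simp add: algebra_simps)
  fix x
  have "(norm (f x + g x))\<^sup>2 \<le> (norm (f x) + norm (g x))\<^sup>2" by (intro power_mono norm_triangle_ineq) auto
  also have "\<dots> \<le> 2 * ((norm (f x))\<^sup>2 + (norm (g x))\<^sup>2)"
    using sum_squares_bound[of "norm (f x)" "norm (g x)"] by (simp add: power2_sum)
  finally show "(norm (f x + g x))\<^sup>2 \<le> 2 * ((norm (f x))\<^sup>2 + (norm (g x))\<^sup>2)" .
qed

lemma square_integrable_cmult:
  assumes f: "square_integrable (jacobi_measure \<alpha> \<beta>) f"
  shows "square_integrable (jacobi_measure \<alpha> \<beta>) (\<lambda>x. c * f x)"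
proof (rule square_integrable_dominated[where h = "\<lambda>x. (norm c)\<^sup>2 * (norm (f x))\<^sup>2"])
  show "(\<lambda>x. c * f x) \<in> borel_measurable (lebesgue_on unit_ivl)"
    using f by (auto simp: square_integrable_iff)
  have "(\<lambda>x. (norm c)\<^sup>2 * (jacobi_weight \<alpha> \<beta> x * (norm (f x))\<^sup>2)) absolutely_integrable_on unit_ivl"
    using f by (intro set_integrable_mult_right) (auto simp: square_integrable_iff)
  then show "(\<lambda>x. jacobi_weight \<alpha> \<beta> x * ((norm c)\<^sup>2 * (norm (f x))\<^sup>2)) absolutely_integrable_on unit_ivl"
    by (simp add: algebra_simps)
qed (simp add: norm_mult power_mult_distrib)

lemma square_integrable_zero: "square_integrable (jacobi_measure \<alpha> \<beta>) (\<lambda>x. 0)"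
  by (simp add: square_integrable_def)

lemma square_integrable_mult:
  assumes f: "square_integrable (jacobi_measure \<alpha> \<beta>) f" and g: "square_integrable (jacobi_measure \<alpha> \<beta>) g"
    and h: "h \<in> borel_measurable (lebesgue_on unit_ivl)" "\<And>x. x \<in> unit_ivl \<Longrightarrow> norm (h x) \<le> norm (f x) * norm (g x)"
  shows "(\<lambda>x. jacobi_weight \<alpha> \<beta> x *\<^sub>R (h x :: complex)) absolutely_integrable_on unit_ivl"
proof (rule measurable_bounded_by_integrable_imp_absolutely_integrable)
  show "(\<lambda>x. jacobi_weight \<alpha> \<beta> x *\<^sub>R h x) \<in> borel_measurable (lebesgue_on unit_ivl)"
    using h(1) by measurable
  have "(\<lambda>x. jacobi_weight \<alpha> \<beta> x * (norm (f x))\<^sup>2 + jacobi_weight \<alpha> \<beta> x * (norm (g x))\<^sup>2) absolutely_integrable_on unit_ivl"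
    using f g by (intro set_integral_add(1)) (auto simp: square_integrable_iff)
  then show "(\<lambda>x. jacobi_weight \<alpha> \<beta> x * (norm (f x))\<^sup>2 + jacobi_weight \<alpha> \<beta> x * (norm (g x))\<^sup>2) integrable_on unit_ivl"
    by (simp add: absolutely_integrable_on_def)
  fix x assume x: "x \<in> unit_ivl"
  have "norm (h x) \<le> (norm (f x))\<^sup>2 + (norm (g x))\<^sup>2"
  proof -
    have "2 * (norm (f x) * norm (g x)) \<le> (norm (f x))\<^sup>2 + (norm (g x))\<^sup>2"
      using sum_squares_bound[of "norm (f x)" "norm (g x)"] by simp
    moreover have "0 \<le> norm (f x) * norm (g x)" by simp
    ultimately show ?thesis using h(2)[OF x] by linarith
  qed
  then have "jacobi_weight \<alpha> \<beta> x * norm (h x) \<le> jacobi_weight \<alpha> \<beta> x * ((norm (f x))\<^sup>2 + (norm (g x))\<^sup>2)"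
    using jacobi_weight_pos[OF x, of \<alpha> \<beta>] by (intro mult_left_mono) auto
  then show "norm (jacobi_weight \<alpha> \<beta> x *\<^sub>R h x) \<le> jacobi_weight \<alpha> \<beta> x * (norm (f x))\<^sup>2 + jacobi_weight \<alpha> \<beta> x * (norm (g x))\<^sup>2"
    using jacobi_weight_pos[OF x, of \<alpha> \<beta>] by (simp add: algebra_simps)
qed simp

text \<open>The substitution t = (1 - x) / 2 in Euler's Beta integral, up to a power of 2.\<close>

lemma powr_product_integrable:
  fixes a b :: real
  assumes "a > -1" "b > -1"
  shows "(\<lambda>x. (1 - x) powr a * (1 + x) powr b) absolutely_integrable_on unit_ivl"
proof -
  have *: "((\<lambda>t. t powr (a + 1 - 1) * (1 - t) powr (b + 1 - 1)) has_integral Beta (a + 1) (b + 1)) (cbox 0 1)"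
    using has_integral_Beta_real[of "a+1" "b+1"] assms by simp
  have aff: "- 1 / 2 \<noteq> (0::real)" by simp
  note aff = has_integral_affinity[OF * aff, of "1/2"]
  have "(\<lambda>x. ((1 - x) / 2) powr a * ((1 + x) / 2) powr b) integrable_on {-1..1}"
  proof -
    have "(\<lambda>x::real. (1 / (-1/2::real)) *\<^sub>R x + - ((1 / (-1/2)) *\<^sub>R (1/2))) ` cbox 0 1 = {-1..1::real}"
    proof -
      have "(\<lambda>x::real. (1 / (-1/2::real)) *\<^sub>R x + - ((1 / (-1/2)) *\<^sub>R (1/2))) = (\<lambda>x. (-2) * x + 1)" by (rule ext) simp
      then show ?thesis by (simp only: box_real image_affinity_atLeastAtMost) simp
    qed
    moreover have "((-1/2) *\<^sub>R x + 1/2) = (1 - x) / 2" "1 - (1 - x) / 2 = (1 + x) / 2" for x :: real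
      by (simp_all add: field_simps)
    ultimately show ?thesis
      using has_integral_integrable[OF aff] by (simp only: add_diff_cancel_right')
  qed
  then have "(\<lambda>x. 2 powr (a + b) * (((1 - x) / 2) powr a * ((1 + x) / 2) powr b)) integrable_on unit_ivl"
    unfolding integrable_on_open_interval_real by (rule integrable_on_mult_right)
  then have "(\<lambda>x. (1 - x) powr a * (1 + x) powr b) integrable_on unit_ivl"
    by (rule integrable_eq) (auto simp: powr_divide powr_add)
  then show ?thesis by (rule nonnegative_absolutely_integrable_1) simp
qed

text \<open>With a derivative integrable up to the ends, h is an indefinite integral and therefore
  has limits there; the integral of the derivative is the difference of these limits. Both the
  boundary values and Green's formula are drawn from this.\<close>

lemma AC_loc_extend:
  assumes h: "AC_loc h" and G: "G absolutely_integrable_on unit_ivl" and N: "negligible N"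
    and deriv: "\<And>x. x \<in> unit_ivl - N \<Longrightarrow> (h has_vector_derivative G x) (at x)"
  obtains H where "continuous_on {-1..1} H" "\<And>x. x \<in> unit_ivl \<Longrightarrow> H x = h x"
    "integral unit_ivl G = H 1 - H (-1)"
proof -
  have Gi: "G integrable_on {-1..1}"
    using G by (simp add: absolutely_integrable_on_def integrable_on_open_interval_real)
  define J where "J x = integral {-1..x} G" for x
  define H where "H x = h 0 + (J x - J 0)" for x
  have Jd: "h y - h x = J y - J x" if "-1 < x" "x \<le> y" "y < 1" for x y
  proof -
    have "(G has_integral h y - h x) {x..y}"
      by (rule has_integral_spike[OF N _ AC_loc_FTC[OF h that]]) (use deriv that in \<open>auto intro!: rderiv_eq[symmetric]\<close>)
    then have "integral {x..y} G = h y - h x" by (rule integral_unique)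
    moreover have "integral {-1..x} G + integral {x..y} G = integral {-1..y} G"
      by (rule Henstock_Kurzweil_Integration.integral_combine)
        (use that in \<open>auto intro: integrable_subinterval_real[OF Gi]\<close>)
    ultimately show ?thesis unfolding J_def by (metis add_diff_cancel_left')
  qed
  show thesis
  proof (rule that)
    show "continuous_on {-1..1} H"
      unfolding H_def J_def by (intro continuous_intros indefinite_integral_continuous_1 Gi)
    show "H x = h x" if "x \<in> unit_ivl" for x
      using Jd[of 0 x] Jd[of x 0] that by (cases "0 \<le> x") (auto simp: H_def algebra_simps)
    show "integral unit_ivl G = H 1 - H (-1)"
      by (simp add: H_def J_def integral_open_interval_real)
  qed
qed

lemma continuous_extension_limits:
  fixes H :: "real \<Rightarrow> complex"
  assumes "continuous_on {-1..1} H" "\<And>x. x \<in> unit_ivl \<Longrightarrow> H x = h x"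
  shows "(h \<longlongrightarrow> H 1) (at_left 1)" "(h \<longlongrightarrow> H (-1)) (at_right (-1))"
proof -
  have "(H \<longlongrightarrow> H 1) (at_left 1)" "(H \<longlongrightarrow> H (-1)) (at_right (-1))"
    using continuous_on_Icc_at_leftD[OF assms(1)] continuous_on_Icc_at_rightD[OF assms(1)] by auto
  moreover have "\<forall>\<^sub>F x in at_left 1. H x = h x"
    using eventually_at_left_real[of "-1" 1] by (rule eventually_mono[OF _]) (auto intro: assms(2))
  moreover have "\<forall>\<^sub>F x in at_right (-1). H x = h x"
    using eventually_at_right_real[of "-1" 1] by (rule eventually_mono[OF _]) (auto intro: assms(2))
  ultimately show "(h \<longlongrightarrow> H 1) (at_left 1)" "(h \<longlongrightarrow> H (-1)) (at_right (-1))"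
    by (auto elim: Lim_transform_eventually)
qed

lemma cnj_measurable:
  "h \<in> borel_measurable (lebesgue_on unit_ivl) \<Longrightarrow> (\<lambda>x. cnj (h x)) \<in> borel_measurable (lebesgue_on unit_ivl)"
  by (rule measurable_compose[OF _ borel_measurable_continuous_onI[OF continuous_on_cnj[OF continuous_on_id]]])

section \<open>A second solution of the homogeneous equation\<close>

text \<open>Together with the constant 1 such a u spans the solutions of the homogeneous equation.
  The normalisation p u' = 1 fixes it up to an additive constant, which is left free.\<close>

definition second_solution :: "real \<Rightarrow> real \<Rightarrow> (real \<Rightarrow> real) \<Rightarrow> bool" where
  "second_solution \<alpha> \<beta> u \<longleftrightarrow> (\<forall>x\<in>unit_ivl. (u has_real_derivative 1 / jacobi_p \<alpha> \<beta> x) (at x))"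

lemma second_solution_exists: "\<exists>u. second_solution \<alpha> \<beta> u"
proof -
  have "isCont (\<lambda>x. 1 / jacobi_p \<alpha> \<beta> x) x" if "x \<in> unit_ivl" for x
  proof -
    have "isCont (jacobi_p \<alpha> \<beta>) x" using jacobi_p_deriv[OF that] by (rule DERIV_isCont)
    then show ?thesis using jacobi_p_pos[OF that, of \<alpha> \<beta>] by (intro continuous_intros) auto
  qed
  then obtain F where "\<forall>x. -1 < x \<longrightarrow> x < 1 \<longrightarrow> (F has_vector_derivative 1 / jacobi_p \<alpha> \<beta> x) (at x)"
    using einterval_antiderivative[of "ereal (-1)" "ereal 1" "\<lambda>x. 1 / jacobi_p \<alpha> \<beta> x"] by auto
  then show ?thesis
    unfolding second_solution_def has_real_derivative_iff_has_vector_derivative by (intro exI[of _ F]) simp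
qed

lemma second_solution_continuous: "second_solution \<alpha> \<beta> u \<Longrightarrow> continuous_on unit_ivl u"
  by (rule continuous_at_imp_continuous_on) (auto simp: second_solution_def dest!: DERIV_isCont)

lemma second_solution_AC_loc:
  assumes "second_solution \<alpha> \<beta> u" shows "AC_loc (\<lambda>x. of_real (u x))"
proof (rule AC_loc_C1[OF has_vector_derivative_of_real])
  show "(u has_real_derivative 1 / jacobi_p \<alpha> \<beta> x) (at x)" if "x \<in> unit_ivl" for x
    using assms that by (simp add: second_solution_def)
  show "continuous_on unit_ivl (\<lambda>x. complex_of_real (1 / jacobi_p \<alpha> \<beta> x))"
    unfolding jacobi_p_def by (intro continuous_intros) auto
qed

text \<open>Near 1 the function 1 / p is of order (1 - x)^(-\<alpha> - 1), so u grows like (1 -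
  x)^(-\<alpha>), or like a logarithm if \<alpha> = 0. Positive exponents g and h absorb the
  logarithm and give one formula for all cases.\<close>

lemma second_solution_bound:
  assumes u: "second_solution \<alpha> \<beta> u" and \<alpha>: "0 \<le> \<alpha>" and \<beta>: "0 \<le> \<beta>" and g: "\<alpha> \<le> g" "0 < g" and h: "\<beta> \<le> h" "0 < h"
  obtains C where "C > 0" "\<And>x. x \<in> unit_ivl \<Longrightarrow> \<bar>u x\<bar> \<le> C * ((1 - x) powr (-g) + (1 + x) powr (-h))"
proof -
  \<comment> \<open>A primitive of a majorant of 1 / p; as u is increasing, its increments are
    bounded by those of V.\<close>
  define V where "V x = (1 - x) powr (-g) / g - (1 + x) powr (-h) / h" for x
  have dV: "(V has_real_derivative (1 - x) powr (-g - 1) + (1 + x) powr (-h - 1)) (at x)" if x: "x \<in> unit_ivl" for x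
  proof -
    have "((\<lambda>y. (1 - y) powr (-g)) has_real_derivative (-g) * (1 - x) powr (-g - of_nat 1) * (- 1)) (at x)"
      using x by (intro DERIV_fun_powr) (auto intro!: derivative_eq_intros)
    moreover have "((\<lambda>y. (1 + y) powr (-h)) has_real_derivative (-h) * (1 + x) powr (-h - of_nat 1) * 1) (at x)"
      using x by (intro DERIV_fun_powr) (auto intro!: derivative_eq_intros)
    ultimately have "((\<lambda>y. (1 - y) powr (-g) / g - (1 + y) powr (-h) / h) has_real_derivative
       (-g) * (1 - x) powr (-g - of_nat 1) * (- 1) / g - (-h) * (1 + x) powr (-h - of_nat 1) * 1 / h) (at x)"
      by (intro DERIV_diff DERIV_cdivide)
    then show ?thesis using g h by (simp add: V_def[abs_def])
  qed
  \<comment> \<open>On each half of the interval the factor that is singular at the other end is at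
    most 1.\<close>
  have le: "1 / jacobi_p \<alpha> \<beta> x \<le> (1 - x) powr (-g - 1) + (1 + x) powr (-h - 1)" if x: "x \<in> unit_ivl" for x
  proof (cases "0 \<le> x")
    case True
    have "(1 + x) powr (-\<beta> - 1) \<le> (1 + x) powr 0" using True \<beta> by (intro powr_mono) auto
    moreover have "(1 - x) powr (-\<alpha> - 1) \<le> (1 - x) powr (-g - 1)" using True x g by (intro powr_mono') auto
    ultimately have "(1 - x) powr (-\<alpha> - 1) * (1 + x) powr (-\<beta> - 1) \<le> (1 - x) powr (-g - 1) * 1"
      using True x by (intro mult_mono) auto
    moreover have "1 / jacobi_p \<alpha> \<beta> x = (1 - x) powr (-\<alpha> - 1) * (1 + x) powr (-\<beta> - 1)"
      using x by (simp add: jacobi_p_def powr_minus_divide[symmetric] powr_minus[symmetric] divide_inverse)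
    ultimately show ?thesis by (simp add: add_increasing2)
  next
    case False
    have "(1 - x) powr (-\<alpha> - 1) \<le> (1 - x) powr 0" using False \<alpha> by (intro powr_mono) auto
    moreover have "(1 + x) powr (-\<beta> - 1) \<le> (1 + x) powr (-h - 1)" using False x h by (intro powr_mono') auto
    ultimately have "(1 - x) powr (-\<alpha> - 1) * (1 + x) powr (-\<beta> - 1) \<le> 1 * (1 + x) powr (-h - 1)"
      using False x by (intro mult_mono) auto
    moreover have "1 / jacobi_p \<alpha> \<beta> x = (1 - x) powr (-\<alpha> - 1) * (1 + x) powr (-\<beta> - 1)"
      using x by (simp add: jacobi_p_def powr_minus_divide[symmetric] powr_minus[symmetric] divide_inverse)
    ultimately show ?thesis by (simp add: add_increasing)
  qed
  have pos: "0 < 1 / jacobi_p \<alpha> \<beta> x" if "x \<in> unit_ivl" for x using jacobi_p_pos[OF that, of \<alpha> \<beta>] by simp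
  have diff: "\<bar>u y - u x\<bar> \<le> V y - V x" if xy: "-1 < x" "x \<le> y" "y < 1" for x y
  proof -
    have "V x - u x \<le> V y - u y"
    proof (rule DERIV_nonneg_imp_nondecreasing[OF xy(2)])
      fix t assume "x \<le> t" "t \<le> y"
      then have t: "t \<in> unit_ivl" using xy by auto
      have "((\<lambda>t. V t - u t) has_real_derivative
          (1 - t) powr (-g - 1) + (1 + t) powr (-h - 1) - 1 / jacobi_p \<alpha> \<beta> t) (at t)"
        using u t by (intro DERIV_diff dV) (auto simp: second_solution_def)
      then show "\<exists>D. ((\<lambda>t. V t - u t) has_real_derivative D) (at t) \<and> 0 \<le> D"
        using le[OF t] by (intro exI conjI) auto
    qed
    moreover have "u x \<le> u y"
    proof (rule DERIV_nonneg_imp_nondecreasing[OF xy(2)])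
      fix t assume "x \<le> t" "t \<le> y"
      then have t: "t \<in> unit_ivl" using xy by auto
      then show "\<exists>D. (u has_real_derivative D) (at t) \<and> 0 \<le> D"
        using u pos[OF t] unfolding second_solution_def by (intro exI[of _ "1 / jacobi_p \<alpha> \<beta> t"]) simp
    qed
    ultimately show ?thesis by simp
  qed
  define C where "C = 1 / g + 1 / h + (\<bar>u 0\<bar> + \<bar>V 0\<bar>)"
  show thesis
  proof (rule that)
    show C: "C > 0" using g h by (simp add: C_def add_pos_nonneg)
    fix x :: real assume x: "x \<in> unit_ivl"
    let ?s = "(1 - x) powr (-g) + (1 + x) powr (-h)"
    have "\<bar>u x\<bar> \<le> \<bar>u 0\<bar> + \<bar>V 0\<bar> + \<bar>V x\<bar>"
      using diff[of 0 x] diff[of x 0] x by (cases "0 \<le> x") auto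
    moreover have "\<bar>V x\<bar> \<le> (1 / g + 1 / h) * ?s"
    proof -
      have "\<bar>V x\<bar> \<le> \<bar>(1 - x) powr (-g) / g\<bar> + \<bar>(1 + x) powr (-h) / h\<bar>" unfolding V_def by (rule abs_triangle_ineq4)
      also have "\<dots> = (1 / g) * (1 - x) powr (-g) + (1 / h) * (1 + x) powr (-h)" using g h by simp
      also have "\<dots> \<le> (1 / g + 1 / h) * ?s" using g h by (simp add: distrib_left distrib_right)
      finally show ?thesis .
    qed
    \<comment> \<open>This absorbs the constant \<bar>u 0\<bar> + \<bar>V 0\<bar>: one of the two
      powers always has base at most 1 and negative exponent.\<close>
    moreover have "1 \<le> ?s"
    proof (cases "0 \<le> x")
      case True
      then have "(1 - x) powr 0 \<le> (1 - x) powr (-g)" using x g by (intro powr_mono') auto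
      then show ?thesis using x by (simp add: add_increasing2)
    next
      case False
      then have "(1 + x) powr 0 \<le> (1 + x) powr (-h)" using x h by (intro powr_mono') auto
      then show ?thesis using x by (simp add: add_increasing)
    qed
    then have "(\<bar>u 0\<bar> + \<bar>V 0\<bar>) * 1 \<le> (\<bar>u 0\<bar> + \<bar>V 0\<bar>) * ?s" by (intro mult_left_mono) auto
    ultimately show "\<bar>u x\<bar> \<le> C * ?s" by (simp add: C_def distrib_right)
  qed
qed

text \<open>The limit-circle property of both ends. At 1 the function w u^2 is at most of order (1 -
  x)^(\<alpha> - 2 g), and \<alpha> < 1 leaves room for g \<ge> \<alpha> with this exponent above
  -1.\<close>

lemma second_solution_square_integrable:
  assumes u: "second_solution \<alpha> \<beta> u" and "0 \<le> \<alpha>" "\<alpha> < 1" "0 \<le> \<beta>" "\<beta> < 1"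
  shows "(\<lambda>x. jacobi_weight \<alpha> \<beta> x * (1 + (u x)\<^sup>2)) absolutely_integrable_on unit_ivl"
proof -
  \<comment> \<open>g exceeds \<alpha> by (1 - \<alpha>) / 4, is positive even for \<alpha> = 0, and
    \<alpha> - 2 g = - (1 + \<alpha>) / 2 > -1.\<close>
  define g h where "g = (1 + 3 * \<alpha>) / 4" and "h = (1 + 3 * \<beta>) / 4"
  have gh: "\<alpha> \<le> g" "0 < g" "\<beta> \<le> h" "0 < h" "\<alpha> - 2 * g > -1" "\<beta> - 2 * h > -1" using assms by (simp_all add: g_def h_def field_simps)
  obtain C where C: "C > 0" "\<And>x. x \<in> unit_ivl \<Longrightarrow> \<bar>u x\<bar> \<le> C * ((1 - x) powr (-g) + (1 + x) powr (-h))"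
    using second_solution_bound[OF u assms(2,4) gh(1,2,3,4)] by blast
  let ?f = "\<lambda>x. (1 - x) powr \<alpha> * (1 + x) powr \<beta> + 2 * C\<^sup>2 * ((1 - x) powr (\<alpha> - 2 * g) * (1 + x) powr \<beta>
     + (1 - x) powr \<alpha> * (1 + x) powr (\<beta> - 2 * h))"
  show ?thesis
  proof (rule measurable_bounded_by_integrable_imp_absolutely_integrable)
    show "(\<lambda>x. jacobi_weight \<alpha> \<beta> x * (1 + (u x)\<^sup>2)) \<in> borel_measurable (lebesgue_on unit_ivl)"
      by (intro continuous_measurable_unit_ivl continuous_intros jacobi_weight_continuous second_solution_continuous[OF u])
    have "?f absolutely_integrable_on unit_ivl"
      using assms gh by (intro set_integral_add(1) set_integrable_mult_right powr_product_integrable) auto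
    then show "?f integrable_on unit_ivl" by (simp add: absolutely_integrable_on_def)
    fix x :: real assume x: "x \<in> unit_ivl"
    let ?a = "(1 - x) powr (-g)" and ?b = "(1 + x) powr (-h)"
    have "(u x)\<^sup>2 \<le> (C * (?a + ?b))\<^sup>2" using C(2)[OF x] power_mono[of "\<bar>u x\<bar>" "C * (?a + ?b)" 2] by simp
    also have "\<dots> = C\<^sup>2 * (?a\<^sup>2 + ?b\<^sup>2 + 2 * ?a * ?b)" by (simp add: power_mult_distrib power2_sum)
    also have "\<dots> \<le> C\<^sup>2 * (2 * (?a\<^sup>2 + ?b\<^sup>2))"
      using sum_squares_bound[of ?a ?b] by (intro mult_left_mono) auto
    also have "\<dots> = 2 * C\<^sup>2 * (?a\<^sup>2 + ?b\<^sup>2)" by simp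
    finally have "(u x)\<^sup>2 \<le> 2 * C\<^sup>2 * (?a\<^sup>2 + ?b\<^sup>2)" .
    moreover have "?a\<^sup>2 = (1 - x) powr (- 2 * g)" "?b\<^sup>2 = (1 + x) powr (- 2 * h)"
      using x by (auto simp: power2_eq_square simp flip: powr_add)
    ultimately have "jacobi_weight \<alpha> \<beta> x * (1 + (u x)\<^sup>2) \<le> jacobi_weight \<alpha> \<beta> x *
        (1 + 2 * C\<^sup>2 * ((1 - x) powr (- 2 * g) + (1 + x) powr (- 2 * h)))"
      using jacobi_weight_pos[OF x, of \<alpha> \<beta>] by (intro mult_left_mono) auto
    also have "\<dots> = ?f x"
      using x by (simp add: jacobi_weight_def diff_conv_add_uminus powr_add algebra_simps del: add_uminus_conv_diff)
    finally show "norm (jacobi_weight \<alpha> \<beta> x * (1 + (u x)\<^sup>2)) \<le> ?f x"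
      using jacobi_weight_pos[OF x, of \<alpha> \<beta>] by simp
  qed simp
qed

section \<open>Square linear systems\<close>

text \<open>Gaussian elimination: a nonzero entry of the new equation serves as pivot, and the
  reduced system B has one equation and one unknown fewer.\<close>

lemma underdetermined_system:
  fixes A :: "'j \<Rightarrow> 'i \<Rightarrow> 'a::field"
  assumes "finite J" "finite I" "card J < card I"
  shows "\<exists>c. (\<exists>i\<in>I. c i \<noteq> 0) \<and> (\<forall>j\<in>J. (\<Sum>i\<in>I. A j i * c i) = 0)"
  using assms
proof (induction J arbitrary: I A rule: finite_induct)
  case empty
  then obtain i where "i \<in> I" by (metis card.empty card_gt_0_iff equals0I)
  then show ?case by (intro exI[of _ "\<lambda>_. 1"]) auto
next
  case (insert j J)
  show ?case
  proof (cases "\<forall>i\<in>I. A j i = 0")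
    case True
    then have "\<exists>c. (\<exists>i\<in>I. c i \<noteq> 0) \<and> (\<forall>j\<in>J. (\<Sum>i\<in>I. A j i * c i) = 0)"
      using insert by (intro insert.IH) auto
    then show ?thesis using True by auto
  next
    case False
    then obtain p where p: "p \<in> I" "A j p \<noteq> 0" by blast
    define B where "B k i = A k i - A k p * A j i / A j p" for k i
    have "card J < card (I - {p})" using insert p by simp
    then obtain c where c: "\<exists>i\<in>I-{p}. c i \<noteq> 0" "\<forall>k\<in>J. (\<Sum>i\<in>I-{p}. B k i * c i) = 0"
      using insert.IH[of "I - {p}" B] insert.prems by auto
    define c' where "c' = c(p := - (\<Sum>i\<in>I-{p}. A j i * c i) / A j p)"
    have split: "(\<Sum>i\<in>I. A k i * c' i) = A k p * c' p + (\<Sum>i\<in>I-{p}. A k i * c i)" for k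
    proof -
      have "(\<Sum>i\<in>I. A k i * c' i) = A k p * c' p + (\<Sum>i\<in>I-{p}. A k i * c' i)"
        using p insert.prems by (simp add: sum.remove)
      also have "(\<Sum>i\<in>I-{p}. A k i * c' i) = (\<Sum>i\<in>I-{p}. A k i * c i)"
        by (intro sum.cong) (auto simp: c'_def)
      finally show ?thesis .
    qed
    have "(\<Sum>i\<in>I. A j i * c' i) = 0" using p unfolding split by (simp add: c'_def)
    moreover have "(\<Sum>i\<in>I. A k i * c' i) = 0" if "k \<in> J" for k
    proof -
      have "(\<Sum>i\<in>I-{p}. B k i * c i) = (\<Sum>i\<in>I-{p}. A k i * c i) - A k p / A j p * (\<Sum>i\<in>I-{p}. A j i * c i)"
        unfolding B_def sum_distrib_left sum_subtractf[symmetric] by (intro sum.cong) (auto simp: algebra_simps)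
      then show ?thesis using c(2) that unfolding split by (simp add: c'_def)
    qed
    moreover have "\<exists>i\<in>I. c' i \<noteq> 0" using c(1) by (auto simp: c'_def)
    ultimately show ?thesis by auto
  qed
qed

text \<open>The right-hand side becomes one more column, indexed by \<open>None\<close>. The
  enlarged homogeneous system has a nontrivial solution; injectivity forbids its \<open>None\<close>
  component to vanish, so it can be divided out.\<close>

lemma injective_system_surjective:
  fixes A :: "'j \<Rightarrow> 'i \<Rightarrow> 'a::field"
  assumes fin: "finite J" "finite I" "card J = card I"
    and inj: "\<And>c. (\<forall>j\<in>J. (\<Sum>i\<in>I. A j i * c i) = 0) \<Longrightarrow> \<forall>i\<in>I. c i = 0"
  shows "\<exists>c. \<forall>j\<in>J. (\<Sum>i\<in>I. A j i * c i) = b j"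
proof -
  define A' where "A' j z = (case z of None \<Rightarrow> - b j | Some i \<Rightarrow> A j i)" for j z
  obtain c where c: "\<exists>z\<in>insert None (Some ` I). c z \<noteq> 0" "\<forall>j\<in>J. (\<Sum>z\<in>insert None (Some ` I). A' j z * c z) = 0"
    using underdetermined_system[of J "insert None (Some ` I)" A'] fin by (auto simp: card_image)
  have eq: "(\<Sum>i\<in>I. A j i * c (Some i)) = b j * c None" if "j \<in> J" for j
  proof -
    have "(\<Sum>z\<in>insert None (Some ` I). A' j z * c z) = - b j * c None + (\<Sum>i\<in>I. A j i * c (Some i))"
      using fin by (subst sum.insert) (auto simp: A'_def sum.reindex)
    then show ?thesis using c(2) that by (simp add: add_eq_0_iff)
  qed
  have c0: "c None \<noteq> 0"
  proof
    assume 0: "c None = 0"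
    then have "\<forall>i\<in>I. c (Some i) = 0" using eq by (intro inj) auto
    then show False using c(1) 0 by auto
  qed
  show ?thesis
  proof (intro exI[of _ "\<lambda>i. c (Some i) / c None"] ballI)
    fix j assume "j \<in> J"
    then show "(\<Sum>i\<in>I. A j i * (c (Some i) / c None)) = b j"
      using eq[of j] c0 by (simp add: sum_divide_distrib[symmetric])
  qed
qed

section \<open>Boundary values\<close>

text \<open>Keeping u as a parameter lets the reflection x \<mapsto> -x, which swaps the exponents
  and turns u into - u (- x), produce another instance; what is shown at the end 1 then transfers to
  -1.\<close>

locale jacobi =
  fixes \<alpha> \<beta> :: real and u :: "real \<Rightarrow> real"
  assumes \<alpha>: "0 \<le> \<alpha>" "\<alpha> < 1" and \<beta>: "0 \<le> \<beta>" "\<beta> < 1" and u: "second_solution \<alpha> \<beta> u"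
begin

abbreviation "w \<equiv> jacobi_weight \<alpha> \<beta>"
abbreviation "p \<equiv> jacobi_p \<alpha> \<beta>"
abbreviation "L2 \<equiv> square_integrable (jacobi_measure \<alpha> \<beta>)"
abbreviation "ell \<equiv> jacobi_expr \<alpha> \<beta>"
abbreviation "pow \<equiv> jacobi_pow \<alpha> \<beta>"
abbreviation "qd \<equiv> qder \<alpha> \<beta>"

text \<open>Near an endpoint \<open>f = aco f + u (qd f)\<close>, where \<open>1\<close> and \<open>u\<close> solve the homogeneous equation.
  Both coefficients extend continuously to the endpoints, even though \<open>u\<close> is unbounded there.\<close>

definition aco :: "(real \<Rightarrow> complex) \<Rightarrow> real \<Rightarrow> complex" where
  "aco f x = f x - u x *\<^sub>R qd f x"

lemma L2_dominated_u:
  assumes "f \<in> borel_measurable (lebesgue_on unit_ivl)"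
    and "\<And>x. x \<in> unit_ivl \<Longrightarrow> (norm (f x))\<^sup>2 \<le> C * (1 + (u x)\<^sup>2)"
  shows "L2 f"
proof (rule square_integrable_dominated[OF assms(1) _ assms(2)])
  have "(\<lambda>x. C * (w x * (1 + (u x)\<^sup>2))) absolutely_integrable_on unit_ivl"
    by (intro set_integrable_mult_right second_solution_square_integrable u \<alpha> \<beta>)
  then show "(\<lambda>x. w x * (C * (1 + (u x)\<^sup>2))) absolutely_integrable_on unit_ivl"
    by (simp add: algebra_simps)
qed

lemma L2_one: "L2 (\<lambda>_. 1)"
  by (rule L2_dominated_u[where C = 1]) auto

lemma L2_u: "L2 (\<lambda>x. of_real (u x))"
proof (rule L2_dominated_u[where C = 1])
  show "(\<lambda>x. complex_of_real (u x)) \<in> borel_measurable (lebesgue_on unit_ivl)"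
    by (intro continuous_measurable_unit_ivl continuous_intros second_solution_continuous[OF u])
qed auto

lemma qd_deriv:
  assumes "reg 1 F"
  obtains N where "negligible N" "\<And>x. x \<in> unit_ivl - N \<Longrightarrow> (qd F has_vector_derivative - (w x *\<^sub>R ell F x)) (at x)"
proof (rule that)
  show "negligible {x \<in> unit_ivl. \<not> qd F differentiable (at x)}"
    by (rule AC_loc_negligible[OF AC_loc_qder[OF assms]])
  fix x assume x: "x \<in> unit_ivl - {x \<in> unit_ivl. \<not> qd F differentiable (at x)}"
  then have "(qd F has_vector_derivative rderiv (qd F) x) (at x)" by (auto intro: rderiv_works)
  moreover have "rderiv (qd F) x = - (w x *\<^sub>R ell F x)"
    using x jacobi_weight_pos[of x \<alpha> \<beta>] by (simp add: jacobi_expr_qder)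
  ultimately show "(qd F has_vector_derivative - (w x *\<^sub>R ell F x)) (at x)" by simp
qed

lemma AC_loc_aco:
  assumes "reg 1 F" shows "AC_loc (aco F)"
proof -
  have "AC_loc (\<lambda>x. F x + (-1) * (of_real (u x) * qd F x))"
    using reg_AC_loc[OF assms] AC_loc_qder[OF assms]
    by (intro AC_loc_add AC_loc_mult AC_loc_const second_solution_AC_loc[OF u])
  then show ?thesis by (simp add: aco_def[abs_def] scaleR_conv_of_real)
qed

lemma p_deriv_cancel:
  assumes "x \<in> unit_ivl" shows "(1 / p x) *\<^sub>R qd F x = rderiv F x"
  using jacobi_p_pos[OF assms, of \<alpha> \<beta>] by (simp add: qder_def)

text \<open>Variation of constants: because p u' = 1, the term u' times the quasi-derivative cancels
  f'.\<close>

lemma aco_deriv: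
  assumes F: "F differentiable (at x)" and x: "x \<in> unit_ivl"
    and q: "(qd F has_vector_derivative - (w x *\<^sub>R ell F x)) (at x)"
  shows "(aco F has_vector_derivative w x *\<^sub>R (u x *\<^sub>R ell F x)) (at x)"
proof -
  have du: "(u has_real_derivative 1 / p x) (at x)" using u x by (simp add: second_solution_def)
  have "((\<lambda>x. F x - u x *\<^sub>R qd F x) has_vector_derivative
      rderiv F x - (u x *\<^sub>R (- (w x *\<^sub>R ell F x)) + (1 / p x) *\<^sub>R qd F x)) (at x)"
    by (intro has_vector_derivative_diff has_vector_derivative_scaleR rderiv_works F q du)
  then show ?thesis
    unfolding p_deriv_cancel[OF x] by (simp add: aco_def[abs_def] mult.commute)
qed

lemma L2_mult_u_integrable:
  assumes "L2 g"
  shows "(\<lambda>x. w x *\<^sub>R (u x *\<^sub>R g x)) absolutely_integrable_on unit_ivl"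
    and "(\<lambda>x. - (w x *\<^sub>R g x)) absolutely_integrable_on unit_ivl"
proof -
  have m: "g \<in> borel_measurable (lebesgue_on unit_ivl)" using assms by (simp add: square_integrable_iff)
  have "u \<in> borel_measurable (lebesgue_on unit_ivl)"
    by (intro continuous_measurable_unit_ivl second_solution_continuous[OF u])
  then show "(\<lambda>x. w x *\<^sub>R (u x *\<^sub>R g x)) absolutely_integrable_on unit_ivl"
    using m by (intro square_integrable_mult[OF L2_u assms]) auto
  have "(\<lambda>x. w x *\<^sub>R (- g x)) absolutely_integrable_on unit_ivl"
    using m by (intro square_integrable_mult[OF L2_one assms]) auto
  then show "(\<lambda>x. - (w x *\<^sub>R g x)) absolutely_integrable_on unit_ivl" by simp
qed

lemma boundary_extension:
  assumes F: "reg 1 F" and L: "L2 (ell F)"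
  obtains Ha Hb where "continuous_on {-1..1} Ha" "continuous_on {-1..1} Hb"
    "\<And>x. x \<in> unit_ivl \<Longrightarrow> Ha x = aco F x" "\<And>x. x \<in> unit_ivl \<Longrightarrow> Hb x = qd F x"
proof -
  obtain N where N: "negligible N" "\<And>x. x \<in> unit_ivl - N \<Longrightarrow> (qd F has_vector_derivative - (w x *\<^sub>R ell F x)) (at x)"
    using qd_deriv[OF F] by blast
  obtain Hb where Hb: "continuous_on {-1..1} Hb" "\<And>x. x \<in> unit_ivl \<Longrightarrow> Hb x = qd F x"
    using AC_loc_extend[OF AC_loc_qder[OF F] L2_mult_u_integrable(2)[OF L] N] by blast
  obtain Ha where Ha: "continuous_on {-1..1} Ha" "\<And>x. x \<in> unit_ivl \<Longrightarrow> Ha x = aco F x"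
  proof (rule AC_loc_extend[OF AC_loc_aco[OF F] L2_mult_u_integrable(1)[OF L] N(1)])
    show "(aco F has_vector_derivative w x *\<^sub>R (u x *\<^sub>R ell F x)) (at x)" if "x \<in> unit_ivl - N" for x
      using that F by (intro aco_deriv N(2)) auto
  qed blast
  show thesis using that Ha Hb by blast
qed

text \<open>The coefficients are bounded on the closed interval, so \<bar>F\<bar> \<le> A +
  \<bar>u\<bar> B, and both 1 and u are square integrable.\<close>

lemma L2_of_ell:
  assumes F: "reg 1 F" and L: "L2 (ell F)"
  shows "L2 F"
proof -
  obtain Ha Hb where H: "continuous_on {-1..1} Ha" "continuous_on {-1..1} Hb"
    "\<And>x. x \<in> unit_ivl \<Longrightarrow> Ha x = aco F x" "\<And>x. x \<in> unit_ivl \<Longrightarrow> Hb x = qd F x"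
    using boundary_extension[OF assms] by blast
  have "bounded (Ha ` {-1..1})" "bounded (Hb ` {-1..1})"
    using H(1,2) by (auto intro!: compact_imp_bounded compact_continuous_image)
  then obtain A B where AB: "\<forall>x\<in>{-1..1}. norm (Ha x) \<le> A" "\<forall>x\<in>{-1..1}. norm (Hb x) \<le> B"
    by (auto simp: bounded_iff)
  show ?thesis
  proof (rule L2_dominated_u[where C = "2 * (A\<^sup>2 + B\<^sup>2)"])
    show "F \<in> borel_measurable (lebesgue_on unit_ivl)"
      by (intro continuous_measurable_unit_ivl AC_loc_continuous_on reg_AC_loc[OF F])
    fix x assume x: "x \<in> unit_ivl"
    have "norm (F x) \<le> norm (aco F x) + \<bar>u x\<bar> * norm (qd F x)"
      using norm_triangle_ineq[of "aco F x" "u x *\<^sub>R qd F x"] by (simp add: aco_def)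
    also have "\<dots> \<le> A + \<bar>u x\<bar> * B"
    proof -
      have "norm (aco F x) \<le> A" "norm (qd F x) \<le> B"
        using AB(1)[rule_format, of x] AB(2)[rule_format, of x] H(3,4)[OF x] x by simp_all
      then show ?thesis by (intro add_mono mult_left_mono) auto
    qed
    finally have "(norm (F x))\<^sup>2 \<le> (A + \<bar>u x\<bar> * B)\<^sup>2" by (intro power_mono) auto
    also have "\<dots> \<le> 2 * (A\<^sup>2 + (\<bar>u x\<bar> * B)\<^sup>2)"
      using sum_squares_bound[of A "\<bar>u x\<bar> * B"] by (simp add: power2_sum)
    also have "\<dots> \<le> 2 * (A\<^sup>2 + B\<^sup>2) * (1 + (u x)\<^sup>2)"
      by (simp add: power_mult_distrib algebra_simps)
    finally show "(norm (F x))\<^sup>2 \<le> 2 * (A\<^sup>2 + B\<^sup>2) * (1 + (u x)\<^sup>2)" .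
  qed
qed

abbreviation endpoint :: "bool \<Rightarrow> real filter" where
  "endpoint e \<equiv> (if e then at_left 1 else at_right (-1))"

lemma endpoint_nontrivial: "endpoint e \<noteq> bot"
  by simp

lemma aco_qd_limits:
  assumes F: "reg 1 F" and L: "L2 (ell F)"
  shows "\<exists>l. (aco F \<longlongrightarrow> l) (endpoint e)" "\<exists>l. (qd F \<longlongrightarrow> l) (endpoint e)"
proof -
  have ext: "\<exists>l. (h \<longlongrightarrow> l) (endpoint e)"
    if "continuous_on {-1..1} H" "\<And>x. x \<in> unit_ivl \<Longrightarrow> H x = h x" for H h :: "real \<Rightarrow> complex"
    using continuous_extension_limits[OF that] by (cases e) auto
  obtain Ha Hb where "continuous_on {-1..1} Ha" "continuous_on {-1..1} Hb"
    "\<And>x. x \<in> unit_ivl \<Longrightarrow> Ha x = aco F x" "\<And>x. x \<in> unit_ivl \<Longrightarrow> Hb x = qd F x"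
    using boundary_extension[OF assms] by blast
  then show "\<exists>l. (aco F \<longlongrightarrow> l) (endpoint e)" "\<exists>l. (qd F \<longlongrightarrow> l) (endpoint e)"
    using ext by blast+
qed

text \<open>In the boundary term F cnj (p G') - p F' cnj G the contributions of the real function u
  cancel when F and G are expanded. What remains pairs the coefficients of F with those of G, all of
  which converge, so it tends to 0 even if F or G is unbounded.\<close>

lemma Green_vanishing:
  assumes F: "reg 1 F" "L2 (ell F)" and G: "reg 1 G" "L2 (ell G)"
    and 0: "\<And>e. (aco F \<longlongrightarrow> 0) (endpoint e)" "\<And>e. (qd F \<longlongrightarrow> 0) (endpoint e)"
  shows "(\<lambda>x. w x *\<^sub>R (ell F x * cnj (G x) - F x * cnj (ell G x))) absolutely_integrable_on unit_ivl"
    and "integral unit_ivl (\<lambda>x. w x *\<^sub>R (ell F x * cnj (G x) - F x * cnj (ell G x))) = 0"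
proof -
  have LF: "L2 F" and LG: "L2 G" using L2_of_ell F G by blast+
  have meas: "F \<in> borel_measurable (lebesgue_on unit_ivl)" "G \<in> borel_measurable (lebesgue_on unit_ivl)"
    "ell F \<in> borel_measurable (lebesgue_on unit_ivl)" "ell G \<in> borel_measurable (lebesgue_on unit_ivl)"
    using LF LG F(2) G(2) by (simp_all add: square_integrable_iff)
  have "(\<lambda>x. w x *\<^sub>R (ell F x * cnj (G x))) absolutely_integrable_on unit_ivl"
    "(\<lambda>x. w x *\<^sub>R (F x * cnj (ell G x))) absolutely_integrable_on unit_ivl"
    by (rule square_integrable_mult[OF F(2) LG] square_integrable_mult[OF LF G(2)],
        intro borel_measurable_times meas cnj_measurable, simp add: norm_mult)+
  then have "(\<lambda>x. w x *\<^sub>R (ell F x * cnj (G x)) - w x *\<^sub>R (F x * cnj (ell G x))) absolutely_integrable_on unit_ivl"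
    by (rule set_integral_diff(1))
  then show int: "(\<lambda>x. w x *\<^sub>R (ell F x * cnj (G x) - F x * cnj (ell G x))) absolutely_integrable_on unit_ivl"
    by (simp add: scaleR_diff_right)
  define W where "W x = F x * cnj (qd G x) + (-1) * (qd F x * cnj (G x))" for x
  have W: "AC_loc W"
    unfolding W_def[abs_def] using F(1) G(1)
    by (intro AC_loc_add AC_loc_mult AC_loc_cnj AC_loc_const AC_loc_qder reg_AC_loc)
  obtain N1 where N1: "negligible N1" "\<And>x. x \<in> unit_ivl - N1 \<Longrightarrow> (qd F has_vector_derivative - (w x *\<^sub>R ell F x)) (at x)"
    using qd_deriv[OF F(1)] by blast
  obtain N2 where N2: "negligible N2" "\<And>x. x \<in> unit_ivl - N2 \<Longrightarrow> (qd G has_vector_derivative - (w x *\<^sub>R ell G x)) (at x)"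
    using qd_deriv[OF G(1)] by blast
  obtain H where H: "continuous_on {-1..1} H" "\<And>x. x \<in> unit_ivl \<Longrightarrow> H x = W x"
    "integral unit_ivl (\<lambda>x. w x *\<^sub>R (ell F x * cnj (G x) - F x * cnj (ell G x))) = H 1 - H (-1)"
  proof (rule AC_loc_extend[OF W int, of "N1 \<union> N2"])
    show "negligible (N1 \<union> N2)" using N1 N2 by simp
    fix x assume x: "x \<in> unit_ivl - (N1 \<union> N2)"
    have dF: "(F has_vector_derivative rderiv F x) (at x)" and dG: "(G has_vector_derivative rderiv G x) (at x)"
      using F(1) G(1) x by (auto intro: rderiv_works)
    have dc: "((\<lambda>x. cnj (h x)) has_vector_derivative cnj h') (at x)" if "(h has_vector_derivative h') (at x)" for h h'
      using that by (rule bounded_linear.has_vector_derivative[OF bounded_linear_cnj])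
    have "(W has_vector_derivative
        (F x * cnj (- (w x *\<^sub>R ell G x)) + rderiv F x * cnj (qd G x)) +
        (-1) * (qd F x * cnj (rderiv G x) + - (w x *\<^sub>R ell F x) * cnj (G x))) (at x)"
      unfolding W_def[abs_def] using x
      by (intro has_vector_derivative_add has_vector_derivative_mult has_vector_derivative_mult_right dc dF dG N1(2) N2(2)) auto
    moreover have "rderiv F x * cnj (qd G x) = qd F x * cnj (rderiv G x)"
      by (simp add: qder_def scaleR_conv_of_real)
    ultimately show "(W has_vector_derivative w x *\<^sub>R (ell F x * cnj (G x) - F x * cnj (ell G x))) (at x)"
      by (simp add: scaleR_conv_of_real algebra_simps)
  qed blast
  have "(W \<longlongrightarrow> 0) (endpoint e)" for e
  proof -
    obtain la lb where l: "(aco G \<longlongrightarrow> la) (endpoint e)" "(qd G \<longlongrightarrow> lb) (endpoint e)"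
      using aco_qd_limits[OF G] by metis
    have "((\<lambda>x. aco F x * cnj (qd G x) - qd F x * cnj (aco G x)) \<longlongrightarrow> 0 * cnj lb - 0 * cnj la) (endpoint e)"
      by (intro tendsto_intros 0 l)
    moreover have "(\<lambda>x. aco F x * cnj (qd G x) - qd F x * cnj (aco G x)) = W"
      by (rule ext) (simp add: W_def aco_def scaleR_conv_of_real algebra_simps)
    ultimately show ?thesis by simp
  qed
  from this[of True] this[of False] have "(W \<longlongrightarrow> 0) (at_left 1)" "(W \<longlongrightarrow> 0) (at_right (-1))" by simp_all
  moreover have "(W \<longlongrightarrow> H 1) (at_left 1)" "(W \<longlongrightarrow> H (-1)) (at_right (-1))"
    using continuous_extension_limits[OF H(1,2)] by blast+
  ultimately have "H 1 = 0" "H (-1) = 0" by (metis tendsto_unique trivial_limit_at_left_real trivial_limit_at_right_real)+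
  then show "integral unit_ivl (\<lambda>x. w x *\<^sub>R (ell F x * cnj (G x) - F x * cnj (ell G x))) = 0" using H(3) by simp
qed

end

section \<open>Boundary values on the maximal domain\<close>

lemma AC_loc_AE_zero:
  assumes f: "AC_loc f" and N: "negligible {x \<in> unit_ivl. f x \<noteq> 0}" and x: "x \<in> unit_ivl"
  shows "f x = 0"
proof -
  have "open {x \<in> unit_ivl. f x \<noteq> 0}"
  proof -
    have "{x \<in> unit_ivl. f x \<noteq> 0} = unit_ivl \<inter> f -` (- {0})" by auto
    then show ?thesis
      using continuous_open_preimage[OF AC_loc_continuous_on[OF f], of "- {0}"] by auto
  qed
  then have "{x \<in> unit_ivl. f x \<noteq> 0} = {}" using N open_not_negligible by blast
  then show ?thesis using x by blast
qed

lemma jacobi_expr_zero: "jacobi_expr \<alpha> \<beta> (\<lambda>_. 0) = (\<lambda>_. 0)"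
proof -
  have 0: "rderiv (\<lambda>_. 0) = (\<lambda>_. 0)"
    by (rule ext) (auto intro: rderiv_eq derivative_eq_intros)
  then have "qder \<alpha> \<beta> (\<lambda>_. 0) = (\<lambda>_. 0)" by (simp add: qder_def)
  then show ?thesis using 0 by (intro ext) (simp add: jacobi_expr_qder)
qed

lemma jacobi_pow_zero: "jacobi_pow \<alpha> \<beta> k (\<lambda>_. 0) = (\<lambda>_. 0)"
  by (induction k) (simp_all add: jacobi_expr_zero)

locale jacobi_power = jacobi +
  fixes n :: nat
  assumes n: "n \<ge> 1"
begin

abbreviation "V \<equiv> D_max \<alpha> \<beta> n"

lemma reg_pow: "reg (2 * n - 1) f \<Longrightarrow> k < n \<Longrightarrow> reg 1 (pow k f)"
proof -
  assume f: "reg (2 * n - 1) f" and k: "k < n"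
  have "2 * k + (2 * (n - k) - 1) = 2 * n - 1" using k by auto
  then have "reg (2 * (n - k) - 1) (pow k f)" using f by (intro reg_jacobi_pow) (simp only:)
  then show "reg 1 (pow k f)" by (rule reg_le) (use k in linarith)
qed

text \<open>Descent from level n by \<open>L2_of_ell\<close>; it provides every power below n with
  boundary values.\<close>

lemma L2_pow_levels:
  assumes f: "reg (2 * n - 1) f" "L2 (pow n f)" and k: "k \<le> n"
  shows "L2 (pow k f)"
  using k
proof (induction rule: inc_induct)
  case (step m)
  have "L2 (ell (pow m f))" using step.IH by simp
  moreover have "reg 1 (pow m f)" by (rule reg_pow[OF f(1)]) (use step.hyps in simp)
  ultimately show ?case by (rule L2_of_ell[rotated])
qed (rule f)

lemma D_max_iff:
  "f \<in> V \<longleftrightarrow> (\<forall>x. x \<notin> unit_ivl \<longrightarrow> f x = 0) \<and> reg (2 * n - 1) f \<and> L2 (pow n f)"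
proof -
  have "(\<forall>k\<le>2 * n - 1. AC_loc ((rderiv ^^ k) f)) \<longleftrightarrow> (\<forall>k<2 * n. AC_loc ((rderiv ^^ k) f))"
    using n by (intro all_cong1) auto
  then have "f \<in> V \<longleftrightarrow> (\<forall>x. x \<notin> unit_ivl \<longrightarrow> f x = 0) \<and> L2 f \<and> reg (2 * n - 1) f \<and> L2 (pow n f)"
    unfolding D_max_def reg_iff by blast
  then show ?thesis using L2_pow_levels[of f 0] by auto
qed

lemma D_maxD:
  assumes "f \<in> V"
  shows "x \<notin> unit_ivl \<Longrightarrow> f x = 0" "reg (2 * n - 1) f" "k < n \<Longrightarrow> reg 1 (pow k f)" "k \<le> n \<Longrightarrow> L2 (pow k f)"
    "k < n \<Longrightarrow> reg (2 * k) f" "reg 1 f"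
  using assms reg_pow[of f k] reg_pow[of f 0] L2_pow_levels[of f k] reg_le[of "2 * n - 1" f "2 * k"] n unfolding D_max_iff by auto

lemma zero_in_V: "(\<lambda>_. 0) \<in> V"
  unfolding D_max_iff by (simp add: jacobi_pow_zero square_integrable_zero reg_const)

text \<open>Up to level n - 1 linearity holds everywhere. The last application is linear only where
  both quasi-derivatives are differentiable, hence off a null set.\<close>

lemma pow_n_lincomb:
  assumes f: "f \<in> V" and g: "g \<in> V"
  obtains N where "negligible N"
    "\<And>x. x \<in> unit_ivl - N \<Longrightarrow> pow n (\<lambda>x. c * f x + d * g x) x = c * pow n f x + d * pow n g x"
proof -
  obtain m where m: "n = Suc m" using n by (cases n) auto
  have r: "reg 1 (pow m f)" "reg 1 (pow m g)" using D_maxD(3)[OF f, of m] D_maxD(3)[OF g, of m] m by auto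
  define N where "N = {x \<in> unit_ivl. \<not> qd (pow m f) differentiable (at x)} \<union> {x \<in> unit_ivl. \<not> qd (pow m g) differentiable (at x)}"
  show thesis
  proof (rule that)
    show "negligible N" unfolding N_def by (intro negligible_Un AC_loc_negligible AC_loc_qder r)
    fix x assume x: "x \<in> unit_ivl - N"
    have "pow n (\<lambda>x. c * f x + d * g x) x = ell (\<lambda>x. c * pow m f x + d * pow m g x) x"
      unfolding m using x D_maxD(5)[OF f, of m] D_maxD(5)[OF g, of m] m
      by (auto intro!: jacobi_expr_cong jacobi_pow_lincomb)
    also have "\<dots> = c * pow n f x + d * pow n g x"
      unfolding m using x r by (simp add: N_def jacobi_expr_lincomb)
    finally show "pow n (\<lambda>x. c * f x + d * g x) x = c * pow n f x + d * pow n g x" .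
  qed
qed

lemma V_lincomb:
  assumes f: "f \<in> V" and g: "g \<in> V"
  shows "(\<lambda>x. c * f x + d * g x) \<in> V"
proof -
  obtain N where N: "negligible N"
    "\<And>x. x \<in> unit_ivl - N \<Longrightarrow> pow n (\<lambda>x. c * f x + d * g x) x = c * pow n f x + d * pow n g x"
    using pow_n_lincomb[OF assms] by blast
  have "L2 (\<lambda>x. c * pow n f x + d * pow n g x)"
    using D_maxD(4)[OF f, of n] D_maxD(4)[OF g, of n] by (intro square_integrable_add square_integrable_cmult) auto
  then have "L2 (pow n (\<lambda>x. c * f x + d * g x))"
    by (rule square_integrable_spike[OF _ N])
  then show ?thesis
    unfolding D_max_iff using D_maxD(1,2)[OF f] D_maxD(1,2)[OF g] by (auto intro!: reg_add reg_cmult)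
qed

definition bfun :: "nat \<Rightarrow> bool \<Rightarrow> (real \<Rightarrow> complex) \<Rightarrow> real \<Rightarrow> complex" where
  "bfun k b f = (if b then qd (pow k f) else aco (pow k f))"

text \<open>In (k, b, e) the flag b selects the quasi-derivative over the other coefficient, and e
  selects the end 1 over -1. On V the limit exists by \<open>bfun_tendsto\<close>.\<close>

definition bd :: "nat \<times> bool \<times> bool \<Rightarrow> (real \<Rightarrow> complex) \<Rightarrow> complex" where
  "bd j f = (case j of (k, b, e) \<Rightarrow> Lim (endpoint e) (bfun k b f))"

lemma bfun_tendsto:
  assumes "f \<in> V" "k < n"
  shows "(bfun k b f \<longlongrightarrow> bd (k, b, e) f) (endpoint e)"
proof -
  have "reg 1 (pow k f)" "L2 (ell (pow k f))"
    using D_maxD(3,4)[OF assms(1), of k] D_maxD(4)[OF assms(1), of "Suc k"] assms(2) by auto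
  then obtain l where "(bfun k b f \<longlongrightarrow> l) (endpoint e)"
    using aco_qd_limits by (metis bfun_def)
  moreover have "bd (k, b, e) f = l"
    unfolding bd_def prod.case by (rule tendsto_Lim[OF endpoint_nontrivial calculation])
  ultimately show ?thesis by simp
qed

lemma bfun_lincomb:
  assumes f: "f \<in> V" and g: "g \<in> V" and k: "k < n" and x: "x \<in> unit_ivl"
  shows "bfun k b (\<lambda>x. c * f x + d * g x) x = c * bfun k b f x + d * bfun k b g x"
proof -
  have pw: "pow k (\<lambda>x. c * f x + d * g x) y = c * pow k f y + d * pow k g y" if "y \<in> unit_ivl" for y
    using that D_maxD(5)[OF f k] D_maxD(5)[OF g k] by (intro jacobi_pow_lincomb)
  have "qd (pow k (\<lambda>x. c * f x + d * g x)) x = qd (\<lambda>x. c * pow k f x + d * pow k g x) x"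
    using rderiv_cong[OF pw x] by (simp add: qder_def)
  also have "\<dots> = c * qd (pow k f) x + d * qd (pow k g) x"
    using D_maxD(3)[OF f k] D_maxD(3)[OF g k] x by (intro qder_lincomb) auto
  finally have q: "qd (pow k (\<lambda>x. c * f x + d * g x)) x = c * qd (pow k f) x + d * qd (pow k g) x" .
  then show ?thesis
    using pw[OF x] by (simp add: bfun_def aco_def scaleR_conv_of_real algebra_simps)
qed

lemma eventually_endpoint: "\<forall>\<^sub>F x in endpoint e. x \<in> unit_ivl"
  using eventually_at_left_real[of "-1" 1] eventually_at_right_real[of "-1" 1] by (cases e) auto

lemma bd_lincomb:
  assumes f: "f \<in> V" and g: "g \<in> V" and k: "k < n"
  shows "bd (k, b, e) (\<lambda>x. c * f x + d * g x) = c * bd (k, b, e) f + d * bd (k, b, e) g"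
proof (rule tendsto_unique[OF endpoint_nontrivial])
  show "(bfun k b (\<lambda>x. c * f x + d * g x) \<longlongrightarrow> bd (k, b, e) (\<lambda>x. c * f x + d * g x)) (endpoint e)"
    by (intro bfun_tendsto V_lincomb f g k)
  have "((\<lambda>x. c * bfun k b f x + d * bfun k b g x) \<longlongrightarrow> c * bd (k, b, e) f + d * bd (k, b, e) g) (endpoint e)"
    by (intro tendsto_intros bfun_tendsto f g k)
  then show "(bfun k b (\<lambda>x. c * f x + d * g x) \<longlongrightarrow> c * bd (k, b, e) f + d * bd (k, b, e) g) (endpoint e)"
    by (rule Lim_transform_eventually) (use eventually_endpoint in \<open>rule eventually_mono\<close>, simp add: bfun_lincomb[OF f g k])
qed

lemma V_sum:
  assumes "finite S" "\<And>i. i \<in> S \<Longrightarrow> v i \<in> V"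
  shows "(\<lambda>x. \<Sum>i\<in>S. c i * v i x) \<in> V"
    and "k < n \<Longrightarrow> bd (k, b, e) (\<lambda>x. \<Sum>i\<in>S. c i * v i x) = (\<Sum>i\<in>S. c i * bd (k, b, e) (v i))"
proof -
  have "(\<lambda>x. \<Sum>i\<in>S. c i * v i x) \<in> V \<and>
    (k < n \<longrightarrow> bd (k, b, e) (\<lambda>x. \<Sum>i\<in>S. c i * v i x) = (\<Sum>i\<in>S. c i * bd (k, b, e) (v i)))"
    using assms
  proof (induction rule: finite_induct)
    case empty
    have "k < n \<Longrightarrow> bd (k, b, e) (\<lambda>_. 0) = 0"
      using bd_lincomb[OF zero_in_V zero_in_V, of k b e 0 0] by simp
    then show ?case using zero_in_V by simp
  next
    case (insert i S)
    have eq: "(\<lambda>x. \<Sum>i\<in>insert i S. c i * v i x) = (\<lambda>x. c i * v i x + 1 * (\<Sum>i\<in>S. c i * v i x))"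
      using insert by (simp add: fun_eq_iff)
    have v: "v i \<in> V" "(\<lambda>x. \<Sum>i\<in>S. c i * v i x) \<in> V" using insert by auto
    show ?case
      unfolding eq using V_lincomb[OF v, of "c i" 1] bd_lincomb[OF v, of k b e "c i" 1] insert by simp
  qed
  then show "(\<lambda>x. \<Sum>i\<in>S. c i * v i x) \<in> V"
    "k < n \<Longrightarrow> bd (k, b, e) (\<lambda>x. \<Sum>i\<in>S. c i * v i x) = (\<Sum>i\<in>S. c i * bd (k, b, e) (v i))" by auto
qed

definition bd_kernel :: "(real \<Rightarrow> complex) set" where
  "bd_kernel = {f \<in> V. \<forall>k<n. \<forall>b e. bd (k, b, e) f = 0}"

text \<open>The square matrix of boundary values of the \<open>v i\<close> is injective, because a
  combination without boundary values lies in the kernel; hence some combination has the same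
  boundary values as f.\<close>

lemma decompose_mod_bd_kernel:
  assumes S: "finite S" "card S = 4 * n" and v: "\<And>i. i \<in> S \<Longrightarrow> v i \<in> V"
    and inj: "\<And>c. (\<lambda>x. \<Sum>i\<in>S. c i * v i x) \<in> bd_kernel \<Longrightarrow> \<forall>i\<in>S. c i = 0"
    and f: "f \<in> V"
  obtains c where "(\<lambda>x. f x - (\<Sum>i\<in>S. c i * v i x)) \<in> bd_kernel"
proof -
  define J where "J = {..<n} \<times> (UNIV :: (bool \<times> bool) set)"
  have "card (UNIV :: (bool \<times> bool) set) = 4" by (simp flip: UNIV_Times_UNIV add: card_cartesian_product)
  then have J: "finite J" "card J = card S" using S by (simp_all add: J_def card_cartesian_product)
  have "\<exists>c. \<forall>j\<in>J. (\<Sum>i\<in>S. bd j (v i) * c i) = bd j f"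
  proof (rule injective_system_surjective[OF J(1) S(1) J(2)])
    fix c assume c: "\<forall>j\<in>J. (\<Sum>i\<in>S. bd j (v i) * c i) = 0"
    have "bd (k, b, e) (\<lambda>x. \<Sum>i\<in>S. c i * v i x) = 0" if "k < n" for k b e
      using c[rule_format, of "(k, b, e)"] that V_sum(2)[OF S(1) v that]
      by (simp add: J_def mult.commute)
    then show "\<forall>i\<in>S. c i = 0" using V_sum(1)[OF S(1) v] by (intro inj) (auto simp: bd_kernel_def)
  qed
  then obtain c where c: "\<And>j. j \<in> J \<Longrightarrow> (\<Sum>i\<in>S. bd j (v i) * c i) = bd j f" by blast
  let ?s = "\<lambda>x. \<Sum>i\<in>S. c i * v i x"
  have s: "?s \<in> V" using V_sum(1)[OF S(1) v] .
  have "bd (k, b, e) (\<lambda>x. 1 * f x + (-1) * ?s x) = 0" if "k < n" for k b e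
  proof -
    have "(k, b, e) \<in> J" using that by (simp add: J_def)
    then have "bd (k, b, e) ?s = bd (k, b, e) f"
      using c V_sum(2)[OF S(1) v that] by (simp add: mult.commute)
    then show ?thesis by (simp only: bd_lincomb[OF f s that]) simp
  qed
  moreover have "(\<lambda>x. 1 * f x + (-1) * ?s x) \<in> V" by (rule V_lincomb[OF f s])
  ultimately have "(\<lambda>x. 1 * f x + (-1) * ?s x) \<in> bd_kernel" unfolding bd_kernel_def by blast
  then show thesis by (intro that[of c]) simp
qed

section \<open>The bracket and the minimal domain\<close>

lemma L2_cnj_integrable:
  assumes "L2 f" "L2 g"
  shows "integrable (jacobi_measure \<alpha> \<beta>) (\<lambda>x. f x * cnj (g x))"
proof -
  have m: "(\<lambda>x. f x * cnj (g x)) \<in> borel_measurable (lebesgue_on unit_ivl)"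
    using assms by (auto simp: square_integrable_iff intro!: borel_measurable_times cnj_measurable)
  then show ?thesis
    unfolding integrable_jacobi_measure_iff[OF m]
    by (rule square_integrable_mult[OF assms]) (simp add: norm_mult)
qed

lemma bracket_integrable:
  assumes "f \<in> V" "g \<in> V"
  shows "integrable (jacobi_measure \<alpha> \<beta>) (\<lambda>x. pow n f x * cnj (g x) - f x * cnj (pow n g x))"
  using D_maxD(4)[OF assms(1), of n] D_maxD(4)[OF assms(1), of 0] D_maxD(4)[OF assms(2), of n] D_maxD(4)[OF assms(2), of 0]
  by (intro Bochner_Integration.integrable_diff L2_cnj_integrable) auto

text \<open>A telescoping sum moves \<open>ell\<close> from f to g one factor at a time. Its k-th
  term is the integrand of Green's formula for \<open>pow k f\<close> and
  \<open>pow (n - Suc k) g\<close>, where all boundary values of the first function vanish.\<close>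

lemma bd_kernel_subset_D_min: "bd_kernel \<subseteq> D_min \<alpha> \<beta> n"
proof
  fix f assume "f \<in> bd_kernel"
  then have f: "f \<in> V" and f0: "\<And>k b e. k < n \<Longrightarrow> bd (k, b, e) f = 0" by (auto simp: bd_kernel_def)
  have "jacobi_bracket \<alpha> \<beta> n f g = 0" if g: "g \<in> V" for g
  proof -
    define T where "T k x = pow (Suc k) f x * cnj (pow (n - Suc k) g x) - pow k f x * cnj (pow (n - k) g x)" for k x
    have tele: "pow n f x * cnj (g x) - f x * cnj (pow n g x) = (\<Sum>k<n. T k x)" for x
      using sum_lessThan_telescope[of "\<lambda>k. pow k f x * cnj (pow (n - k) g x)" n] by (simp add: T_def)
    have T: "integrable (jacobi_measure \<alpha> \<beta>) (T k)" "integral\<^sup>L (jacobi_measure \<alpha> \<beta>) (T k) = 0" if k: "k < n" for k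
    proof -
      define F G where "F = pow k f" and "G = pow (n - Suc k) g"
      have F: "reg 1 F" "L2 (ell F)"
        using D_maxD(3)[OF f k] D_maxD(4)[OF f, of "Suc k"] k by (auto simp: F_def)
      have eG: "ell G = pow (n - k) g" using k by (simp add: G_def Suc_diff_Suc[symmetric])
      have G: "reg 1 G" "L2 (ell G)"
        using D_maxD(3)[OF g, of "n - Suc k"] D_maxD(4)[OF g, of "n - k"] k unfolding eG by (auto simp: G_def)
      have z: "(aco F \<longlongrightarrow> 0) (endpoint e)" "(qd F \<longlongrightarrow> 0) (endpoint e)" for e
        using bfun_tendsto[OF f k, of False e] bfun_tendsto[OF f k, of True e] f0[OF k] by (simp_all add: bfun_def F_def)
      have Teq: "T k = (\<lambda>x. ell F x * cnj (G x) - F x * cnj (ell G x))"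
        unfolding eG by (rule ext) (simp add: T_def F_def G_def)
      have LF: "L2 F" "L2 G" using L2_of_ell F G by blast+
      then show i: "integrable (jacobi_measure \<alpha> \<beta>) (T k)"
        unfolding Teq using F G by (intro Bochner_Integration.integrable_diff L2_cnj_integrable) auto
      then have m: "T k \<in> borel_measurable (lebesgue_on unit_ivl)"
        using borel_measurable_integrable by fastforce
      show "integral\<^sup>L (jacobi_measure \<alpha> \<beta>) (T k) = 0"
        using Green_vanishing[OF F G z] integral_jacobi_measure[OF m, of \<alpha> \<beta>] unfolding Teq by simp
    qed
    show ?thesis
      unfolding jacobi_bracket_def tele using T by (subst Bochner_Integration.integral_sum) auto
  qed
  then show "f \<in> D_min \<alpha> \<beta> n" using f by (simp add: D_min_def)
qed

lemma bracket_lincomb: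
  assumes f: "f \<in> V" and g: "g \<in> V" and h: "h \<in> V"
  shows "jacobi_bracket \<alpha> \<beta> n (\<lambda>x. c * f x + d * g x) h =
    c * jacobi_bracket \<alpha> \<beta> n f h + d * jacobi_bracket \<alpha> \<beta> n g h"
proof -
  let ?M = "jacobi_measure \<alpha> \<beta>"
  let ?i = "\<lambda>f x. pow n f x * cnj (h x) - f x * cnj (pow n h x)"
  obtain N where N: "negligible N"
    "\<And>x. x \<in> unit_ivl - N \<Longrightarrow> pow n (\<lambda>x. c * f x + d * g x) x = c * pow n f x + d * pow n g x"
    using pow_n_lincomb[OF f g] by blast
  have "integral\<^sup>L ?M (?i (\<lambda>x. c * f x + d * g x)) = integral\<^sup>L ?M (\<lambda>x. c * ?i f x + d * ?i g x)"
  proof (rule integral_cong_AE)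
    show "?i (\<lambda>x. c * f x + d * g x) \<in> borel_measurable ?M"
      using bracket_integrable[OF V_lincomb[OF f g] h] by (rule borel_measurable_integrable)
    show "(\<lambda>x. c * ?i f x + d * ?i g x) \<in> borel_measurable ?M"
      using bracket_integrable[OF f h] bracket_integrable[OF g h]
      by (intro borel_measurable_add borel_measurable_times borel_measurable_const borel_measurable_integrable)
    show "AE x in ?M. ?i (\<lambda>x. c * f x + d * g x) x = c * ?i f x + d * ?i g x"
      unfolding AE_jacobi_measure_iff
    proof (rule negligible_subset[OF N(1)], rule subsetI, rule ccontr)
      fix x assume x: "x \<in> {x \<in> unit_ivl. ?i (\<lambda>x. c * f x + d * g x) x \<noteq> c * ?i f x + d * ?i g x}" "x \<notin> N"
      then have "pow n (\<lambda>x. c * f x + d * g x) x = c * pow n f x + d * pow n g x" by (intro N(2)) auto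
      then show False using x by (simp add: algebra_simps)
    qed
  qed
  also have "\<dots> = c * integral\<^sup>L ?M (?i f) + d * integral\<^sup>L ?M (?i g)"
    using bracket_integrable[OF f h] bracket_integrable[OF g h] by simp
  finally show ?thesis by (simp add: jacobi_bracket_def)
qed

lemma D_min_lincomb:
  assumes "f \<in> D_min \<alpha> \<beta> n" "g \<in> D_min \<alpha> \<beta> n"
  shows "(\<lambda>x. c * f x + d * g x) \<in> D_min \<alpha> \<beta> n"
  using assms by (auto simp: D_min_def V_lincomb bracket_lincomb)

text \<open>The bracket of \<open>f + g\<close> with \<open>f - g\<close> is \<open>\<i> (\<parallel>f - g\<parallel>\<^sup>2 + \<parallel>f + g\<parallel>\<^sup>2)\<close>.\<close>

lemma D_min_defect_sum:
  assumes f: "f \<in> defect_plus \<alpha> \<beta> n" and g: "g \<in> defect_minus \<alpha> \<beta> n" and s: "(\<lambda>x. f x + g x) \<in> D_min \<alpha> \<beta> n"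
  shows "f = (\<lambda>_. 0)" "g = (\<lambda>_. 0)"
proof -
  let ?M = "jacobi_measure \<alpha> \<beta>"
  have fV: "f \<in> V" and gV: "g \<in> V" using f g by (auto simp: defect_plus_def defect_minus_def)
  let ?s = "\<lambda>x. 1 * f x + 1 * g x" and ?d = "\<lambda>x. 1 * f x + (-1) * g x"
  have sV: "?s \<in> V" and dV: "?d \<in> V" using V_lincomb[OF fV gV] by blast+
  obtain N1 where N1: "negligible N1" "\<And>x. x \<in> unit_ivl - N1 \<Longrightarrow> pow n ?s x = 1 * pow n f x + 1 * pow n g x"
    using pow_n_lincomb[OF fV gV] by blast
  obtain N2 where N2: "negligible N2" "\<And>x. x \<in> unit_ivl - N2 \<Longrightarrow> pow n ?d x = 1 * pow n f x + (-1) * pow n g x"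
    using pow_n_lincomb[OF fV gV] by blast
  define N where "N = N1 \<union> N2 \<union> {x \<in> unit_ivl. pow n f x \<noteq> \<i> * f x} \<union> {x \<in> unit_ivl. pow n g x \<noteq> - \<i> * g x}"
  have N: "negligible N"
    using f g N1 N2 by (auto simp: N_def defect_plus_def defect_minus_def AE_jacobi_measure_iff)
  let ?h = "\<lambda>x. (norm (?d x))\<^sup>2 + (norm (?s x))\<^sup>2"
  have eq: "pow n ?s x * cnj (?d x) - ?s x * cnj (pow n ?d x) = \<i> * of_real (?h x)" if x: "x \<in> unit_ivl - N" for x
  proof -
    have "pow n f x = \<i> * f x" "pow n g x = - \<i> * g x" using x by (auto simp: N_def)
    then have "pow n ?s x = \<i> * ?d x" "pow n ?d x = \<i> * ?s x"
      using N1(2)[of x] N2(2)[of x] x by (auto simp: N_def algebra_simps)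
    then have "pow n ?s x * cnj (?d x) - ?s x * cnj (pow n ?d x) = \<i> * (?d x * cnj (?d x) + ?s x * cnj (?s x))"
      by (simp only:) (simp add: algebra_simps)
    then show ?thesis by (simp only: complex_norm_square of_real_add)
  qed
  have L: "L2 ?s" "L2 ?d" using D_maxD(4)[OF sV, of 0] D_maxD(4)[OF dV, of 0] by simp_all
  have ih: "integrable ?M ?h" using L by (intro Bochner_Integration.integrable_add) (simp_all add: square_integrable_def)
  have "jacobi_bracket \<alpha> \<beta> n ?s ?d = 0" using s dV by (simp add: D_min_def)
  moreover have "jacobi_bracket \<alpha> \<beta> n ?s ?d = integral\<^sup>L ?M (\<lambda>x. \<i> * of_real (?h x))"
    unfolding jacobi_bracket_def
  proof (rule integral_cong_AE)
    show "(\<lambda>x. pow n ?s x * cnj (?d x) - ?s x * cnj (pow n ?d x)) \<in> borel_measurable ?M"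
      using bracket_integrable[OF sV dV] by (rule borel_measurable_integrable)
    show "(\<lambda>x. \<i> * of_real (?h x)) \<in> borel_measurable ?M"
      using borel_measurable_integrable[OF ih] by measurable
    show "AE x in ?M. pow n ?s x * cnj (?d x) - ?s x * cnj (pow n ?d x) = \<i> * of_real (?h x)"
      unfolding AE_jacobi_measure_iff by (rule negligible_subset[OF N]) (use eq in blast)
  qed
  moreover have "integral\<^sup>L ?M (\<lambda>x. \<i> * of_real (?h x)) = \<i> * of_real (integral\<^sup>L ?M ?h)"
    by (subst integral_mult_right_zero, subst integral_complex_of_real, rule refl)
  ultimately have "\<i> * complex_of_real (integral\<^sup>L ?M ?h) = 0" by (simp only:)
  then have "integral\<^sup>L ?M ?h = 0" by (simp only: mult_eq_0_iff complex_i_not_zero of_real_eq_0_iff simp_thms)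
  then have "AE x in ?M. ?h x = 0" using ih by (subst (asm) integral_nonneg_eq_0_iff_AE) auto
  then have neg: "negligible {x \<in> unit_ivl. ?h x \<noteq> 0}" unfolding AE_jacobi_measure_iff .
  have nz: "?h x \<noteq> 0" if "f x \<noteq> 0 \<or> g x \<noteq> 0" for x
  proof
    assume "?h x = 0"
    then have "?d x = 0 \<and> ?s x = 0" by (simp only: sum_power2_eq_zero_iff norm_eq_zero)
    then have "2 * f x = 0" "2 * g x = 0" by algebra+
    then show False using that by auto
  qed
  \<comment> \<open>Vanishing almost everywhere becomes vanishing everywhere, inside by continuity
    and outside by the convention on representatives.\<close>
  have "f x = 0" "g x = 0" for x
  proof -
    have "negligible {x \<in> unit_ivl. f x \<noteq> 0}" "negligible {x \<in> unit_ivl. g x \<noteq> 0}"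
      by (rule negligible_subset[OF neg]; use nz in blast)+
    then show "f x = 0" "g x = 0"
      using AC_loc_AE_zero[of f x] AC_loc_AE_zero[of g x] D_maxD(1)[OF fV, of x] D_maxD(1)[OF gV, of x]
        reg_AC_loc[OF D_maxD(2)[OF fV]] reg_AC_loc[OF D_maxD(2)[OF gV]] by blast+
  qed
  then show "f = (\<lambda>_. 0)" "g = (\<lambda>_. 0)" by auto
qed

end

section \<open>Eigenfunctions\<close>

definition psum :: "(nat \<Rightarrow> complex) \<Rightarrow> real \<Rightarrow> complex" where
  "psum a x = (\<Sum>k. a k * of_real x ^ k)"

definition conv1 :: "(nat \<Rightarrow> complex) \<Rightarrow> bool" where
  "conv1 a \<longleftrightarrow> (\<forall>z. norm z < 1 \<longrightarrow> summable (\<lambda>k. a k * z ^ k))"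

lemma conv1_diffs: "conv1 a \<Longrightarrow> conv1 (diffs a)"
  unfolding conv1_def using termdiff_converges[of _ 1 a] by blast

lemma psum_has_vector_derivative:
  assumes a: "conv1 a" and x: "x \<in> unit_ivl"
  shows "(psum a has_vector_derivative psum (diffs a) x) (at x)"
proof -
  \<comment> \<open>A point of modulus strictly between \<bar>x\<bar> and 1, since termwise
    differentiation needs convergence beyond x.\<close>
  let ?K = "complex_of_real ((\<bar>x\<bar> + 1) / 2)"
  have K: "norm ?K < 1" "norm (complex_of_real x) < norm ?K" using x by (auto simp del: of_real_divide of_real_add)
  have "((\<lambda>z. \<Sum>k. a k * z ^ k) has_field_derivative (\<Sum>k. diffs a k * of_real x ^ k)) (at (of_real x))"
    using a K by (intro termdiffs_strong[of _ ?K]) (auto simp: conv1_def)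
  from field_vector_diff_chain_at[OF has_vector_derivative_of_real[OF DERIV_ident] this]
  show ?thesis by (simp add: psum_def[abs_def] o_def)
qed

lemma psum_reg: "conv1 a \<Longrightarrow> reg m (psum a)"
proof (induction m arbitrary: a)
  case 0
  have "continuous_on unit_ivl (psum (diffs a))"
    using psum_has_vector_derivative[OF conv1_diffs[OF 0]]
    by (intro continuous_at_imp_continuous_on ballI has_vector_derivative_continuous)
  then show ?case using AC_loc_C1[OF psum_has_vector_derivative[OF 0]] by simp
next
  case (Suc m)
  have d: "(psum a has_vector_derivative psum (diffs a) x) (at x)" if "x \<in> unit_ivl" for x
    using psum_has_vector_derivative Suc.prems that by blast
  have "reg m (rderiv (psum a))"
    by (rule reg_cong[OF _ Suc.IH[OF conv1_diffs[OF Suc.prems]]]) (simp add: rderiv_eq[OF d])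
  moreover have "AC_loc (psum a)" using reg_AC_loc[OF Suc.IH[OF Suc.prems]] .
  moreover have "\<forall>x\<in>unit_ivl. psum a differentiable (at x)" using differentiableI_vector[OF d] by blast
  ultimately show ?case by simp
qed

text \<open>The factors x and x^2 realign the differentiated series with the index k, the form in
  which the differential equation turns into a recursion of the coefficients.\<close>

lemma psum_shift:
  assumes a: "conv1 a" and x: "x \<in> unit_ivl"
  shows "(\<lambda>k. a k * of_real x ^ k) sums psum a x"
    and "(\<lambda>k. of_nat k * a k * of_real x ^ k) sums (of_real x * psum (diffs a) x)"
    and "(\<lambda>k. of_nat k * (of_nat k - 1) * a k * of_real x ^ k) sums ((of_real x)\<^sup>2 * psum (diffs (diffs a)) x)"
proof -
  let ?z = "complex_of_real x"
  have sm: "summable (\<lambda>k. c k * ?z ^ k)" if "conv1 c" for c using that x by (auto simp: conv1_def)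
  show "(\<lambda>k. a k * ?z ^ k) sums psum a x" unfolding psum_def by (rule summable_sums[OF sm[OF a]])
  have one: "(\<lambda>k. of_nat k * c k * ?z ^ k) sums (?z * psum (diffs c) x)" if c: "conv1 c" for c
  proof -
    have "(\<lambda>k. of_nat k * c k * ?z ^ (k - Suc 0)) sums psum (diffs c) x"
      unfolding psum_def by (rule diffs_equiv[OF sm[OF conv1_diffs[OF c]]])
    then have "(\<lambda>k. ?z * (of_nat k * c k * ?z ^ (k - Suc 0))) sums (?z * psum (diffs c) x)" by (rule sums_mult)
    moreover have "?z * (of_nat k * c k * ?z ^ (k - Suc 0)) = of_nat k * c k * ?z ^ k" for k
      by (cases k) auto
    ultimately show ?thesis by simp
  qed
  from one[OF a] show "(\<lambda>k. of_nat k * a k * ?z ^ k) sums (?z * psum (diffs a) x)" .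
  have "(\<lambda>k. ?z * (of_nat k * diffs a k * ?z ^ k)) sums (?z * (?z * psum (diffs (diffs a)) x))"
    by (intro sums_mult one conv1_diffs a)
  moreover have "?z * (of_nat k * diffs a k * ?z ^ k) = of_nat (Suc k) * (of_nat (Suc k) - 1) * a (Suc k) * ?z ^ Suc k" for k
    by (simp add: diffs_def)
  ultimately have "(\<lambda>k. of_nat (Suc k) * (of_nat (Suc k) - 1) * a (Suc k) * ?z ^ Suc k) sums (?z\<^sup>2 * psum (diffs (diffs a)) x)"
    by (simp only: power2_eq_square mult.assoc)
  from sums_Suc[OF this] show "(\<lambda>k. of_nat k * (of_nat k - 1) * a k * ?z ^ k) sums (?z\<^sup>2 * psum (diffs (diffs a)) x)"
    by simp
qed

text \<open>The larger of two neighbouring coefficients grows at most by the factor s per step, so a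
  geometric series of ratio \<open>norm z * s\<close> dominates. Taking s close to 1 reaches the
  whole unit disc.\<close>

lemma second_order_growth_summable:
  fixes a :: "nat \<Rightarrow> complex"
  assumes s: "s \<ge> 1" and le: "\<And>k. k \<ge> K \<Longrightarrow> norm (a (Suc (Suc k))) \<le> s * max (norm (a k)) (norm (a (Suc k)))"
    and z: "norm z * s < 1"
  shows "summable (\<lambda>k. a k * z ^ k)"
proof -
  define M where "M = max (norm (a K)) (norm (a (Suc K)))"
  have b: "max (norm (a (K + j))) (norm (a (Suc (K + j)))) \<le> s ^ j * M" for j
  proof (induction j)
    case (Suc j)
    let ?m = "max (norm (a (K + j))) (norm (a (Suc (K + j))))"
    have m: "s * ?m \<le> s * (s ^ j * M)" using Suc s by (intro mult_left_mono) auto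
    have "1 * ?m \<le> s * ?m" using s by (intro mult_right_mono) (auto simp: le_max_iff_disj)
    then have "norm (a (Suc (K + j))) \<le> s * ?m" by simp
    moreover have "norm (a (Suc (Suc (K + j)))) \<le> s * ?m" using le[of "K + j"] by simp
    ultimately show ?case using m by simp
  qed (simp add: M_def)
  have "summable (\<lambda>j. a (j + K) * z ^ (j + K))"
  proof (rule summable_comparison_test')
    show "summable (\<lambda>j. M * norm z ^ K * (norm z * s) ^ j)"
      using z s by (intro summable_mult summable_geometric) auto
    fix j
    have "norm (a (K + j)) \<le> s ^ j * M" using b[of j] by simp
    then have "norm (a (K + j)) * norm z ^ (K + j) \<le> s ^ j * M * norm z ^ (K + j)" by (intro mult_right_mono) auto
    then show "norm (a (j + K) * z ^ (j + K)) \<le> M * norm z ^ K * (norm z * s) ^ j"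
      by (simp add: norm_mult norm_power power_add power_mult_distrib ac_simps)
  qed
  then show ?thesis using summable_iff_shift[of "\<lambda>k. a k * z ^ k" K] by simp
qed

section \<open>Solutions of the eigenvalue equation and their square integrability\<close>

context jacobi
begin

text \<open>The Taylor coefficients at \<open>0\<close> of the solution of \<open>ell f = \<mu> f\<close> with \<open>f 0 = c\<close>, \<open>f' 0 = d\<close>.\<close>

fun jcoeff :: "complex \<Rightarrow> complex \<Rightarrow> complex \<Rightarrow> nat \<Rightarrow> complex" where
  "jcoeff \<mu> c d 0 = c"
| "jcoeff \<mu> c d (Suc 0) = d"
| "jcoeff \<mu> c d (Suc (Suc k)) = - (of_real (\<beta> - \<alpha>) * of_nat (Suc k) * jcoeff \<mu> c d (Suc k) +
      (\<mu> - of_nat k * (of_nat k - 1) - of_real (\<alpha> + \<beta> + 2) * of_nat k) * jcoeff \<mu> c d k)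
      / (of_nat (Suc (Suc k)) * of_nat (Suc k))"

text \<open>In the recursion the factor of the coefficient k steps back in modulus tends to 1 for
  the second predecessor and to 0 for the first, so any growth factor s > 1 is valid from some index
  on.\<close>

lemma jcoeff_conv1: "conv1 (jcoeff \<mu> c d)"
  unfolding conv1_def
proof (intro allI impI)
  fix z :: complex assume z: "norm z < 1"
  obtain s where s: "s > 1" "norm z * s < 1"
  proof (cases "z = 0")
    case True then show ?thesis using that[of 2] by simp
  next
    case False
    then have "1 < 1 / norm z" using z by simp
    then obtain s where "1 < s" "s < 1 / norm z" using dense by blast
    then show ?thesis using that[of s] False by (simp add: field_simps)
  qed
  let ?a = "jcoeff \<mu> c d"
  \<comment> \<open>Collects the terms of lower order: the two numerators together are at most q + D
    (k + 1) with q = (k + 2) (k + 1), and from K on D (k + 1) \<le> (s - 1) q.\<close>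
  define D where "D = \<bar>\<beta> - \<alpha>\<bar> + norm \<mu> + (\<alpha> + \<beta> + 2)"
  have D: "D \<ge> 0" using \<alpha> \<beta> by (simp add: D_def)
  obtain K :: nat where K: "D / (s - 1) \<le> real K" using real_arch_simple by blast
  show "summable (\<lambda>k. ?a k * z ^ k)"
  proof (rule second_order_growth_summable[OF _ _ s(2)])
    fix k assume k: "k \<ge> K"
    let ?m = "max (norm (?a k)) (norm (?a (Suc k)))"
    let ?q = "(real k + 2) * (real k + 1)"
    have q: "?q > 0" by simp
    have q': "norm (of_nat (Suc (Suc k)) * of_nat (Suc k) :: complex) = ?q"
      unfolding norm_mult norm_of_nat by (simp add: algebra_simps)
    let ?A = "of_real (\<beta> - \<alpha>) * of_nat (Suc k) :: complex"
    let ?B = "\<mu> - of_nat k * (of_nat k - 1) - of_real (\<alpha> + \<beta> + 2) * of_nat k :: complex"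
    have A: "norm ?A = \<bar>\<beta> - \<alpha>\<bar> * (real k + 1)"
      unfolding norm_mult norm_of_nat norm_of_real by simp
    have B: "norm ?B \<le> norm \<mu> + real k * (real k + 1) + (\<alpha> + \<beta> + 2) * real k"
    proof -
      have "norm (of_nat k * (of_nat k - 1) :: complex) \<le> real k * (real k + 1)"
        unfolding norm_mult norm_of_nat using norm_triangle_ineq4[of "of_nat k :: complex" 1]
        by (intro mult_left_mono) auto
      moreover have "norm (of_real (\<alpha> + \<beta> + 2) * of_nat k :: complex) = (\<alpha> + \<beta> + 2) * real k"
        unfolding norm_mult norm_of_nat norm_of_real using \<alpha> \<beta> by simp
      ultimately show ?thesis
        using norm_triangle_ineq4[of "\<mu> - of_nat k * (of_nat k - 1)" "of_real (\<alpha> + \<beta> + 2) * of_nat k"]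
          norm_triangle_ineq4[of \<mu> "of_nat k * (of_nat k - 1)"] by linarith
    qed
    have "norm (?A * ?a (Suc k) + ?B * ?a k) \<le> norm ?A * ?m + norm ?B * ?m"
      unfolding norm_mult[symmetric]
      by (rule order_trans[OF norm_triangle_ineq]) (simp add: norm_mult mult_left_mono add_mono)
    also have "\<dots> = (norm ?A + norm ?B) * ?m" by (simp add: distrib_right)
    also have "\<dots> \<le> (?q + D * (real k + 1)) * ?m"
    proof (rule mult_right_mono)
      have "norm \<mu> * 1 \<le> norm \<mu> * (real k + 1)" by (intro mult_left_mono) auto
      moreover have "real k * (real k + 1) \<le> ?q" by (intro mult_right_mono) auto
      moreover have "(\<alpha> + \<beta> + 2) * real k \<le> (\<alpha> + \<beta> + 2) * (real k + 1)"
        using \<alpha> \<beta> by (intro mult_left_mono) auto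
      moreover have "D * (real k + 1) = \<bar>\<beta> - \<alpha>\<bar> * (real k + 1) + norm \<mu> * (real k + 1) + (\<alpha> + \<beta> + 2) * (real k + 1)"
        by (simp only: D_def distrib_right)
      ultimately show "norm ?A + norm ?B \<le> ?q + D * (real k + 1)"
        using A B by linarith
    qed (auto simp: le_max_iff_disj)
    also have "\<dots> \<le> (?q * s) * ?m"
    proof (rule mult_right_mono)
      have "D \<le> (s - 1) * (real k + 2)"
      proof -
        have "D \<le> (s - 1) * real K" using K s by (simp add: field_simps)
        also have "\<dots> \<le> (s - 1) * (real k + 2)" using k s by (intro mult_left_mono) auto
        finally show ?thesis .
      qed
      then have "D * (real k + 1) \<le> (s - 1) * (real k + 2) * (real k + 1)" by (intro mult_right_mono) auto
      then show "?q + D * (real k + 1) \<le> ?q * s" by (simp add: algebra_simps)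
    qed (auto simp: le_max_iff_disj)
    finally have "norm (?A * ?a (Suc k) + ?B * ?a k) / ?q \<le> s * ?m"
      using q by (simp add: divide_le_eq mult.commute mult.left_commute)
    then show "norm (?a (Suc (Suc k))) \<le> s * ?m"
      unfolding jcoeff.simps norm_divide norm_minus_cancel q' .
  qed (use s in simp)
qed

lemma psum_ell:
  assumes x: "x \<in> unit_ivl"
  shows "ell (psum (jcoeff \<mu> c d)) x = \<mu> * psum (jcoeff \<mu> c d) x"
proof -
  let ?a = "jcoeff \<mu> c d" and ?z = "complex_of_real x"
  let ?F = "psum ?a x" and ?F1 = "psum (diffs ?a) x" and ?F2 = "psum (diffs (diffs ?a)) x"
  have a: "conv1 ?a" by (rule jcoeff_conv1)
  have d1: "(psum ?a has_vector_derivative psum (diffs ?a) y) (at y)" if "y \<in> unit_ivl" for y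
    by (rule psum_has_vector_derivative[OF a that])
  have d2: "(psum (diffs ?a) has_vector_derivative ?F2) (at x)"
    by (rule psum_has_vector_derivative[OF conv1_diffs[OF a] x])
  have "(rderiv (psum ?a) has_vector_derivative ?F2) (at x)"
    using d2 has_vector_derivative_cong_ivl[of "psum (diffs ?a)" "rderiv (psum ?a)" x ?F2] rderiv_eq[OF d1] x by auto
  then have e: "ell (psum ?a) x = (x\<^sup>2 - 1) *\<^sub>R ?F2 + ((\<alpha> + \<beta> + 2) * x + (\<alpha> - \<beta>)) *\<^sub>R ?F1"
    using jacobi_expr_eq[of "psum ?a" x ?F2 \<alpha> \<beta>] differentiableI_vector[OF d1[OF x]] rderiv_eq[OF d1[OF x]] x by simp
  \<comment> \<open>The power series of \<mu> f - l[f] term by term; the recursion makes each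
    coefficient vanish.\<close>
  have "(\<lambda>k. diffs (diffs ?a) k * ?z ^ k - of_nat k * (of_nat k - 1) * ?a k * ?z ^ k +
      of_real (\<beta> - \<alpha>) * (diffs ?a k * ?z ^ k) - of_real (\<alpha> + \<beta> + 2) * (of_nat k * ?a k * ?z ^ k) + \<mu> * (?a k * ?z ^ k))
    sums (?F2 - ?z\<^sup>2 * ?F2 + of_real (\<beta> - \<alpha>) * ?F1 - of_real (\<alpha> + \<beta> + 2) * (?z * ?F1) + \<mu> * ?F)"
    by (intro sums_add sums_diff sums_mult psum_shift x a conv1_diffs)
  moreover have "diffs (diffs ?a) k * ?z ^ k - of_nat k * (of_nat k - 1) * ?a k * ?z ^ k +
      of_real (\<beta> - \<alpha>) * (diffs ?a k * ?z ^ k) - of_real (\<alpha> + \<beta> + 2) * (of_nat k * ?a k * ?z ^ k) + \<mu> * (?a k * ?z ^ k) = 0" for k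
  proof -
    have nz: "of_nat (Suc (Suc k)) * of_nat (Suc k) \<noteq> (0::complex)" by (simp only: mult_eq_0_iff of_nat_eq_0_iff) simp
    have "of_nat (Suc (Suc k)) * of_nat (Suc k) * ?a (Suc (Suc k)) = - (of_real (\<beta> - \<alpha>) * of_nat (Suc k) * ?a (Suc k) +
      (\<mu> - of_nat k * (of_nat k - 1) - of_real (\<alpha> + \<beta> + 2) * of_nat k) * ?a k)"
    proof -
      have "y * (X / y) = X" if "y \<noteq> 0" for X y :: complex using that by simp
      from this[OF nz] show ?thesis unfolding jcoeff.simps(3) .
    qed
    then have "(diffs (diffs ?a) k - of_nat k * (of_nat k - 1) * ?a k +
      of_real (\<beta> - \<alpha>) * diffs ?a k - of_real (\<alpha> + \<beta> + 2) * (of_nat k * ?a k) + \<mu> * ?a k) = 0"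
      unfolding diffs_def by algebra
    then have "(diffs (diffs ?a) k - of_nat k * (of_nat k - 1) * ?a k +
      of_real (\<beta> - \<alpha>) * diffs ?a k - of_real (\<alpha> + \<beta> + 2) * (of_nat k * ?a k) + \<mu> * ?a k) * ?z ^ k = 0"
      by (simp only: mult_zero_left)
    then show ?thesis by (simp only: distrib_right left_diff_distrib mult.assoc)
  qed
  ultimately have "?F2 - ?z\<^sup>2 * ?F2 + of_real (\<beta> - \<alpha>) * ?F1 - of_real (\<alpha> + \<beta> + 2) * (?z * ?F1) + \<mu> * ?F = 0"
    using sums_unique2[OF _ sums_zero] by (simp only:)
  then show ?thesis unfolding e by (simp add: scaleR_conv_of_real algebra_simps)
qed

text \<open>For \<open>ell f = \<mu> f\<close> the coefficients \<open>aco f\<close>, \<open>qd f\<close> satisfy a first order linear system with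
  integrable coefficient matrix, hence are bounded.\<close>

lemma eigenfunction_L2:
  assumes F: "reg 2 F" and eig: "\<And>x. x \<in> unit_ivl \<Longrightarrow> ell F x = \<mu> * F x"
  shows "L2 F"
proof -
  have F1: "reg 1 F" by (rule reg_le[OF F]) simp
  have Fd: "F differentiable (at x)" if "x \<in> unit_ivl" for x using F that by (simp add: numeral_2_eq_2)
  have db: "(qd F has_vector_derivative - (w x *\<^sub>R (\<mu> * F x))) (at x)" if x: "x \<in> unit_ivl" for x
  proof -
    have "(qd F has_vector_derivative rderiv (qd F) x) (at x)"
      using qder_differentiable[OF F x] by (rule rderiv_works)
    moreover have "rderiv (qd F) x = - (w x *\<^sub>R ell F x)"
      using jacobi_weight_pos[OF x, of \<alpha> \<beta>] by (simp add: jacobi_expr_qder)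
    ultimately show ?thesis using eig[OF x] by simp
  qed
  have da: "(aco F has_vector_derivative w x *\<^sub>R (u x *\<^sub>R (\<mu> * F x))) (at x)" if x: "x \<in> unit_ivl" for x
    using aco_deriv[OF Fd[OF x] x] db[OF x] eig[OF x] by simp
  let ?g = "\<lambda>x. w x * (1 + (u x)\<^sup>2)"
  \<comment> \<open>Energy for a Gronwall argument: \<bar>E'\<bar> \<le> C w (1 + u^2) E, where the
    coefficient w (1 + u^2) is integrable over the whole interval.\<close>
  define E where "E x = aco F x \<bullet> aco F x + qd F x \<bullet> qd F x" for x
  define E' where "E' x = 2 * (aco F x \<bullet> (w x *\<^sub>R (u x *\<^sub>R (\<mu> * F x)))) + 2 * (qd F x \<bullet> (- (w x *\<^sub>R (\<mu> * F x))))" for x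
  have dE: "(E has_real_derivative E' x) (at x)" if x: "x \<in> unit_ivl" for x
  proof -
    have "((\<lambda>x. aco F x \<bullet> aco F x + qd F x \<bullet> qd F x) has_vector_derivative
      (aco F x \<bullet> (w x *\<^sub>R (u x *\<^sub>R (\<mu> * F x))) + (w x *\<^sub>R (u x *\<^sub>R (\<mu> * F x))) \<bullet> aco F x) +
      (qd F x \<bullet> (- (w x *\<^sub>R (\<mu> * F x))) + (- (w x *\<^sub>R (\<mu> * F x))) \<bullet> qd F x)) (at x)"
      by (intro has_vector_derivative_add bounded_bilinear.has_vector_derivative[OF bounded_bilinear_inner] da db x)
    then show ?thesis
      unfolding has_real_derivative_iff_has_vector_derivative E_def[abs_def] E'_def
      by (simp add: inner_commute del: inner_scaleR_left inner_scaleR_right)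
  qed
  have E0: "0 \<le> E x" for x by (simp add: E_def)
  define C where "C = 2 * norm \<mu>"
  have C0: "C \<ge> 0" by (simp add: C_def)
  have E'_le: "\<bar>E' x\<bar> \<le> C * ?g x * E x" if x: "x \<in> unit_ivl" for x
  proof -
    let ?a = "norm (aco F x)" and ?b = "norm (qd F x)" and ?u = "\<bar>u x\<bar>"
    have Fx: "norm (F x) \<le> ?a + ?u * ?b"
      using norm_triangle_ineq[of "aco F x" "u x *\<^sub>R qd F x"] by (simp add: aco_def)
    have "\<bar>E' x\<bar> \<le> 2 * \<bar>aco F x \<bullet> (w x *\<^sub>R (u x *\<^sub>R (\<mu> * F x)))\<bar> + 2 * \<bar>qd F x \<bullet> (- (w x *\<^sub>R (\<mu> * F x)))\<bar>"
      unfolding E'_def by (rule order_trans[OF abs_triangle_ineq]) (simp add: abs_mult)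
    also have "\<dots> \<le> 2 * (?a * norm (w x *\<^sub>R (u x *\<^sub>R (\<mu> * F x)))) + 2 * (?b * norm (- (w x *\<^sub>R (\<mu> * F x))))"
      by (intro add_mono mult_left_mono Cauchy_Schwarz_ineq2) auto
    also have "\<dots> = C * w x * ((?a * ?u + ?b) * norm (F x))"
      by (simp add: C_def norm_mult abs_mult algebra_simps)
    also have "\<dots> \<le> C * w x * ((?a * ?u + ?b) * (?a + ?u * ?b))"
      using Fx C0 by (intro mult_left_mono) auto
    also have "\<dots> \<le> C * w x * ((1 + (u x)\<^sup>2) * (?a\<^sup>2 + ?b\<^sup>2))"
    proof -
      have u2: "2 * ?u \<le> 1 + (u x)\<^sup>2" using sum_squares_bound[of 1 ?u] by simp
      have ab: "2 * (?a * ?b) \<le> ?a\<^sup>2 + ?b\<^sup>2" using sum_squares_bound[of ?a ?b] by simp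
      have "(?a * ?u + ?b) * (?a + ?u * ?b) = ?u * (?a\<^sup>2 + ?b\<^sup>2) + (1 + (u x)\<^sup>2) * (?a * ?b)"
        by (simp add: algebra_simps power2_eq_square abs_mult_self_eq)
      moreover have "2 * ?u * (?a\<^sup>2 + ?b\<^sup>2) \<le> (1 + (u x)\<^sup>2) * (?a\<^sup>2 + ?b\<^sup>2)"
        by (intro mult_right_mono u2) auto
      moreover have "(1 + (u x)\<^sup>2) * (2 * (?a * ?b)) \<le> (1 + (u x)\<^sup>2) * (?a\<^sup>2 + ?b\<^sup>2)"
        by (intro mult_left_mono ab) auto
      ultimately have "(?a * ?u + ?b) * (?a + ?u * ?b) \<le> (1 + (u x)\<^sup>2) * (?a\<^sup>2 + ?b\<^sup>2)" by linarith
      then show ?thesis using C0 by (intro mult_left_mono) auto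
    qed
    also have "\<dots> = C * ?g x * E x" by (simp add: E_def power2_norm_eq_inner)
    finally show ?thesis .
  qed
  have gi: "?g integrable_on {-1..1}"
    using second_solution_square_integrable[OF u \<alpha> \<beta>]
    by (simp add: absolutely_integrable_on_def integrable_on_open_interval_real)
  \<comment> \<open>The bounded primitive of w (1 + u^2). The integrating factor is exp (- C
    \<kappa>) to the right of 0 and exp (C \<kappa>) to the left.\<close>
  define \<kappa> where "\<kappa> x = integral {-1..x} ?g" for x
  have "bounded (\<kappa> ` {-1..1})"
    unfolding \<kappa>_def by (intro compact_imp_bounded compact_continuous_image indefinite_integral_continuous_1 gi) simp
  then obtain T where T: "\<And>x. x \<in> {-1..1} \<Longrightarrow> \<bar>\<kappa> x\<bar> \<le> T" by (auto simp: bounded_iff simp del: atLeastAtMost_iff)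
  have d\<kappa>: "(\<kappa> has_real_derivative ?g x) (at x)" if x: "x \<in> unit_ivl" for x
  proof -
    have "continuous_on unit_ivl ?g"
      by (intro continuous_intros jacobi_weight_continuous second_solution_continuous[OF u])
    then have "isCont ?g x" using x by (simp add: continuous_on_eq_continuous_at)
    then have "(\<kappa> has_vector_derivative ?g x) (at x within ({-1..1} - {}))"
      unfolding \<kappa>_def using x gi by (intro integral_has_vector_derivative_continuous_at) (auto intro: continuous_at_imp_continuous_within)
    then have "(\<kappa> has_vector_derivative ?g x) (at x)"
      using x at_within_interior[of x "{-1..1}"] by (simp add: interior_atLeastAtMost_real)
    then show ?thesis by (simp add: has_real_derivative_iff_has_vector_derivative)
  qed
  have ck: "\<bar>C * \<kappa> x\<bar> \<le> C * T" if "x \<in> {-1..1}" for x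
    using T[OF that] C0 by (simp add: abs_mult mult_left_mono)
  define B where "B = exp (2 * C * T) * E 0"
  have E_le: "E x \<le> B" if x: "x \<in> unit_ivl" for x
  proof -
    have d: "((\<lambda>y. exp (r * \<kappa> y) * E y) has_real_derivative exp (r * \<kappa> y) * (r * ?g y * E y + E' y)) (at y)"
      if "y \<in> unit_ivl" for r y
    proof -
      have "((\<lambda>y. exp (r * \<kappa> y)) has_real_derivative exp (r * \<kappa> y) * (r * ?g y)) (at y)"
        by (intro DERIV_fun_exp DERIV_cmult d\<kappa> that)
      from DERIV_mult[OF this dE[OF that]] show ?thesis by (simp add: algebra_simps)
    qed
    have "exp (- C * T) * E x \<le> exp (C * T) * E 0"
    proof (cases "0 \<le> x")
      case True
      have "exp (- C * \<kappa> x) * E x \<le> exp (- C * \<kappa> 0) * E 0"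
      proof (rule DERIV_nonpos_imp_nonincreasing[OF True])
        fix y assume y: "0 \<le> y" "y \<le> x"
        then have yI: "y \<in> unit_ivl" using x by auto
        have "exp (- C * \<kappa> y) * (- C * ?g y * E y + E' y) \<le> 0"
          using E'_le[OF yI] by (intro mult_nonneg_nonpos) auto
        then show "\<exists>D. ((\<lambda>y. exp (- C * \<kappa> y) * E y) has_real_derivative D) (at y) \<and> D \<le> 0" using d[OF yI, of "-C"] by blast
      qed
      moreover have "exp (- C * T) * E x \<le> exp (- C * \<kappa> x) * E x"
        using ck[of x] E0 x by (intro mult_right_mono) auto
      moreover have "exp (- C * \<kappa> 0) * E 0 \<le> exp (C * T) * E 0"
        using ck[of 0] E0 by (intro mult_right_mono) auto
      ultimately show ?thesis by linarith
    next
      case False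
      then have x0: "x \<le> 0" by simp
      have "exp (C * \<kappa> x) * E x \<le> exp (C * \<kappa> 0) * E 0"
      proof (rule DERIV_nonneg_imp_nondecreasing[OF x0])
        fix y assume y: "x \<le> y" "y \<le> 0"
        then have yI: "y \<in> unit_ivl" using x by auto
        have "0 \<le> exp (C * \<kappa> y) * (C * ?g y * E y + E' y)"
          using E'_le[OF yI] by (intro mult_nonneg_nonneg) auto
        then show "\<exists>D. ((\<lambda>y. exp (C * \<kappa> y) * E y) has_real_derivative D) (at y) \<and> 0 \<le> D" using d[OF yI, of C] by blast
      qed
      moreover have "exp (- C * T) * E x \<le> exp (C * \<kappa> x) * E x"
        using ck[of x] E0 x by (intro mult_right_mono) auto
      moreover have "exp (C * \<kappa> 0) * E 0 \<le> exp (C * T) * E 0"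
        using ck[of 0] E0 by (intro mult_right_mono) auto
      ultimately show ?thesis by linarith
    qed
    then have "exp (C * T) * (exp (- C * T) * E x) \<le> exp (C * T) * (exp (C * T) * E 0)" by (intro mult_left_mono) auto
    then show ?thesis by (simp add: B_def mult.assoc[symmetric] flip: exp_add)
  qed
  show ?thesis
  proof (rule L2_dominated_u[where C = "2 * B"])
    show "F \<in> borel_measurable (lebesgue_on unit_ivl)"
      by (intro continuous_measurable_unit_ivl AC_loc_continuous_on reg_AC_loc[OF F])
    fix x assume x: "x \<in> unit_ivl"
    let ?a = "norm (aco F x)" and ?b = "\<bar>u x\<bar> * norm (qd F x)"
    have "norm (F x) \<le> ?a + ?b"
      using norm_triangle_ineq[of "aco F x" "u x *\<^sub>R qd F x"] by (simp add: aco_def)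
    then have "(norm (F x))\<^sup>2 \<le> (?a + ?b)\<^sup>2" by (intro power_mono) auto
    also have "\<dots> \<le> 2 * (?a\<^sup>2 + ?b\<^sup>2)"
      using sum_squares_bound[of ?a ?b] by (simp add: power2_sum)
    also have "\<dots> \<le> 2 * (E x + (u x)\<^sup>2 * E x)"
    proof -
      have "?a\<^sup>2 \<le> E x" "(norm (qd F x))\<^sup>2 \<le> E x" by (simp_all add: E_def power2_norm_eq_inner)
      then show ?thesis by (auto simp: power_mult_distrib intro!: add_mono mult_left_mono)
    qed
    also have "\<dots> = 2 * E x * (1 + (u x)\<^sup>2)" by (simp add: algebra_simps)
    also have "\<dots> \<le> 2 * B * (1 + (u x)\<^sup>2)" using E_le[OF x] by (intro mult_right_mono) auto
    finally show "(norm (F x))\<^sup>2 \<le> 2 * B * (1 + (u x)\<^sup>2)" .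
  qed
qed

lemma pow_sum:
  assumes "finite S" "\<And>i m. i \<in> S \<Longrightarrow> reg m (v i)"
  shows "reg m (\<lambda>x. \<Sum>i\<in>S. c i * v i x)"
    and "x \<in> unit_ivl \<Longrightarrow> pow k (\<lambda>x. \<Sum>i\<in>S. c i * v i x) x = (\<Sum>i\<in>S. c i * pow k (v i) x)"
proof -
  have "(\<forall>m. reg m (\<lambda>x. \<Sum>i\<in>S. c i * v i x)) \<and>
    (\<forall>x\<in>unit_ivl. pow k (\<lambda>x. \<Sum>i\<in>S. c i * v i x) x = (\<Sum>i\<in>S. c i * pow k (v i) x))"
    using assms
  proof (induction rule: finite_induct)
    case empty
    show ?case by (simp add: reg_const jacobi_pow_zero)
  next
    case (insert i S)
    have eq: "(\<lambda>x. \<Sum>i\<in>insert i S. c i * v i x) = (\<lambda>x. c i * v i x + 1 * (\<Sum>i\<in>S. c i * v i x))"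
      using insert by (simp add: fun_eq_iff)
    have r: "reg m (v i)" "reg m (\<lambda>x. \<Sum>i\<in>S. c i * v i x)" for m using insert by auto
    have "reg m (\<lambda>x. c i * v i x + 1 * (\<Sum>i\<in>S. c i * v i x))" for m
      by (intro reg_add reg_cmult r)
    moreover have "pow k (\<lambda>x. c i * v i x + 1 * (\<Sum>i\<in>S. c i * v i x)) x = (\<Sum>i\<in>insert i S. c i * pow k (v i) x)"
      if "x \<in> unit_ivl" for x
      using jacobi_pow_lincomb[OF r(1) r(2) that, where \<alpha> = \<alpha> and \<beta> = \<beta> and k = k and c = "c i" and d = 1] insert that by simp
    ultimately show ?case unfolding eq by blast
  qed
  then show "reg m (\<lambda>x. \<Sum>i\<in>S. c i * v i x)"
    "x \<in> unit_ivl \<Longrightarrow> pow k (\<lambda>x. \<Sum>i\<in>S. c i * v i x) x = (\<Sum>i\<in>S. c i * pow k (v i) x)" by auto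
qed

end

section \<open>Eigenfunctions inside the defect spaces\<close>

context jacobi_power
begin

text \<open>A fundamental system at 0: the flag s selects the initial data (1, 0) or (0, 1).\<close>

definition eigf :: "complex \<Rightarrow> bool \<Rightarrow> real \<Rightarrow> complex" where
  "eigf \<mu> s x = (if x \<in> unit_ivl then psum (jcoeff \<mu> (of_bool s) (of_bool (\<not> s))) x else 0)"

lemma eigf_reg: "reg m (eigf \<mu> s)"
  by (rule reg_cong[OF _ psum_reg[OF jcoeff_conv1]]) (simp add: eigf_def)

lemma eigf_ell:
  assumes "x \<in> unit_ivl" shows "ell (eigf \<mu> s) x = \<mu> * eigf \<mu> s x"
proof -
  have "ell (eigf \<mu> s) x = ell (psum (jcoeff \<mu> (of_bool s) (of_bool (\<not> s)))) x"
    by (rule jacobi_expr_cong[OF _ assms]) (simp add: eigf_def)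
  then show ?thesis using psum_ell[OF assms] assms by (simp add: eigf_def)
qed

lemma pow_eigf: "x \<in> unit_ivl \<Longrightarrow> pow k (eigf \<mu> s) x = \<mu> ^ k * eigf \<mu> s x"
proof (induction k arbitrary: x)
  case (Suc k)
  have "pow (Suc k) (eigf \<mu> s) x = ell (\<lambda>x. \<mu> ^ k * eigf \<mu> s x + 0 * eigf \<mu> s x) x"
    using Suc by (auto intro: jacobi_expr_cong)
  also have "\<dots> = \<mu> ^ k * ell (eigf \<mu> s) x + 0 * ell (eigf \<mu> s) x"
    by (intro jacobi_expr_lincomb eigf_reg qder_differentiable Suc.prems)
  finally show ?case using eigf_ell[OF Suc.prems] by simp
qed simp

lemma eigf_V: "eigf \<mu> s \<in> V"
proof -
  have "L2 (eigf \<mu> s)" by (rule eigenfunction_L2[OF eigf_reg eigf_ell])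
  then have "L2 (\<lambda>x. \<mu> ^ n * eigf \<mu> s x)" by (rule square_integrable_cmult)
  then have "L2 (pow n (eigf \<mu> s))"
    by (rule square_integrable_spike[where N = "{}"]) (auto simp: pow_eigf)
  then show ?thesis unfolding D_max_iff by (auto simp: eigf_reg eigf_def)
qed

lemma eigf_initial: "eigf \<mu> s 0 = of_bool s" "(eigf \<mu> s has_vector_derivative of_bool (\<not> s)) (at 0)"
proof -
  let ?a = "jcoeff \<mu> (of_bool s) (of_bool (\<not> s))"
  have z: "psum a 0 = a 0" for a using powser_zero[of a] by (simp add: psum_def)
  show "eigf \<mu> s 0 = of_bool s" by (simp add: eigf_def z)
  have "(psum ?a has_vector_derivative of_bool (\<not> s)) (at 0)"
    using psum_has_vector_derivative[OF jcoeff_conv1, of 0] by (simp add: z diffs_def)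
  then show "(eigf \<mu> s has_vector_derivative of_bool (\<not> s)) (at 0)"
    by (subst has_vector_derivative_cong_ivl[of _ "psum ?a"]) (auto simp: eigf_def)
qed

text \<open>If \<open>\<mu>\<close> runs through the \<open>2 n\<close> roots of \<open>\<mu>\<^bsup>2n\<^esup> = - 1\<close> then \<open>\<mu>\<^bsup>n\<^esup> = \<plusminus> \<i>\<close>, so the
  eigenfunctions of \<open>ell\<close> for these \<open>\<mu>\<close> lie in the defect spaces.\<close>

definition eig_index :: "(complex \<times> bool) set" where
  "eig_index = {\<mu>. \<mu> ^ (2 * n) = -1} \<times> UNIV"

lemma eig_index_finite: "finite eig_index" and card_eig_index: "card eig_index = 4 * n"
proof -
  have c: "card {\<mu>::complex. \<mu> ^ (2 * n) = -1} = 2 * n" using n by (intro card_nth_roots) auto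
  then have "finite {\<mu>::complex. \<mu> ^ (2 * n) = -1}" using n by (intro card_ge_0_finite) simp
  then show "finite eig_index" by (simp add: eig_index_def)
  show "card eig_index = 4 * n" using c by (simp add: eig_index_def card_cartesian_product)
qed

text \<open>Applying the powers of \<open>ell\<close> to the vanishing combination inserts any
  polynomial in the eigenvalue. The polynomial with all roots except \<mu> isolates the two
  eigenfunctions for \<mu>, and value and derivative at 0 separate these.\<close>

lemma eigf_independent:
  assumes 0: "\<And>x. (\<Sum>i\<in>eig_index. c i * eigf (fst i) (snd i) x) = 0" and i: "(\<mu>, s) \<in> eig_index"
  shows "c (\<mu>, s) = 0"
proof -
  let ?R = "{\<mu>::complex. \<mu> ^ (2 * n) = -1}"
  have finR: "finite ?R" using eig_index_finite by (auto simp: eig_index_def finite_cartesian_product_iff)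
  have pw: "(\<Sum>i\<in>eig_index. c i * (fst i ^ k * eigf (fst i) (snd i) x)) = 0" if x: "x \<in> unit_ivl" for k x
  proof -
    have "(\<Sum>i\<in>eig_index. c i * pow k (eigf (fst i) (snd i)) x) = pow k (\<lambda>x. \<Sum>i\<in>eig_index. c i * eigf (fst i) (snd i) x) x"
      using pow_sum(2)[OF eig_index_finite eigf_reg x, where c = c] by simp
    also have "\<dots> = 0" unfolding 0 by (simp add: jacobi_pow_zero)
    finally show ?thesis using x by (simp add: pow_eigf)
  qed
  define P where "P = (\<Prod>\<nu>\<in>?R - {\<mu>}. [:-\<nu>, 1:])"
  have P0: "poly P \<nu> = 0" if "\<nu> \<in> ?R" "\<nu> \<noteq> \<mu>" for \<nu>
    using that finR by (auto simp: P_def poly_prod)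
  have P1: "poly P \<mu> \<noteq> 0" using finR by (auto simp: P_def poly_prod)
  have zero: "(\<Sum>s\<in>UNIV. c (\<mu>, s) * eigf \<mu> s x) = 0" if x: "x \<in> unit_ivl" for x
  proof -
    have "(\<Sum>i\<in>eig_index. poly P (fst i) * (c i * eigf (fst i) (snd i) x)) =
        (\<Sum>i\<in>eig_index. \<Sum>k\<le>degree P. coeff P k * (c i * (fst i ^ k * eigf (fst i) (snd i) x)))"
      unfolding poly_altdef by (intro sum.cong refl) (simp add: sum_distrib_left sum_distrib_right mult_ac)
    also have "\<dots> = (\<Sum>k\<le>degree P. coeff P k * (\<Sum>i\<in>eig_index. c i * (fst i ^ k * eigf (fst i) (snd i) x)))"
      by (subst sum.swap) (simp add: sum_distrib_left)
    also have "\<dots> = 0" using pw[OF x] by simp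
    finally have "(\<Sum>i\<in>eig_index. poly P (fst i) * (c i * eigf (fst i) (snd i) x)) = 0" .
    also have "(\<Sum>i\<in>eig_index. poly P (fst i) * (c i * eigf (fst i) (snd i) x)) =
        (\<Sum>\<nu>\<in>?R. \<Sum>s\<in>UNIV. poly P \<nu> * (c (\<nu>, s) * eigf \<nu> s x))"
      unfolding eig_index_def by (subst sum.cartesian_product) (simp add: case_prod_beta)
    also have "\<dots> = (\<Sum>\<nu>\<in>?R. if \<nu> = \<mu> then \<Sum>s\<in>UNIV. poly P \<mu> * (c (\<mu>, s) * eigf \<mu> s x) else 0)"
      using P0 by (intro sum.cong) auto
    also have "\<dots> = poly P \<mu> * (\<Sum>s\<in>UNIV. c (\<mu>, s) * eigf \<mu> s x)"
      using i finR by (simp add: eig_index_def sum_distrib_left)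
    finally show ?thesis using P1 by simp
  qed
  let ?h = "\<lambda>x. c (\<mu>, True) * eigf \<mu> True x + c (\<mu>, False) * eigf \<mu> False x"
  have h0: "?h x = 0" if "x \<in> unit_ivl" for x
    using zero[OF that] by (simp add: UNIV_bool add.commute)
  have "c (\<mu>, True) = 0" using h0[of 0] by (simp add: eigf_initial)
  moreover have "c (\<mu>, False) = 0"
  proof -
    have "(?h has_vector_derivative c (\<mu>, True) * of_bool (\<not> True) + c (\<mu>, False) * of_bool (\<not> False)) (at 0)"
      by (intro has_vector_derivative_add has_vector_derivative_mult_right eigf_initial(2))
    moreover have "(?h has_vector_derivative 0) (at 0)"
      by (subst has_vector_derivative_cong_ivl[of _ "\<lambda>_. 0"]) (use h0 in auto)
    ultimately show ?thesis using vector_derivative_unique_at by fastforce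
  qed
  ultimately show ?thesis by (cases s) auto
qed

lemma eig_sum_split:
  obtains f g where "f \<in> defect_plus \<alpha> \<beta> n" "g \<in> defect_minus \<alpha> \<beta> n"
    "\<And>x. (\<Sum>i\<in>eig_index. c i * eigf (fst i) (snd i) x) = f x + g x"
proof -
  define P M where "P = {i \<in> eig_index. fst i ^ n = \<i>}" and "M = {i \<in> eig_index. fst i ^ n \<noteq> \<i>}"
  have PM: "eig_index = P \<union> M" "P \<inter> M = {}" "finite P" "finite M"
    using eig_index_finite by (auto simp: P_def M_def)
  have M: "fst i ^ n = - \<i>" if "i \<in> M" for i
  proof -
    have "(fst i ^ n)\<^sup>2 = -1" using that by (auto simp: M_def eig_index_def power_mult[symmetric] mult.commute)
    then have "fst i ^ n = \<i> \<or> fst i ^ n = - \<i>" by (metis power2_i power2_eq_iff)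
    then show ?thesis using that by (auto simp: M_def)
  qed
  have pw: "pow n (\<lambda>x. \<Sum>i\<in>Q. c i * eigf (fst i) (snd i) x) x = a * (\<Sum>i\<in>Q. c i * eigf (fst i) (snd i) x)"
    if "finite Q" "\<And>i. i \<in> Q \<Longrightarrow> fst i ^ n = a" "x \<in> unit_ivl" for Q a x
  proof -
    have "pow n (\<lambda>x. \<Sum>i\<in>Q. c i * eigf (fst i) (snd i) x) x = (\<Sum>i\<in>Q. c i * pow n (eigf (fst i) (snd i)) x)"
      by (rule pow_sum(2)[OF that(1) eigf_reg that(3)])
    also have "\<dots> = (\<Sum>i\<in>Q. c i * (a * eigf (fst i) (snd i) x))"
      using that by (intro sum.cong refl) (simp add: pow_eigf)
    finally show ?thesis by (simp add: sum_distrib_left mult_ac)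
  qed
  let ?s = "\<lambda>Q x. \<Sum>i\<in>Q. c i * eigf (fst i) (snd i) x"
  have Ppow: "pow n (?s P) x = \<i> * ?s P x" if "x \<in> unit_ivl" for x
    by (rule pw[of P "\<i>", OF PM(3) _ that]) (simp add: P_def)
  have Mpow: "pow n (?s M) x = - \<i> * ?s M x" if "x \<in> unit_ivl" for x
    by (rule pw[of M "- \<i>", OF PM(4) M that])
  have Pe: "{x \<in> unit_ivl. pow n (?s P) x \<noteq> \<i> * ?s P x} = {}" and Me: "{x \<in> unit_ivl. pow n (?s M) x \<noteq> - \<i> * ?s M x} = {}"
    using Ppow Mpow by blast+
  have "?s P \<in> defect_plus \<alpha> \<beta> n"
    unfolding defect_plus_def AE_jacobi_measure_iff mem_Collect_eq Pe
    using V_sum(1)[OF PM(3) eigf_V, where c = c] by simp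
  moreover have "?s M \<in> defect_minus \<alpha> \<beta> n"
    unfolding defect_minus_def AE_jacobi_measure_iff mem_Collect_eq Me
    using V_sum(1)[OF PM(4) eigf_V, where c = c] by simp
  moreover have "?s eig_index x = ?s P x + ?s M x" for x
    unfolding PM(1) by (rule sum.union_disjoint) (use PM in auto)
  ultimately show thesis by (rule that)
qed

lemma eig_sum_in_D_min:
  assumes "(\<lambda>x. \<Sum>i\<in>eig_index. c i * eigf (fst i) (snd i) x) \<in> D_min \<alpha> \<beta> n"
  shows "\<forall>i\<in>eig_index. c i = 0"
proof -
  obtain f g where fg: "f \<in> defect_plus \<alpha> \<beta> n" "g \<in> defect_minus \<alpha> \<beta> n"
    "\<And>x. (\<Sum>i\<in>eig_index. c i * eigf (fst i) (snd i) x) = f x + g x"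
    using eig_sum_split[of c] by blast
  have "f = (\<lambda>_. 0)" "g = (\<lambda>_. 0)"
    using D_min_defect_sum[OF fg(1,2)] assms unfolding fg(3) by auto
  then have "(\<Sum>i\<in>eig_index. c i * eigf (fst i) (snd i) x) = 0" for x using fg(3)[of x] by simp
  then show ?thesis using eigf_independent[of c] by auto
qed

lemma V_eig_decomposition:
  assumes f: "f \<in> V"
  obtains c where "(\<lambda>x. f x - (\<Sum>i\<in>eig_index. c i * eigf (fst i) (snd i) x)) \<in> bd_kernel"
proof (rule decompose_mod_bd_kernel[OF eig_index_finite card_eig_index _ _ f])
  show "\<forall>i\<in>eig_index. c i = 0" if "(\<lambda>x. \<Sum>i\<in>eig_index. c i * eigf (fst i) (snd i) x) \<in> bd_kernel" for c
    using eig_sum_in_D_min that bd_kernel_subset_D_min by blast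
qed (rule eigf_V)

text \<open>A member of the minimal domain differs from a member of the kernel by a combination of
  eigenfunctions. That combination lies in the minimal domain too, hence is 0.\<close>

lemma D_min_eq_bd_kernel: "D_min \<alpha> \<beta> n = bd_kernel"
proof
  show "D_min \<alpha> \<beta> n \<subseteq> bd_kernel"
  proof
    fix f assume f: "f \<in> D_min \<alpha> \<beta> n"
    then have "f \<in> V" by (simp add: D_min_def)
    then obtain c where c: "(\<lambda>x. f x - (\<Sum>i\<in>eig_index. c i * eigf (fst i) (snd i) x)) \<in> bd_kernel"
      using V_eig_decomposition by blast
    let ?s = "\<lambda>x. \<Sum>i\<in>eig_index. c i * eigf (fst i) (snd i) x"
    have "(\<lambda>x. f x - ?s x) \<in> D_min \<alpha> \<beta> n" using c bd_kernel_subset_D_min by blast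
    from D_min_lincomb[OF f this, of 1 "-1"] have "?s \<in> D_min \<alpha> \<beta> n" by simp
    then have "?s = (\<lambda>_. 0)" using eig_sum_in_D_min[of c] by (simp add: fun_eq_iff)
    then show "f \<in> bd_kernel" using c by (simp add: fun_eq_iff)
  qed
qed (rule bd_kernel_subset_D_min)

end

section \<open>Endpoint profiles\<close>

text \<open>The functions \<open>(1 - x)\<^bsup>s\<^esup> (a + b ln (1 - x))\<close> contain all profiles, and each differential
  operation stays within finite sums of them.\<close>

definition hlog :: "real \<Rightarrow> complex \<Rightarrow> complex \<Rightarrow> real \<Rightarrow> complex" where
  "hlog s a b x = of_real ((1 - x) powr s) * (a + b * of_real (ln (1 - x)))"

lemma hlog_deriv:
  assumes x: "x < 1"
  shows "(hlog s a b has_vector_derivative hlog (s - 1) (- (of_real s * a + b)) (- (of_real s * b)) x) (at x)"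
proof -
  have 1: "((\<lambda>y. (1 - y) powr s) has_real_derivative s * (1 - x) powr (s - of_nat 1) * (- 1)) (at x)"
    using x by (intro DERIV_fun_powr) (auto intro!: derivative_eq_intros)
  have 2: "((\<lambda>y. ln (1 - y)) has_real_derivative - 1 / (1 - x)) (at x)"
    using x by (auto intro!: derivative_eq_intros)
  have d: "(hlog s a b has_vector_derivative
      of_real ((1 - x) powr s) * (0 + b * of_real (- 1 / (1 - x))) +
      of_real (s * (1 - x) powr (s - of_nat 1) * (- 1)) * (a + b * of_real (ln (1 - x)))) (at x)"
    unfolding hlog_def[abs_def]
    by (intro has_vector_derivative_mult has_vector_derivative_add has_vector_derivative_const
        has_vector_derivative_mult_right has_vector_derivative_of_real 1 2)
  have "of_real ((1 - x) powr s) * of_real (- 1 / (1 - x)) = - complex_of_real ((1 - x) powr (s - 1))"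
    unfolding of_real_mult[symmetric] of_real_minus[symmetric] using x by (simp add: powr_diff)
  then have e: "of_real ((1 - x) powr s) * (0 + b * of_real (- 1 / (1 - x))) = - of_real ((1 - x) powr (s - 1)) * b"
    by (metis add_0 mult.commute mult.left_commute)
  show ?thesis
    by (rule has_vector_derivative_eq_rhs[OF d]) (simp only: e, simp add: hlog_def algebra_simps)
qed

lemma hlog_reg: "reg m (hlog s a b)"
proof (induction m arbitrary: s a b)
  case 0
  have "continuous_on unit_ivl (hlog (s - 1) (- (of_real s * a + b)) (- (of_real s * b)))"
    by (intro continuous_at_imp_continuous_on ballI has_vector_derivative_continuous[OF hlog_deriv]) auto
  then show ?case using AC_loc_C1[OF hlog_deriv] by simp
next
  case (Suc m)
  have "reg m (rderiv (hlog s a b))"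
    by (rule reg_cong[OF _ Suc.IH]) (rule rderiv_eq[OF hlog_deriv, symmetric], simp)
  moreover have "\<forall>x\<in>unit_ivl. hlog s a b differentiable (at x)"
    using differentiableI_vector[OF hlog_deriv] by auto
  ultimately show ?case using reg_AC_loc[OF Suc.IH] by simp
qed

lemma hlog_shift: "x < 1 \<Longrightarrow> of_real (1 - x) * hlog s a b x = hlog (s + 1) a b x"
  by (simp add: hlog_def powr_add)

lemma hlog_powr_mult: "of_real ((1 - x) powr r) * hlog s a b x = hlog (r + s) a b x"
  by (simp add: hlog_def powr_add)

text \<open>Writing 1 + x = 2 - (1 - x) splits the image into one term of exponent s - 1 and one of
  exponent s. The factor s (s + \<alpha>) is the indicial polynomial at the end 1, with roots 0 and
  -\<alpha>.\<close>

lemma hlog_ell: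
  assumes x: "x \<in> unit_ivl"
  shows "jacobi_expr \<alpha> \<beta> (hlog s a b) x =
    hlog (s - 1) (- 2 * (of_real (s * (s + \<alpha>)) * a + of_real (2 * s + \<alpha>) * b)) (- 2 * of_real (s * (s + \<alpha>)) * b) x +
    hlog s (of_real (s * (s + \<alpha> + \<beta> + 1)) * a + of_real (2 * s + \<alpha> + \<beta> + 1) * b) (of_real (s * (s + \<alpha> + \<beta> + 1)) * b) x"
proof -
  let ?a1 = "- (of_real s * a + b)" and ?b1 = "- (of_real s * b)"
  let ?a2 = "- (of_real (s - 1) * ?a1 + ?b1)" and ?b2 = "- (of_real (s - 1) * ?b1)"
  have x1: "x < 1" using x by simp
  have d1: "rderiv (hlog s a b) y = hlog (s - 1) ?a1 ?b1 y" if "y \<in> unit_ivl" for y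
    by (rule rderiv_eq[OF hlog_deriv]) (use that in simp)
  have d2: "(rderiv (hlog s a b) has_vector_derivative hlog (s - 1 - 1) ?a2 ?b2 x) (at x)"
    using hlog_deriv[OF x1, of "s - 1" ?a1 ?b1] has_vector_derivative_cong_ivl[OF d1 x] by simp
  have "jacobi_expr \<alpha> \<beta> (hlog s a b) x = (x\<^sup>2 - 1) *\<^sub>R hlog (s - 1 - 1) ?a2 ?b2 x +
      ((\<alpha> + \<beta> + 2) * x + (\<alpha> - \<beta>)) *\<^sub>R hlog (s - 1) ?a1 ?b1 x"
    using jacobi_expr_eq[OF differentiableI_vector[OF hlog_deriv[OF x1]] d2 x] d1[OF x] by simp
  also have "(x\<^sup>2 - 1) *\<^sub>R hlog (s - 1 - 1) ?a2 ?b2 x = (- (1 + x)) *\<^sub>R hlog (s - 1) ?a2 ?b2 x"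
  proof -
    have "(x\<^sup>2 - 1) *\<^sub>R h = (- (1 + x)) *\<^sub>R (of_real (1 - x) * h)" for h :: complex
      by (simp add: scaleR_conv_of_real power2_eq_square algebra_simps)
    moreover have "s - 1 - 1 + 1 = s - 1" by simp
    ultimately show ?thesis using hlog_shift[OF x1, of "s - 1 - 1" ?a2 ?b2] by (simp only:)
  qed
  also have "(- (1 + x)) *\<^sub>R hlog (s - 1) ?a2 ?b2 x + ((\<alpha> + \<beta> + 2) * x + (\<alpha> - \<beta>)) *\<^sub>R hlog (s - 1) ?a1 ?b1 x =
     (-2) * hlog (s - 1) ?a2 ?b2 x + of_real (2 * (\<alpha> + 1)) * hlog (s - 1) ?a1 ?b1 x
     + (of_real (1 - x) * hlog (s - 1) ?a2 ?b2 x - of_real (\<alpha> + \<beta> + 2) * (of_real (1 - x) * hlog (s - 1) ?a1 ?b1 x))"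
    by (simp add: scaleR_conv_of_real algebra_simps)
  also have "\<dots> = (-2) * hlog (s - 1) ?a2 ?b2 x + of_real (2 * (\<alpha> + 1)) * hlog (s - 1) ?a1 ?b1 x
     + (hlog s ?a2 ?b2 x - of_real (\<alpha> + \<beta> + 2) * hlog s ?a1 ?b1 x)"
    unfolding hlog_shift[OF x1] by simp
  also have "\<dots> = hlog (s - 1) (- 2 * (of_real (s * (s + \<alpha>)) * a + of_real (2 * s + \<alpha>) * b)) (- 2 * of_real (s * (s + \<alpha>)) * b) x +
    hlog s (of_real (s * (s + \<alpha> + \<beta> + 1)) * a + of_real (2 * s + \<alpha> + \<beta> + 1) * b) (of_real (s * (s + \<alpha> + \<beta> + 1)) * b) x"
    unfolding hlog_def by (simp add: algebra_simps)
  finally show ?thesis .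
qed

lemma hlog_tendsto_0:
  assumes "r > 0" shows "(hlog r a b \<longlongrightarrow> 0) (at_left 1)"
proof -
  have t: "filterlim (\<lambda>x::real. 1 - x) (at_right 0) (at_left 1)"
    unfolding filterlim_at
    by (auto intro!: tendsto_eq_intros eventually_at_leftI[of 0])
  have "((\<lambda>x. (1 - x) powr r) \<longlongrightarrow> 0 powr r) (at_left 1)"
    using assms by (intro tendsto_powr2[OF _ tendsto_const])
      (auto intro!: tendsto_eq_intros eventually_at_leftI[of 0])
  then have 1: "((\<lambda>x. (1 - x) powr r) \<longlongrightarrow> 0) (at_left 1)" using assms by simp
  have "((\<lambda>t::real. t powr r * ln t) \<longlongrightarrow> 0) (at_right 0)"
    using assms by real_asymp
  from filterlim_compose[OF this t] have 2: "((\<lambda>x. (1 - x) powr r * ln (1 - x)) \<longlongrightarrow> 0) (at_left 1)" .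
  have "((\<lambda>x. of_real ((1 - x) powr r) * a + of_real ((1 - x) powr r * ln (1 - x)) * b) \<longlongrightarrow> of_real 0 * a + of_real 0 * b) (at_left 1)"
    by (intro tendsto_intros 1 2)
  then show ?thesis by (simp add: hlog_def[abs_def] algebra_simps)
qed

section \<open>Action of the expression on the coefficients of the profiles at 1\<close>

context jacobi
begin

lemma qd_hlog:
  assumes x: "x \<in> unit_ivl"
  shows "qd (hlog s a b) x = of_real ((1 + x) powr (\<beta> + 1)) * hlog (s + \<alpha>) (- (of_real s * a + b)) (- (of_real s * b)) x"
proof -
  have "rderiv (hlog s a b) x = hlog (s - 1) (- (of_real s * a + b)) (- (of_real s * b)) x"
    by (rule rderiv_eq[OF hlog_deriv]) (use x in simp)
  moreover have "of_real ((1 - x) powr (\<alpha> + 1)) * hlog (s - 1) A B x = hlog (s + \<alpha>) A B x" for A B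
  proof -
    have "\<alpha> + 1 + (s - 1) = s + \<alpha>" by simp
    then show ?thesis using hlog_powr_mult[of x "\<alpha> + 1" "s - 1" A B] by (simp only:)
  qed
  moreover have "a * b * c = b * (a * c)" for a b c :: complex by simp
  ultimately show ?thesis
    unfolding qder_def jacobi_p_def by (simp only: scaleR_conv_of_real of_real_mult)
qed

text \<open>Here a multiplies the first profile of index j and b the second. Treating them as a pair
  lets the logarithmic case and the power case share all later arguments.\<close>

definition prof :: "nat \<Rightarrow> complex \<Rightarrow> complex \<Rightarrow> real \<Rightarrow> complex" where
  "prof j a b x = (if \<alpha> = 0 then hlog (real j) a b x else hlog (real j) a 0 x + hlog (real j - \<alpha>) b 0 x)"

lemma prof_eq:
  assumes "x < 1"
  shows "prof j a b x = a * of_real ((1 - x) ^ j) + b * of_real (psi_profile \<alpha> j (1 - x))"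
  using assms by (simp add: prof_def hlog_def psi_profile_def powr_realpow algebra_simps)

lemma prof_alpha_0:
  assumes "\<alpha> = 0" shows "prof j a b = hlog (real j) a b"
  by (rule ext) (simp only: prof_def if_P[OF assms])

lemma prof_reg: "reg m (prof j a b)"
proof (cases "\<alpha> = 0")
  case True
  show ?thesis unfolding prof_alpha_0[OF True] by (rule hlog_reg)
next
  case False
  then show ?thesis using reg_add[OF hlog_reg[of m "real j" a 0] hlog_reg[of m "real j - \<alpha>" b 0]]
    by (simp add: prof_def[abs_def])
qed

text \<open>Switches on the terms by which differentiating the logarithm feeds the second
  coefficient into the first; for \<alpha> > 0 the two families do not mix.\<close>

definition \<theta> :: complex where "\<theta> = of_bool (\<alpha> = 0)"

text \<open>The suffix 1 marks the contribution to index j - 1, the suffix 0 the one to index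
  j.\<close>

definition opA1 :: "nat \<Rightarrow> complex \<Rightarrow> complex \<Rightarrow> complex" where
  "opA1 j a b = - 2 * (of_real (real j * (real j + \<alpha>)) * a + \<theta> * of_real (2 * real j) * b)"
definition opB1 :: "nat \<Rightarrow> complex \<Rightarrow> complex" where
  "opB1 j b = - 2 * of_real ((real j - \<alpha>) * real j) * b"
definition opA0 :: "nat \<Rightarrow> complex \<Rightarrow> complex \<Rightarrow> complex" where
  "opA0 j a b = of_real (real j * (real j + \<alpha> + \<beta> + 1)) * a + \<theta> * of_real (2 * real j + \<beta> + 1) * b"
definition opB0 :: "nat \<Rightarrow> complex \<Rightarrow> complex" where
  "opB0 j b = of_real ((real j - \<alpha>) * (real j + \<beta> + 1)) * b"

lemma hlog_zero [simp]: "hlog s 0 0 x = 0"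
  by (simp add: hlog_def)

lemma prof_zero [simp]: "prof j 0 0 x = 0"
  by (simp add: prof_def)

lemma prof_add: "prof j a b x + prof j a' b' x = prof j (a + a') (b + b') x"
  by (simp add: prof_def hlog_def algebra_simps)

text \<open>The exponents 0 and -\<alpha> of the profiles of index 0 are indicial, and for \<alpha>
  = 0 the double root also removes the logarithmic remainder. So index -1 never arises.\<close>

lemma ell_prof:
  assumes x: "x \<in> unit_ivl"
  shows "ell (prof j a b) x = (if j = 0 then 0 else prof (j - 1) (opA1 j a b) (opB1 j b) x) + prof j (opA0 j a b) (opB0 j b) x"
proof (cases "\<alpha> = 0")
  case True
  have th: "\<theta> = 1" unfolding \<theta>_def using True by simp
  have "ell (hlog (real j) a b) x = hlog (real j - 1) (opA1 j a b) (opB1 j b) x + hlog (real j) (opA0 j a b) (opB0 j b) x"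
    by (subst hlog_ell[OF x], simp only: opA1_def opB1_def opA0_def opB0_def th) (simp add: True algebra_simps)
  also have "hlog (real j - 1) (opA1 j a b) (opB1 j b) x = (if j = 0 then 0 else hlog (real (j - 1)) (opA1 j a b) (opB1 j b) x)"
    by (auto simp: opA1_def opB1_def of_nat_diff)
  finally show ?thesis unfolding prof_alpha_0[OF True] .
next
  case False
  have e: "prof j a b = (\<lambda>x. 1 * hlog (real j) a 0 x + 1 * hlog (real j - \<alpha>) b 0 x)" for j a b
    using False by (simp add: prof_def fun_eq_iff)
  have "ell (prof j a b) x = ell (\<lambda>x. 1 * hlog (real j) a 0 x + 1 * hlog (real j - \<alpha>) b 0 x) x"
    unfolding e ..
  also have "\<dots> = 1 * ell (hlog (real j) a 0) x + 1 * ell (hlog (real j - \<alpha>) b 0) x"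
    by (intro jacobi_expr_lincomb hlog_reg qder_differentiable x)
  also have "\<dots> = (hlog (real j - 1) (opA1 j a b) 0 x + hlog (real j - \<alpha> - 1) (opB1 j b) 0 x) +
      (hlog (real j) (opA0 j a b) 0 x + hlog (real j - \<alpha>) (opB0 j b) 0 x)"
    using False by (simp add: hlog_ell[OF x] opA1_def opB1_def opA0_def opB0_def \<theta>_def algebra_simps)
  also have "hlog (real j - 1) (opA1 j a b) 0 x + hlog (real j - \<alpha> - 1) (opB1 j b) 0 x =
      (if j = 0 then 0 else prof (j - 1) (opA1 j a b) (opB1 j b) x)"
    using False by (auto simp: opA1_def opB1_def prof_def of_nat_diff \<theta>_def algebra_simps)
  finally show ?thesis unfolding e[of j "opA0 j a b" "opB0 j b"] by (simp only: mult_1)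
qed

definition tsum :: "nat \<Rightarrow> (nat \<Rightarrow> complex) \<Rightarrow> (nat \<Rightarrow> complex) \<Rightarrow> real \<Rightarrow> complex" where
  "tsum N A B x = (\<Sum>j<N. prof j (A j) (B j) x)"

definition opA :: "(nat \<Rightarrow> complex) \<Rightarrow> (nat \<Rightarrow> complex) \<Rightarrow> nat \<Rightarrow> complex" where
  "opA A B j = opA1 (Suc j) (A (Suc j)) (B (Suc j)) + opA0 j (A j) (B j)"
definition opB :: "(nat \<Rightarrow> complex) \<Rightarrow> nat \<Rightarrow> complex" where
  "opB B j = opB1 (Suc j) (B (Suc j)) + opB0 j (B j)"

lemma op_zero [simp]: "opA1 j 0 0 = 0" "opB1 j 0 = 0" "opA0 j 0 0 = 0" "opB0 j 0 = 0"
  by (simp_all add: opA1_def opB1_def opA0_def opB0_def)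

lemma ell_tsum:
  assumes x: "x \<in> unit_ivl" and supp: "\<And>j. j \<ge> N \<Longrightarrow> A j = 0 \<and> B j = 0"
  shows "ell (tsum N A B) x = tsum N (opA A B) (opB B) x"
proof -
  have "ell (tsum N A B) x = (\<Sum>j<N. ell (prof j (A j) (B j)) x)"
    using pow_sum(2)[of "{..<N}" "\<lambda>j. prof j (A j) (B j)" x "Suc 0" "\<lambda>_. 1"] prof_reg x by (simp add: tsum_def[abs_def])
  also have "\<dots> = (\<Sum>j<N. if j = 0 then 0 else prof (j - 1) (opA1 j (A j) (B j)) (opB1 j (B j)) x) +
      (\<Sum>j<N. prof j (opA0 j (A j) (B j)) (opB0 j (B j)) x)"
    by (simp add: ell_prof[OF x] sum.distrib)
  also have "(\<Sum>j<N. if j = 0 then 0 else prof (j - 1) (opA1 j (A j) (B j)) (opB1 j (B j)) x) =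
      (\<Sum>j<N. prof j (opA1 (Suc j) (A (Suc j)) (B (Suc j))) (opB1 (Suc j) (B (Suc j))) x)"
  proof (cases N)
    \<comment> \<open>Shifting the index drops the term of index 0, which is 0, and adds one with
      the coefficients of index N, which vanish by \<open>supp\<close>.\<close>
    case (Suc M)
    show ?thesis
      unfolding Suc by (subst sum.lessThan_Suc_shift, subst sum.lessThan_Suc) (use supp[of "Suc M"] Suc in simp)
  qed simp
  also have "\<dots> + (\<Sum>j<N. prof j (opA0 j (A j) (B j)) (opB0 j (B j)) x) = tsum N (opA A B) (opB B) x"
    unfolding sum.distrib[symmetric] by (simp add: prof_add tsum_def opA_def opB_def)
  finally show ?thesis .
qed

text \<open>The recursion transforms the coefficients before iterating, so that the induction in
  \<open>opn_vanishing\<close> can pass to the transformed pair.\<close>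

fun opn :: "nat \<Rightarrow> (nat \<Rightarrow> complex) \<times> (nat \<Rightarrow> complex) \<Rightarrow> (nat \<Rightarrow> complex) \<times> (nat \<Rightarrow> complex)" where
  "opn 0 AB = AB"
| "opn (Suc k) AB = opn k (opA (fst AB) (snd AB), opB (snd AB))"

lemma pow_tsum:
  assumes x: "x \<in> unit_ivl" and supp: "\<And>j. j \<ge> N \<Longrightarrow> A j = 0 \<and> B j = 0"
  shows "pow k (tsum N A B) x = tsum N (fst (opn k (A, B))) (snd (opn k (A, B))) x"
  using supp x
proof (induction k arbitrary: A B x)
  case (Suc k)
  have supp': "opA A B j = 0 \<and> opB B j = 0" if "j \<ge> N" for j
    using Suc.prems(1)[of j] Suc.prems(1)[of "Suc j"] that by (simp add: opA_def opB_def)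
  have "pow (Suc k) (tsum N A B) x = pow k (ell (tsum N A B)) x" by (simp add: funpow_swap1)
  also have "\<dots> = pow k (tsum N (opA A B) (opB B)) x"
    by (rule jacobi_pow_cong[OF _ Suc.prems(2)]) (rule ell_tsum[OF _ Suc.prems(1)])
  also have "\<dots> = tsum N (fst (opn k (opA A B, opB B))) (snd (opn k (opA A B, opB B))) x"
    by (rule Suc.IH[OF supp' Suc.prems(2)])
  finally show ?case by simp
qed simp

text \<open>By induction the transformed coefficients vanish below m - 1. Their entry of index j,
  once index j itself is known to be 0, contains only index j + 1, with factors (j + 1 - \<alpha>)
  (j + 1) and (j + 1) (j + 1 + \<alpha>), nonzero as 0 \<le> \<alpha> < 1.\<close>

lemma opn_vanishing:
  assumes "\<And>k. k < m \<Longrightarrow> fst (opn k (A, B)) 0 = 0 \<and> snd (opn k (A, B)) 0 = 0" and "j < m"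
  shows "A j = 0 \<and> B j = 0"
  using assms
proof (induction m arbitrary: A B j)
  case (Suc m)
  have IH: "opA A B i = 0 \<and> opB B i = 0" if "i < m" for i
    by (rule Suc.IH[OF _ that]) (use Suc.prems(1)[of "Suc _"] in simp)
  show ?case using Suc.prems(2)
  proof (induction j)
    case 0 then show ?case using Suc.prems(1)[of 0] by simp
  next
    case (Suc j)
    then have j0: "A j = 0" "B j = 0" and op: "opA A B j = 0" "opB B j = 0" using IH[of j] by auto
    \<comment> \<open>The second coefficient comes first, because for \<alpha> = 0 it also enters
      \<open>opA1\<close>.\<close>
    have "opB1 (Suc j) (B (Suc j)) = 0" using op j0 by (simp add: opB_def)
    moreover have "(real (Suc j) - \<alpha>) * real (Suc j) \<noteq> 0" using \<alpha> by simp
    ultimately have B: "B (Suc j) = 0" unfolding opB1_def by (simp only: mult_eq_0_iff of_real_eq_0_iff) simp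
    have "opA1 (Suc j) (A (Suc j)) 0 = 0" using op j0 B by (simp add: opA_def)
    moreover have "real (Suc j) * (real (Suc j) + \<alpha>) \<noteq> 0" using \<alpha> by simp
    ultimately have "A (Suc j) = 0" unfolding opA1_def by (simp only: mult_eq_0_iff of_real_eq_0_iff mult_zero_right add_0_right) simp
    then show ?case using B by simp
  qed
qed simp


section \<open>Boundary values of sums of profiles at 1\<close>

lemma eventually_at_left_1_unit_ivl: "\<forall>\<^sub>F x in at_left 1. x \<in> unit_ivl"
  using eventually_at_left_real[of "-1" 1] by auto

text \<open>Apart from the second profile of index 0, the quasi-derivative is either 0 or of
  exponent at least 1, up to a logarithm. This beats the growth (1 - x)^(-g) of u, because g can be
  taken below 1.\<close>

lemma qd_prof_tendsto_0:
  assumes "j = 0 \<Longrightarrow> b = 0"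
  shows "(qd (prof j a b) \<longlongrightarrow> 0) (at_left 1)" "((\<lambda>x. u x *\<^sub>R qd (prof j a b) x) \<longlongrightarrow> 0) (at_left 1)"
proof -
  define g where "g = (1 + 3 * \<alpha>) / 4"
  define h where "h = (1 + 3 * \<beta>) / 4"
  have gh: "\<alpha> \<le> g" "0 < g" "\<beta> \<le> h" "0 < h" "g < 1" using \<alpha> \<beta> by (simp_all add: g_def h_def)
  obtain C where C: "C > 0" "\<And>x. x \<in> unit_ivl \<Longrightarrow> \<bar>u x\<bar> \<le> C * ((1 - x) powr (-g) + (1 + x) powr (-h))"
    using second_solution_bound[OF u \<alpha>(1) \<beta>(1) gh(1,2,3,4)] by blast
  have lim1: "((\<lambda>x. (1 + x) powr (\<beta> + 1)) \<longlongrightarrow> (1 + 1) powr (\<beta> + 1)) (at_left 1)"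
    by (intro tendsto_intros) auto
  have main: "(qd (hlog s c d) \<longlongrightarrow> 0) (at_left 1)" "((\<lambda>x. u x *\<^sub>R qd (hlog s c d) x) \<longlongrightarrow> 0) (at_left 1)"
    if s: "s + \<alpha> \<ge> 1 \<or> (s = 0 \<and> d = 0)" for s c d
  proof -
    let ?c = "- (of_real s * c + d)" and ?d = "- (of_real s * d)"
    let ?k = "hlog (s + \<alpha>) ?c ?d" and ?k' = "hlog (s + \<alpha> - g) ?c ?d"
    let ?P = "\<lambda>x. complex_of_real ((1 + x) powr (\<beta> + 1))"
    have k: "(?k \<longlongrightarrow> 0) (at_left 1)" "(?k' \<longlongrightarrow> 0) (at_left 1)"
    proof -
      have "(?k \<longlongrightarrow> 0) (at_left 1) \<and> (?k' \<longlongrightarrow> 0) (at_left 1)"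
      proof (cases "s + \<alpha> \<ge> 1")
        case True
        then show ?thesis using hlog_tendsto_0 gh by simp
      next
        case False
        then have "?c = 0" "?d = 0" using s by auto
        moreover have "hlog r 0 0 = (\<lambda>_. 0)" for r by (rule ext) simp
        ultimately show ?thesis by (simp only: tendsto_const)
      qed
      then show "(?k \<longlongrightarrow> 0) (at_left 1)" "(?k' \<longlongrightarrow> 0) (at_left 1)" by auto
    qed
    have qe: "\<forall>\<^sub>F x in at_left 1. qd (hlog s c d) x = ?P x * ?k x"
      using eventually_at_left_1_unit_ivl by (rule eventually_mono) (rule qd_hlog)
    have "((\<lambda>x. ?P x * ?k x) \<longlongrightarrow> of_real ((1 + 1) powr (\<beta> + 1)) * 0) (at_left 1)"
      by (intro tendsto_mult tendsto_of_real lim1 k)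
    then have "((\<lambda>x. ?P x * ?k x) \<longlongrightarrow> 0) (at_left 1)" by simp
    then show "(qd (hlog s c d) \<longlongrightarrow> 0) (at_left 1)"
      by (rule Lim_transform_eventually) (use qe in \<open>auto elim: eventually_mono\<close>)
    have "((\<lambda>x. (1 + x) powr (\<beta> + 1) * (C * (norm (?k' x) + (1 + x) powr (-h) * norm (?k x)))) \<longlongrightarrow>
        (1 + 1) powr (\<beta> + 1) * (C * (norm (0::complex) + (1 + 1) powr (-h) * norm (0::complex)))) (at_left 1)"
      by (intro tendsto_mult lim1 tendsto_add tendsto_norm k tendsto_const tendsto_powr tendsto_ident_at) auto
    then have z: "((\<lambda>x. (1 + x) powr (\<beta> + 1) * (C * (norm (?k' x) + (1 + x) powr (-h) * norm (?k x)))) \<longlongrightarrow> 0) (at_left 1)"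
      by simp
    show "((\<lambda>x. u x *\<^sub>R qd (hlog s c d) x) \<longlongrightarrow> 0) (at_left 1)"
    proof (rule Lim_null_comparison[OF _ z])
      show "\<forall>\<^sub>F x in at_left 1. norm (u x *\<^sub>R qd (hlog s c d) x) \<le>
          (1 + x) powr (\<beta> + 1) * (C * (norm (?k' x) + (1 + x) powr (-h) * norm (?k x)))"
        using eventually_at_left_1_unit_ivl
      proof (rule eventually_mono)
        fix x assume x: "x \<in> unit_ivl"
        have e: "(1 - x) powr (-g) * norm (?k x) = norm (?k' x)"
          using hlog_powr_mult[of x "-g" "s + \<alpha>" ?c ?d, symmetric] by (simp add: norm_mult algebra_simps)
        have "norm (u x *\<^sub>R qd (hlog s c d) x) = (1 + x) powr (\<beta> + 1) * (\<bar>u x\<bar> * norm (?k x))"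
          by (simp add: qd_hlog[OF x] norm_mult)
        also have "\<dots> \<le> (1 + x) powr (\<beta> + 1) * (C * ((1 - x) powr (-g) + (1 + x) powr (-h)) * norm (?k x))"
          using C(2)[OF x] by (intro mult_left_mono mult_right_mono) auto
        also have "\<dots> = (1 + x) powr (\<beta> + 1) * (C * ((1 - x) powr (-g) * norm (?k x) + (1 + x) powr (-h) * norm (?k x)))"
          by (simp only: distrib_right mult.assoc)
        finally show "norm (u x *\<^sub>R qd (hlog s c d) x) \<le>
            (1 + x) powr (\<beta> + 1) * (C * (norm (?k' x) + (1 + x) powr (-h) * norm (?k x)))"
          unfolding e .
      qed
    qed
  qed
  show "(qd (prof j a b) \<longlongrightarrow> 0) (at_left 1)" "((\<lambda>x. u x *\<^sub>R qd (prof j a b) x) \<longlongrightarrow> 0) (at_left 1)"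
  proof -
    have "(qd (prof j a b) \<longlongrightarrow> 0) (at_left 1) \<and> ((\<lambda>x. u x *\<^sub>R qd (prof j a b) x) \<longlongrightarrow> 0) (at_left 1)"
    proof (cases "\<alpha> = 0")
      case True
      show ?thesis
        unfolding prof_alpha_0[OF True] using main[of "real j" b a] assms True by (cases j) auto
    next
      case False
      have m: "(qd (hlog (real j) a 0) \<longlongrightarrow> 0) (at_left 1)" "((\<lambda>x. u x *\<^sub>R qd (hlog (real j) a 0) x) \<longlongrightarrow> 0) (at_left 1)"
        using main[of "real j" 0 a] \<alpha> by (cases j; simp)+
      have m': "(qd (hlog (real j - \<alpha>) b 0) \<longlongrightarrow> 0) (at_left 1)" "((\<lambda>x. u x *\<^sub>R qd (hlog (real j - \<alpha>) b 0) x) \<longlongrightarrow> 0) (at_left 1)"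
      proof -
        have "(qd (hlog (real j - \<alpha>) b 0) \<longlongrightarrow> 0) (at_left 1) \<and> ((\<lambda>x. u x *\<^sub>R qd (hlog (real j - \<alpha>) b 0) x) \<longlongrightarrow> 0) (at_left 1)"
        proof (cases j)
          case 0
          have h0: "hlog r 0 0 = hlog 0 0 0" for r by (rule ext) simp
          show ?thesis using main[of 0 0 0] assms 0 h0[of "- \<alpha>"] by simp
        qed (use main[of "real j - \<alpha>" 0 b] in auto)
        then show "(qd (hlog (real j - \<alpha>) b 0) \<longlongrightarrow> 0) (at_left 1)" "((\<lambda>x. u x *\<^sub>R qd (hlog (real j - \<alpha>) b 0) x) \<longlongrightarrow> 0) (at_left 1)" by auto
      qed
      have e: "prof j a b = (\<lambda>x. 1 * hlog (real j) a 0 x + 1 * hlog (real j - \<alpha>) b 0 x)"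
        using False by (auto simp: prof_def fun_eq_iff)
      have ev: "\<forall>\<^sub>F x in at_left 1. qd (hlog (real j) a 0) x + qd (hlog (real j - \<alpha>) b 0) x = qd (prof j a b) x"
        using eventually_at_left_1_unit_ivl
      proof (rule eventually_mono)
        fix x :: real assume "x \<in> unit_ivl"
        then have "x < 1" by simp
        then show "qd (hlog (real j) a 0) x + qd (hlog (real j - \<alpha>) b 0) x = qd (prof j a b) x"
          unfolding e by (subst qder_lincomb) (auto intro: differentiableI_vector[OF hlog_deriv])
      qed
      have "(qd (prof j a b) \<longlongrightarrow> 0 + 0) (at_left 1)"
        by (rule Lim_transform_eventually[OF tendsto_add[OF m(1) m'(1)] ev])
      moreover have "((\<lambda>x. u x *\<^sub>R qd (prof j a b) x) \<longlongrightarrow> 0 + 0) (at_left 1)"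
        by (rule Lim_transform_eventually[OF tendsto_add[OF m(2) m'(2)]])
          (use ev in \<open>auto elim!: eventually_mono simp flip: scaleR_add_right\<close>)
      ultimately show ?thesis by simp
    qed
    then show "(qd (prof j a b) \<longlongrightarrow> 0) (at_left 1)" "((\<lambda>x. u x *\<^sub>R qd (prof j a b) x) \<longlongrightarrow> 0) (at_left 1)" by auto
  qed
qed

text \<open>The exponent of p cancels the singularity of the derivative of the second profile. The
  limit factor K is 2^(\<beta> + 1) \<alpha>, or -2^(\<beta> + 1) in the logarithmic case.\<close>

lemma qd_prof_0:
  "\<exists>K\<noteq>0. (qd (prof 0 a b) \<longlongrightarrow> K * b) (at_left 1)"
proof -
  have lim1: "((\<lambda>x. complex_of_real ((1 + x) powr (\<beta> + 1))) \<longlongrightarrow> of_real ((1 + 1) powr (\<beta> + 1))) (at_left 1)"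
    by (intro tendsto_of_real tendsto_powr tendsto_add tendsto_const tendsto_ident_at) auto
  have ev1: "\<forall>\<^sub>F x::real in at_left 1. x < 1" by (auto intro: eventually_at_leftI[of 0])
  show ?thesis
  proof (cases "\<alpha> = 0")
    case True
    have "\<forall>\<^sub>F x in at_left 1. complex_of_real ((1 + x) powr (\<beta> + 1)) * (- b) = qd (prof 0 a b) x"
      using eventually_at_left_1_unit_ivl
    proof (rule eventually_mono)
      fix x assume x: "x \<in> unit_ivl"
      then show "complex_of_real ((1 + x) powr (\<beta> + 1)) * (- b) = qd (prof 0 a b) x"
        unfolding prof_alpha_0[OF True] by (subst qd_hlog[OF x]) (simp add: True hlog_def)
    qed
    then have "(qd (prof 0 a b) \<longlongrightarrow> of_real ((1 + 1) powr (\<beta> + 1)) * (- b)) (at_left 1)"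
      using Lim_transform_eventually[OF tendsto_mult[OF lim1 tendsto_const[of "- b"]]] by blast
    then show ?thesis by (intro exI[of _ "- of_real ((1 + 1) powr (\<beta> + 1))"]) simp
  next
    case False
    have e: "prof 0 a b = (\<lambda>x. 1 * hlog 0 a 0 x + 1 * hlog (- \<alpha>) b 0 x)"
      using False by (auto simp: prof_def fun_eq_iff)
    have "\<forall>\<^sub>F x in at_left 1. complex_of_real ((1 + x) powr (\<beta> + 1)) * (of_real \<alpha> * b) = qd (prof 0 a b) x"
      using eventually_at_left_1_unit_ivl
    proof (rule eventually_mono)
      fix x assume x: "x \<in> unit_ivl"
      then have x1: "x < 1" by simp
      have "qd (prof 0 a b) x = 1 * qd (hlog 0 a 0) x + 1 * qd (hlog (- \<alpha>) b 0) x"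
        unfolding e by (intro qder_lincomb differentiableI_vector[OF hlog_deriv] x1)
      also have "\<dots> = complex_of_real ((1 + x) powr (\<beta> + 1)) * (of_real \<alpha> * b)"
        using x1 by (simp add: qd_hlog[OF x] hlog_def)
      finally show "complex_of_real ((1 + x) powr (\<beta> + 1)) * (of_real \<alpha> * b) = qd (prof 0 a b) x" by simp
    qed
    then have "(qd (prof 0 a b) \<longlongrightarrow> of_real ((1 + 1) powr (\<beta> + 1)) * (of_real \<alpha> * b)) (at_left 1)"
      using Lim_transform_eventually[OF tendsto_mult[OF lim1 tendsto_const[of "of_real \<alpha> * b"]]] by blast
    then show ?thesis using False by (intro exI[of _ "of_real ((1 + 1) powr (\<beta> + 1)) * of_real \<alpha>"]) (simp add: mult.assoc)
  qed
qed

lemma prof_tendsto: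
  assumes "j = 0 \<Longrightarrow> b = 0"
  shows "(prof j a b \<longlongrightarrow> (if j = 0 then a else 0)) (at_left 1)"
proof (cases "j = 0")
  case True
  have "\<forall>\<^sub>F x::real in at_left 1. x < 1" by (auto intro: eventually_at_leftI[of 0])
  then have "\<forall>\<^sub>F x in at_left 1. a = prof j a b x"
    by (rule eventually_mono) (use True assms in \<open>simp add: prof_eq\<close>)
  then show ?thesis using True Lim_transform_eventually[OF tendsto_const] by auto
next
  case False
  have "(prof j a b \<longlongrightarrow> 0) (at_left 1)"
  proof (cases "\<alpha> = 0")
    case True
    show ?thesis unfolding prof_alpha_0[OF True] using False by (intro hlog_tendsto_0) simp
  next
    case nz: False
    have "real j - \<alpha> > 0" using False \<alpha> by (cases j) auto
    then have "((\<lambda>x. hlog (real j) a 0 x + hlog (real j - \<alpha>) b 0 x) \<longlongrightarrow> 0 + 0) (at_left 1)"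
      using False by (intro tendsto_add hlog_tendsto_0) auto
    then show ?thesis using nz by (simp add: prof_def[abs_def])
  qed
  then show ?thesis using False by simp
qed

lemma qd_tsum:
  assumes x: "x \<in> unit_ivl"
  shows "qd (tsum N A B) x = (\<Sum>j<N. qd (prof j (A j) (B j)) x)"
proof -
  have d: "prof j (A j) (B j) differentiable (at x)" for j
    using prof_reg[of "Suc 0"] x by simp
  have "rderiv (tsum N A B) x = (\<Sum>j<N. rderiv (prof j (A j) (B j)) x)"
    unfolding tsum_def[abs_def] by (intro rderiv_eq has_vector_derivative_sum rderiv_works d)
  then show ?thesis by (simp add: qder_def scaleR_sum_right)
qed

text \<open>The quasi-derivative detects only \<open>B 0\<close>. Once that is 0, u times the
  quasi-derivative tends to 0, so \<open>aco\<close> has the same limit as the sum itself, namely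
  \<open>A 0\<close>.\<close>

lemma tsum_boundary_zero:
  assumes N: "N \<ge> 1" and q: "(qd (tsum N A B) \<longlongrightarrow> 0) (at_left 1)" and a: "(aco (tsum N A B) \<longlongrightarrow> 0) (at_left 1)"
  shows "A 0 = 0 \<and> B 0 = 0"
proof -
  obtain M where M: "N = Suc M" using N by (cases N) auto
  obtain K where K: "K \<noteq> 0" "(qd (prof 0 (A 0) (B 0)) \<longlongrightarrow> K * B 0) (at_left 1)" using qd_prof_0 by blast
  have ev: "\<forall>\<^sub>F x in at_left 1. (\<Sum>j<N. qd (prof j (A j) (B j)) x) = qd (tsum N A B) x"
    using eventually_at_left_1_unit_ivl by (rule eventually_mono) (simp add: qd_tsum)
  have "((\<lambda>x. qd (prof 0 (A 0) (B 0)) x + (\<Sum>j<M. qd (prof (Suc j) (A (Suc j)) (B (Suc j))) x)) \<longlongrightarrow> K * B 0 + (\<Sum>j<M. 0)) (at_left 1)"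
    by (intro tendsto_add K tendsto_sum qd_prof_tendsto_0) simp
  then have "((\<lambda>x. \<Sum>j<N. qd (prof j (A j) (B j)) x) \<longlongrightarrow> K * B 0) (at_left 1)"
    unfolding M sum.lessThan_Suc_shift by simp
  then have "(qd (tsum N A B) \<longlongrightarrow> K * B 0) (at_left 1)" using ev by (rule Lim_transform_eventually)
  then have B0: "B 0 = 0" using q K tendsto_unique[OF trivial_limit_at_left_real] by fastforce
  have c: "j = 0 \<Longrightarrow> B j = 0" for j using B0 by simp
  have "((\<lambda>x. \<Sum>j<N. u x *\<^sub>R qd (prof j (A j) (B j)) x) \<longlongrightarrow> (\<Sum>j<N. 0)) (at_left 1)"
    by (intro tendsto_sum qd_prof_tendsto_0 c)
  then have "((\<lambda>x. u x *\<^sub>R (\<Sum>j<N. qd (prof j (A j) (B j)) x)) \<longlongrightarrow> 0) (at_left 1)"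
    by (simp add: scaleR_sum_right)
  moreover have "\<forall>\<^sub>F x in at_left 1. u x *\<^sub>R (\<Sum>j<N. qd (prof j (A j) (B j)) x) = u x *\<^sub>R qd (tsum N A B) x"
    using ev by (rule eventually_mono) simp
  ultimately have "((\<lambda>x. u x *\<^sub>R qd (tsum N A B) x) \<longlongrightarrow> 0) (at_left 1)"
    by (rule Lim_transform_eventually)
  from tendsto_add[OF a this] have t0: "(tsum N A B \<longlongrightarrow> 0) (at_left 1)"
    by (simp add: aco_def[abs_def])
  have "(tsum N A B \<longlongrightarrow> (\<Sum>j<N. if j = 0 then A j else 0)) (at_left 1)"
    unfolding tsum_def[abs_def] by (intro tendsto_sum prof_tendsto c)
  then have "(tsum N A B \<longlongrightarrow> A 0) (at_left 1)" using N by (simp add: sum.delta)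
  then have "A 0 = 0" using t0 tendsto_unique[OF trivial_limit_at_left_real] by blast
  then show ?thesis using B0 by simp
qed

section \<open>Transfer to functions that agree with a sum of profiles near 1\<close>

lemma rderiv_cong_eventually:
  assumes "\<forall>\<^sub>F y in nhds x. f y = g y"
  shows "rderiv f x = rderiv g x"
  unfolding rderiv_def using assms by (intro vector_derivative_cong_eq) (auto elim: eventually_mono)

lemma eventually_at_left_1_open:
  "(\<forall>\<^sub>F x in at_left 1. P x) \<longleftrightarrow> (\<exists>b<1. \<forall>x. b < x \<and> x < 1 \<longrightarrow> P x)" for P :: "real \<Rightarrow> bool"
  using eventually_at_left[of 0 1 P] by auto

lemma local_eq_propagates:
  assumes "\<forall>\<^sub>F x in at_left 1. f x = g x"
  shows "\<forall>\<^sub>F x in at_left 1. rderiv f x = rderiv g x"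
proof -
  obtain b where b: "b < 1" "\<And>x. b < x \<Longrightarrow> x < 1 \<Longrightarrow> f x = g x"
    using assms unfolding eventually_at_left_1_open by blast
  have "rderiv f x = rderiv g x" if x: "b < x" "x < 1" for x
  proof (rule rderiv_cong_eventually)
    have "\<forall>\<^sub>F y in nhds x. y \<in> {b<..<1}" using x by (intro eventually_nhds_in_open) auto
    then show "\<forall>\<^sub>F y in nhds x. f y = g y" by (rule eventually_mono) (use b in auto)
  qed
  then show ?thesis unfolding eventually_at_left_1_open using b(1) by blast
qed

lemma local_eq_qd:
  assumes "\<forall>\<^sub>F x in at_left 1. f x = g x"
  shows "\<forall>\<^sub>F x in at_left 1. qd f x = qd g x"
  using local_eq_propagates[OF assms] by (rule eventually_mono) (simp add: qder_def)

lemma local_eq_pow: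
  assumes "\<forall>\<^sub>F x in at_left 1. f x = g x"
  shows "\<forall>\<^sub>F x in at_left 1. pow k f x = pow k g x"
proof (induction k)
  case (Suc k)
  from local_eq_propagates[OF local_eq_qd[OF Suc]] show ?case
    by (rule eventually_mono) (simp add: jacobi_expr_qder)
qed (simp add: assms)

lemma local_eq_aco:
  assumes "\<forall>\<^sub>F x in at_left 1. f x = g x"
  shows "\<forall>\<^sub>F x in at_left 1. aco f x = aco g x"
  using assms local_eq_qd[OF assms] by eventually_elim (simp add: aco_def)

lemma local_pow_tsum:
  assumes f: "\<forall>\<^sub>F x in at_left 1. f x = tsum N A B x" and supp: "\<And>j. j \<ge> N \<Longrightarrow> A j = 0 \<and> B j = 0"
  shows "\<forall>\<^sub>F x in at_left 1. pow k f x = tsum N (fst (opn k (A, B))) (snd (opn k (A, B))) x"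
  using local_eq_pow[OF f, of k] eventually_at_left_1_unit_ivl
  by eventually_elim (simp add: pow_tsum[OF _ supp])

lemma profile_coefficients_zero:
  assumes f: "\<forall>\<^sub>F x in at_left 1. f x = tsum N A B x" and supp: "\<And>j. j \<ge> N \<Longrightarrow> A j = 0 \<and> B j = 0"
    and q: "\<And>k. k < N \<Longrightarrow> (qd (pow k f) \<longlongrightarrow> 0) (at_left 1)"
    and a: "\<And>k. k < N \<Longrightarrow> (aco (pow k f) \<longlongrightarrow> 0) (at_left 1)"
    and j: "j < N"
  shows "A j = 0 \<and> B j = 0"
proof (rule opn_vanishing[OF _ j])
  fix k assume k: "k < N"
  have e: "\<forall>\<^sub>F x in at_left 1. pow k f x = tsum N (fst (opn k (A, B))) (snd (opn k (A, B))) x"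
    by (rule local_pow_tsum[OF f supp])
  show "fst (opn k (A, B)) 0 = 0 \<and> snd (opn k (A, B)) 0 = 0"
  proof (rule tsum_boundary_zero)
    show "1 \<le> N" using k by simp
    show "(qd (tsum N (fst (opn k (A, B))) (snd (opn k (A, B)))) \<longlongrightarrow> 0) (at_left 1)"
      using q[OF k] local_eq_qd[OF e] by (rule Lim_transform_eventually)
    show "(aco (tsum N (fst (opn k (A, B))) (snd (opn k (A, B)))) \<longlongrightarrow> 0) (at_left 1)"
      using a[OF k] local_eq_aco[OF e] by (rule Lim_transform_eventually)
  qed
qed

text \<open>The most singular profile is (1 - x)^(-\<alpha>), or the logarithm if \<alpha> = 0; a
  power above \<alpha> damps it.\<close>

lemma tsum_weighted_limit:
  assumes g: "g > \<alpha>"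
  shows "((\<lambda>x. of_real ((1 - x) powr g) * tsum N A B x) \<longlongrightarrow> 0) (at_left 1)"
proof -
  have "((\<lambda>x. of_real ((1 - x) powr g) * prof j a b x) \<longlongrightarrow> 0) (at_left 1)" for j a b
  proof (cases "\<alpha> = 0")
    case True
    show ?thesis
      unfolding prof_alpha_0[OF True] hlog_powr_mult using g True by (intro hlog_tendsto_0) simp
  next
    case False
    have "((\<lambda>x. hlog (g + real j) a 0 x + hlog (g + (real j - \<alpha>)) b 0 x) \<longlongrightarrow> 0 + 0) (at_left 1)"
      using g \<alpha> by (intro tendsto_add hlog_tendsto_0) auto
    then show ?thesis using False by (simp add: prof_def distrib_left hlog_powr_mult)
  qed
  then have "((\<lambda>x. \<Sum>j<N. of_real ((1 - x) powr g) * prof j (A j) (B j) x) \<longlongrightarrow> (\<Sum>j<N. 0)) (at_left 1)"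
    by (intro tendsto_sum)
  then show ?thesis by (simp add: tsum_def sum_distrib_left)
qed

end

section \<open>Reflection of the interval\<close>

lemma at_right_m1: "at_right (-1::real) = filtermap uminus (at_left 1)"
  using at_right_minus[of "-1::real"] by simp

lemma has_vector_derivative_reflect:
  assumes "(f has_vector_derivative D) (at (- x))"
  shows "((\<lambda>x::real. f (- x)) has_vector_derivative - D) (at x)"
proof -
  have "(uminus has_vector_derivative (-1::real)) (at x)"
    by (auto intro!: derivative_eq_intros simp flip: has_real_derivative_iff_has_vector_derivative)
  from vector_diff_chain_at[OF this assms] show ?thesis by (simp add: o_def)
qed

lemma rderiv_reflect:
  "f differentiable (at (- x)) \<Longrightarrow> rderiv (\<lambda>x. f (- x)) x = - rderiv f (- x)"
  by (intro rderiv_eq has_vector_derivative_reflect rderiv_works)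

lemma jacobi_p_reflect: "jacobi_p \<beta> \<alpha> x = jacobi_p \<alpha> \<beta> (- x)"
  by (simp add: jacobi_p_def mult.commute)

lemma jacobi_weight_reflect: "jacobi_weight \<beta> \<alpha> x = jacobi_weight \<alpha> \<beta> (- x)"
  by (simp add: jacobi_weight_def mult.commute)

lemma qder_reflect:
  "f differentiable (at (- x)) \<Longrightarrow> qder \<beta> \<alpha> (\<lambda>x. f (- x)) x = - qder \<alpha> \<beta> f (- x)"
  unfolding qder_def by (subst jacobi_p_reflect) (simp add: rderiv_reflect)

text \<open>Each of the two derivatives contributes a sign and the signs cancel, while p and w
  exchange their exponents.\<close>

lemma jacobi_expr_reflect:
  assumes f: "reg 2 f" and x: "x \<in> unit_ivl"
  shows "jacobi_expr \<beta> \<alpha> (\<lambda>x. f (- x)) x = jacobi_expr \<alpha> \<beta> f (- x)"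
proof -
  have d: "f differentiable (at (- y))" if "y \<in> unit_ivl" for y using f that by (simp add: numeral_2_eq_2)
  have mx: "- x \<in> unit_ivl" using x by auto
  have "rderiv (qder \<beta> \<alpha> (\<lambda>x. f (- x))) x = rderiv (\<lambda>x. - qder \<alpha> \<beta> f (- x)) x"
    using x by (intro rderiv_cong qder_reflect d)
  also have "\<dots> = - (- rderiv (qder \<alpha> \<beta> f) (- x))"
    by (intro rderiv_eq has_vector_derivative_minus has_vector_derivative_reflect rderiv_works qder_differentiable f mx)
  finally show ?thesis by (simp add: jacobi_expr_qder jacobi_weight_reflect[of \<beta> \<alpha> x])
qed

lemma jacobi_pow_reflect:
  assumes f: "smooth_on_ivl f" and x: "x \<in> unit_ivl"
  shows "jacobi_pow \<beta> \<alpha> k (\<lambda>x. f (- x)) x = jacobi_pow \<alpha> \<beta> k f (- x)"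
  using x
proof (induction k arbitrary: x)
  case (Suc k)
  have "jacobi_pow \<beta> \<alpha> (Suc k) (\<lambda>x. f (- x)) x = jacobi_expr \<beta> \<alpha> (\<lambda>x. jacobi_pow \<alpha> \<beta> k f (- x)) x"
    using Suc by (auto intro: jacobi_expr_cong)
  also have "\<dots> = jacobi_expr \<alpha> \<beta> (jacobi_pow \<alpha> \<beta> k f) (- x)"
    using smooth_jacobi_pow[OF f] Suc.prems by (intro jacobi_expr_reflect) (auto simp: smooth_on_ivl_iff_reg)
  finally show ?case by simp
qed simp

context jacobi
begin

lemma reflected: "jacobi \<beta> \<alpha> (\<lambda>x. - u (- x))"
proof unfold_locales
  show "second_solution \<beta> \<alpha> (\<lambda>x. - u (- x))"
    unfolding second_solution_def
  proof
    fix x :: real assume "x \<in> unit_ivl"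
    then have "(u has_vector_derivative 1 / p (- x)) (at (- x))"
      using u by (auto simp: second_solution_def has_real_derivative_iff_has_vector_derivative)
    then have "((\<lambda>x. - u (- x)) has_vector_derivative - (- (1 / p (- x)))) (at x)"
      by (intro has_vector_derivative_minus has_vector_derivative_reflect)
    then show "((\<lambda>x. - u (- x)) has_real_derivative 1 / jacobi_p \<beta> \<alpha> x) (at x)"
      unfolding has_real_derivative_iff_has_vector_derivative jacobi_p_reflect[of \<beta> \<alpha> x] by simp
  qed
qed (use \<alpha> \<beta> in auto)

text \<open>The two limits make (1 - x)^g (1 + x)^h G continuous up to the ends and hence bounded.
  What is left is the weight times (1 - x)^(-2 g) (1 + x)^(-2 h), integrable by the bounds on g and
  h.\<close>

lemma L2_weighted:
  assumes G: "continuous_on unit_ivl G" and g: "2 * g < 1 + \<alpha>" and h: "2 * h < 1 + \<beta>"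
    and l1: "((\<lambda>x. of_real ((1 - x) powr g) * G x) \<longlongrightarrow> 0) (at_left 1)"
    and l2: "((\<lambda>x. of_real ((1 + x) powr h) * G x) \<longlongrightarrow> 0) (at_right (-1))"
  shows "L2 G"
proof -
  define K where "K x = of_real ((1 + x) powr h) * (of_real ((1 - x) powr g) * G x)" for x
  define K' where "K' x = (if x \<in> unit_ivl then K x else 0)" for x
  have Kc: "continuous_on unit_ivl K"
    unfolding K_def by (intro continuous_intros G) auto
  have "(K \<longlongrightarrow> of_real ((1 + 1) powr h) * 0) (at_left 1)"
    unfolding K_def by (intro tendsto_mult tendsto_of_real tendsto_powr tendsto_add tendsto_const tendsto_ident_at l1) auto
  then have K1: "(K \<longlongrightarrow> 0) (at_left 1)" by simp
  have "((\<lambda>x. of_real ((1 - x) powr g) * (of_real ((1 + x) powr h) * G x)) \<longlongrightarrow> of_real ((1 - (-1)) powr g) * 0) (at_right (-1))"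
    by (intro tendsto_mult tendsto_of_real tendsto_powr tendsto_diff tendsto_const tendsto_ident_at l2) auto
  then have K2: "(K \<longlongrightarrow> 0) (at_right (-1))" by (simp add: K_def[abs_def] mult.left_commute)
  have e1: "\<forall>\<^sub>F x in at_left 1. K x = K' x"
    using eventually_at_left_1_unit_ivl by (rule eventually_mono) (simp add: K'_def)
  have e2: "\<forall>\<^sub>F x in at_right (-1). K x = K' x"
  proof -
    have "\<forall>\<^sub>F x in at_right (-1). x \<in> unit_ivl" using eventually_at_right_real[of "-1" 1] by auto
    then show ?thesis by (rule eventually_mono) (simp add: K'_def)
  qed
  have K'_end: "K' 1 = 0" "K' (-1) = 0" by (simp_all add: K'_def)
  have "continuous_on {-1..1} K'"
  proof (rule continuous_on_IccI)
    show "(K' \<longlongrightarrow> K' (-1)) (at_right (-1))" unfolding K'_end using K2 e2 by (rule Lim_transform_eventually)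
    show "(K' \<longlongrightarrow> K' 1) (at_left 1)" unfolding K'_end using K1 e1 by (rule Lim_transform_eventually)
    fix x :: real assume x: "-1 < x" "x < 1"
    then have "(K \<longlongrightarrow> K x) (at x)" using Kc by (simp add: continuous_on_eq_continuous_at isCont_def)
    moreover have "\<forall>\<^sub>F y in at x. K y = K' y"
      using eventually_at_in_open'[of unit_ivl x] x by (auto elim!: eventually_mono simp: K'_def)
    ultimately have "(K' \<longlongrightarrow> K x) (at x)" by (rule Lim_transform_eventually)
    then show "(K' \<longlongrightarrow> K' x) (at x)" using x by (simp add: K'_def)
  qed simp
  then have "bounded (K' ` {-1..1})" by (intro compact_imp_bounded compact_continuous_image) auto
  then obtain C where C: "\<forall>x\<in>{-1..1}. norm (K' x) \<le> C" by (auto simp: bounded_iff)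
  show ?thesis
  proof (rule square_integrable_dominated[where h = "\<lambda>x. C\<^sup>2 * ((1 - x) powr (- 2 * g) * (1 + x) powr (- 2 * h))"])
    show "G \<in> borel_measurable (lebesgue_on unit_ivl)" by (rule continuous_measurable_unit_ivl[OF G])
    have "(\<lambda>x. C\<^sup>2 * ((1 - x) powr (\<alpha> - 2 * g) * (1 + x) powr (\<beta> - 2 * h))) absolutely_integrable_on unit_ivl"
      using g h by (intro set_integrable_mult_right powr_product_integrable) auto
    moreover have "C\<^sup>2 * ((1 - x) powr (\<alpha> - 2 * g) * (1 + x) powr (\<beta> - 2 * h)) =
        w x * (C\<^sup>2 * ((1 - x) powr (- 2 * g) * (1 + x) powr (- 2 * h)))" for x
      using powr_add[of "1 - x" \<alpha> "- 2 * g"] powr_add[of "1 + x" \<beta> "- 2 * h"] by (simp add: jacobi_weight_def)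
    ultimately show "(\<lambda>x. w x * (C\<^sup>2 * ((1 - x) powr (- 2 * g) * (1 + x) powr (- 2 * h)))) absolutely_integrable_on unit_ivl"
      by simp
    fix x assume x: "x \<in> unit_ivl"
    have K: "norm (K x) \<le> C" using C[rule_format, of x] x by (simp add: K'_def)
    have "(1 - x) powr (- g) * (1 + x) powr (- h) * norm (K x) = norm (G x)"
      using x by (simp add: K_def norm_mult powr_minus field_simps)
    then have "norm (G x) \<le> (1 - x) powr (- g) * (1 + x) powr (- h) * C"
      using mult_left_mono[OF K, of "(1 - x) powr (- g) * (1 + x) powr (- h)"] by simp
    then have "(norm (G x))\<^sup>2 \<le> ((1 - x) powr (- g) * (1 + x) powr (- h) * C)\<^sup>2" by (intro power_mono) auto
    also have "\<dots> = C\<^sup>2 * ((1 - x) powr (- 2 * g) * (1 + x) powr (- 2 * h))"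
      using powr_add[of "1 - x" "-g" "-g"] powr_add[of "1 + x" "-h" "-h"] by (simp add: power2_eq_square)
    finally show "(norm (G x))\<^sup>2 \<le> C\<^sup>2 * ((1 - x) powr (- 2 * g) * (1 + x) powr (- 2 * h))" .
  qed
qed

end

context jacobi_power
begin

lemma profile_in_V:
  assumes f: "smooth_on_ivl f" and out: "\<And>x. x \<notin> unit_ivl \<Longrightarrow> f x = 0"
    and r1: "\<forall>\<^sub>F x in at_left 1. f x = tsum n A B x" and s1: "\<And>j. j \<ge> n \<Longrightarrow> A j = 0 \<and> B j = 0"
    and r2: "\<forall>\<^sub>F x in at_left 1. f (- x) = jacobi.tsum \<beta> n A' B' x" and s2: "\<And>j. j \<ge> n \<Longrightarrow> A' j = 0 \<and> B' j = 0"
  shows "f \<in> V"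
proof -
  interpret R: jacobi \<beta> \<alpha> "\<lambda>x. - u (- x)" by (rule reflected)
  \<comment> \<open>g lies strictly between \<alpha> and (1 + \<alpha>) / 2: large enough to damp
    the profiles, small enough for \<open>L2_weighted\<close>; likewise h.\<close>
  define g h where "g = (1 + 3 * \<alpha>) / 4" and "h = (1 + 3 * \<beta>) / 4"
  have gh: "\<alpha> < g" "\<beta> < h" "2 * g < 1 + \<alpha>" "2 * h < 1 + \<beta>" using \<alpha> \<beta> by (simp_all add: g_def h_def)
  have reg: "reg m (pow n f)" for m using smooth_jacobi_pow[OF f] by (simp add: smooth_on_ivl_iff_reg)
  have l1: "\<forall>\<^sub>F x in at_left 1. pow n f x = tsum n (fst (opn n (A, B))) (snd (opn n (A, B))) x"
    by (rule local_pow_tsum[OF r1 s1])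
  have l2: "\<forall>\<^sub>F x in at_left 1. R.pow n (\<lambda>x. f (- x)) x = R.tsum n (fst (R.opn n (A', B'))) (snd (R.opn n (A', B'))) x"
    by (rule R.local_pow_tsum[OF r2 s2])
  have "L2 (pow n f)"
  proof (rule L2_weighted[OF _ gh(3,4)])
    show "continuous_on unit_ivl (pow n f)" using AC_loc_continuous_on reg_AC_loc[OF reg] by blast
    have "\<forall>\<^sub>F x in at_left 1. of_real ((1 - x) powr g) * tsum n (fst (opn n (A, B))) (snd (opn n (A, B))) x
        = of_real ((1 - x) powr g) * pow n f x"
      using l1 by (rule eventually_mono) (simp only:)
    then show "((\<lambda>x. of_real ((1 - x) powr g) * pow n f x) \<longlongrightarrow> 0) (at_left 1)"
      by (rule Lim_transform_eventually[OF tsum_weighted_limit[OF gh(1)]])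
    have "\<forall>\<^sub>F x in at_left 1. of_real ((1 - x) powr h) * R.tsum n (fst (R.opn n (A', B'))) (snd (R.opn n (A', B'))) x
        = of_real ((1 - x) powr h) * pow n f (- x)"
      using l2 eventually_at_left_1_unit_ivl
      by eventually_elim (simp add: jacobi_pow_reflect[OF f, where \<alpha> = \<alpha> and \<beta> = \<beta>])
    then have "((\<lambda>x. of_real ((1 - x) powr h) * pow n f (- x)) \<longlongrightarrow> 0) (at_left 1)"
      by (rule Lim_transform_eventually[OF R.tsum_weighted_limit[OF gh(2)]])
    then show "((\<lambda>x. of_real ((1 + x) powr h) * pow n f x) \<longlongrightarrow> 0) (at_right (-1))"
      unfolding at_right_m1 filterlim_filtermap by simp
  qed
  then show ?thesis using out smooth_reg[OF f] by (simp add: D_max_iff)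
qed

lemma profile_bd_kernel:
  assumes K: "f \<in> bd_kernel" and f: "smooth_on_ivl f"
    and r1: "\<forall>\<^sub>F x in at_left 1. f x = tsum n A B x" and s1: "\<And>j. j \<ge> n \<Longrightarrow> A j = 0 \<and> B j = 0"
    and r2: "\<forall>\<^sub>F x in at_left 1. f (- x) = jacobi.tsum \<beta> n A' B' x" and s2: "\<And>j. j \<ge> n \<Longrightarrow> A' j = 0 \<and> B' j = 0"
    and j: "j < n"
  shows "A j = 0 \<and> B j = 0" "A' j = 0 \<and> B' j = 0"
proof -
  interpret R: jacobi \<beta> \<alpha> "\<lambda>x. - u (- x)" by (rule reflected)
  have lim: "(qd (pow k f) \<longlongrightarrow> 0) (endpoint e)" "(aco (pow k f) \<longlongrightarrow> 0) (endpoint e)" if "k < n" for k e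
    using bfun_tendsto[of f k True e] bfun_tendsto[of f k False e] K that by (simp_all add: bd_kernel_def bfun_def)
  show "A j = 0 \<and> B j = 0"
    by (rule profile_coefficients_zero[OF r1 s1 _ _ j]) (use lim[of _ True] in simp_all)
  show "A' j = 0 \<and> B' j = 0"
  proof (rule R.profile_coefficients_zero[OF r2 s2 _ _ j])
    fix k assume k: "k < n"
    have d: "pow k f differentiable (at (- x))" if "x \<in> unit_ivl" for x
      using smooth_reg[OF smooth_jacobi_pow[OF f, where \<alpha> = \<alpha> and \<beta> = \<beta> and k = k], of "Suc 0"] that by simp
    have e: "R.qd (R.pow k (\<lambda>x. f (- x))) x = - qd (pow k f) (- x)" if x: "x \<in> unit_ivl" for x
    proof -
      have "R.qd (R.pow k (\<lambda>x. f (- x))) x = R.qd (\<lambda>x. pow k f (- x)) x"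
        using rderiv_cong[OF jacobi_pow_reflect[OF f] x] by (simp add: qder_def)
      then show ?thesis using qder_reflect[OF d[OF x], where \<alpha> = \<alpha> and \<beta> = \<beta>] by simp
    qed
    \<comment> \<open>Reflection changes the sign of both u and the quasi-derivative, so this
      coefficient is invariant.\<close>
    have e': "R.aco (R.pow k (\<lambda>x. f (- x))) x = aco (pow k f) (- x)" if x: "x \<in> unit_ivl" for x
      using e[OF x] jacobi_pow_reflect[OF f x, where \<alpha> = \<alpha> and \<beta> = \<beta> and k = k] by (simp add: R.aco_def aco_def)
    have q: "((\<lambda>x. - qd (pow k f) (- x)) \<longlongrightarrow> 0) (at_left 1)" and a: "((\<lambda>x. aco (pow k f) (- x)) \<longlongrightarrow> 0) (at_left 1)"
      using lim[OF k, of False] tendsto_minus[of "\<lambda>x. qd (pow k f) (- x)" 0]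
      by (simp_all add: at_right_m1 filterlim_filtermap)
    show "(R.qd (R.pow k (\<lambda>x. f (- x))) \<longlongrightarrow> 0) (at_left 1)"
      by (rule Lim_transform_eventually[OF q]) (use eventually_at_left_1_unit_ivl in \<open>rule eventually_mono\<close>, simp add: e)
    show "(R.aco (R.pow k (\<lambda>x. f (- x))) \<longlongrightarrow> 0) (at_left 1)"
      by (rule Lim_transform_eventually[OF a]) (use eventually_at_left_1_unit_ivl in \<open>rule eventually_mono\<close>, simp add: e')
  qed
qed

end

section \<open>The defect spaces and the endpoint spaces\<close>

lemma endpoint_space_eq:
  "endpoint_space n \<phi> \<psi> = {(\<lambda>x. \<Sum>j<n. a j * \<phi> j x + b j * \<psi> j x) |a b. True}" (is "_ = ?T")
proof -
  interpret cm: module "\<lambda>(c::complex) (f::real \<Rightarrow> complex) x. c * f x"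
    by unfold_locales (auto simp: fun_eq_iff algebra_simps)
  have span: "cspan = cm.span" by (simp add: cspan_def)
  have "?T \<subseteq> cm.span (\<phi> ` {..<n} \<union> \<psi> ` {..<n})"
  proof clarify
    fix a b
    have "(\<Sum>j<n. (\<lambda>x. a j * \<phi> j x) + (\<lambda>x. b j * \<psi> j x)) \<in> cm.span (\<phi> ` {..<n} \<union> \<psi> ` {..<n})"
      by (intro cm.span_sum cm.span_add cm.span_scale cm.span_base) auto
    moreover have "(\<Sum>j<n. (\<lambda>x. a j * \<phi> j x) + (\<lambda>x. b j * \<psi> j x)) = (\<lambda>x. \<Sum>j<n. a j * \<phi> j x + b j * \<psi> j x)"
      by (rule ext) (induction n, auto)
    ultimately show "(\<lambda>x. \<Sum>j<n. a j * \<phi> j x + b j * \<psi> j x) \<in> cm.span (\<phi> ` {..<n} \<union> \<psi> ` {..<n})" by simp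
  qed
  moreover have "cm.span (\<phi> ` {..<n} \<union> \<psi> ` {..<n}) \<subseteq> ?T"
  proof (rule cm.span_minimal)
    show "\<phi> ` {..<n} \<union> \<psi> ` {..<n} \<subseteq> ?T"
    proof
      fix f assume "f \<in> \<phi> ` {..<n} \<union> \<psi> ` {..<n}"
      then consider i where "i < n" "f = \<phi> i" | i where "i < n" "f = \<psi> i" by auto
      then show "f \<in> ?T"
      proof cases
        case 1
        have "(\<lambda>x. \<Sum>j<n. of_bool (j = i) * \<phi> j x + 0 * \<psi> j x) = f"
          using 1 by (simp add: fun_eq_iff of_bool_def if_distrib[of "\<lambda>c. c * _"] sum.delta cong: if_cong)
        then show ?thesis by (intro CollectI exI[of _ "\<lambda>j. of_bool (j = i)"] exI[of _ "\<lambda>_. 0"]) simp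
      next
        case 2
        have "(\<lambda>x. \<Sum>j<n. 0 * \<phi> j x + of_bool (j = i) * \<psi> j x) = f"
          using 2 by (simp add: fun_eq_iff of_bool_def if_distrib[of "\<lambda>c. c * _"] sum.delta cong: if_cong)
        then show ?thesis by (intro CollectI exI[of _ "\<lambda>_. 0"] exI[of _ "\<lambda>j. of_bool (j = i)"]) simp
      qed
    qed
    show "cm.subspace ?T"
    proof (rule cm.subspaceI)
      show "0 \<in> ?T" by (intro CollectI exI[of _ "\<lambda>_. 0"]) (simp add: zero_fun_def)
      show "f + g \<in> ?T" if fg: "f \<in> ?T" "g \<in> ?T" for f g
      proof -
        obtain a b where "f = (\<lambda>x. \<Sum>j<n. a j * \<phi> j x + b j * \<psi> j x)" using fg(1) by blast
        moreover obtain a' b' where "g = (\<lambda>x. \<Sum>j<n. a' j * \<phi> j x + b' j * \<psi> j x)" using fg(2) by blast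
        ultimately show ?thesis
          by (intro CollectI exI[of _ "\<lambda>j. a j + a' j"] exI[of _ "\<lambda>j. b j + b' j"])
            (simp add: fun_eq_iff sum.distrib[symmetric] algebra_simps)
      qed
      show "(\<lambda>x. c * f x) \<in> ?T" if fg: "f \<in> ?T" for c f
      proof -
        obtain a b where "f = (\<lambda>x. \<Sum>j<n. a j * \<phi> j x + b j * \<psi> j x)" using fg by blast
        then show ?thesis
          by (intro CollectI exI[of _ "\<lambda>j. c * a j"] exI[of _ "\<lambda>j. c * b j"])
            (simp add: fun_eq_iff sum_distrib_left algebra_simps)
      qed
    qed
  qed
  ultimately show ?thesis unfolding endpoint_space_def span by blast
qed

locale jacobi_profiles = jacobi_power +
  fixes \<phi>p \<phi>m \<psi>p \<psi>m :: "nat \<Rightarrow> real \<Rightarrow> complex"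
  assumes \<phi>p: "cutoff_at_1 (\<lambda>t. t ^ j) (\<phi>p j)"
    and \<phi>m: "cutoff_at_m1 (\<lambda>t. t ^ j) (\<phi>m j)"
    and \<psi>p: "cutoff_at_1 (psi_profile \<alpha> j) (\<psi>p j)"
    and \<psi>m: "cutoff_at_m1 (psi_profile \<beta> j) (\<psi>m j)"
begin

text \<open>In (j, s, e) the flag s selects the second family of profiles and e the end 1; this
  flattens the two endpoint spaces into one family of 4n functions.\<close>

definition ep_vec :: "nat \<times> bool \<times> bool \<Rightarrow> real \<Rightarrow> complex" where
  "ep_vec i = (case i of (j, s, e) \<Rightarrow> if e then (if s then \<psi>p j else \<phi>p j) else (if s then \<psi>m j else \<phi>m j))"

definition ep_index :: "(nat \<times> bool \<times> bool) set" where
  "ep_index = {..<n} \<times> UNIV"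

lemma finite_ep_index: "finite ep_index" and card_ep_index: "card ep_index = 4 * n"
proof -
  have "card (UNIV :: (bool \<times> bool) set) = 4" by (simp flip: UNIV_Times_UNIV add: card_cartesian_product)
  then show "card ep_index = 4 * n" by (simp add: ep_index_def card_cartesian_product)
qed (simp add: ep_index_def)

lemma ep_sum:
  "(\<Sum>i\<in>ep_index. c i * ep_vec i x) =
    (\<Sum>j<n. c (j, False, False) * \<phi>m j x + c (j, True, False) * \<psi>m j x) +
    (\<Sum>j<n. c (j, False, True) * \<phi>p j x + c (j, True, True) * \<psi>p j x)"
proof -
  have "(\<Sum>i\<in>ep_index. c i * ep_vec i x) = (\<Sum>j<n. \<Sum>z\<in>UNIV. c (j, z) * ep_vec (j, z) x)"
    unfolding ep_index_def by (subst sum.cartesian_product) (simp add: case_prod_beta)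
  also have "\<dots> = (\<Sum>j<n. \<Sum>s\<in>UNIV. \<Sum>e\<in>UNIV. c (j, s, e) * ep_vec (j, s, e) x)"
    by (intro sum.cong refl) (simp flip: UNIV_Times_UNIV add: sum.cartesian_product case_prod_beta)
  also have "\<dots> = (\<Sum>j<n. (c (j, False, False) * \<phi>m j x + c (j, True, False) * \<psi>m j x) +
      (c (j, False, True) * \<phi>p j x + c (j, True, True) * \<psi>p j x))"
    by (intro sum.cong refl) (simp add: UNIV_bool ep_vec_def)
  finally show ?thesis by (simp add: sum.distrib)
qed

lemma ep_vec_props:
  "smooth_on_ivl (ep_vec i)" "x \<notin> unit_ivl \<Longrightarrow> ep_vec i x = 0"
  using \<phi>p \<phi>m \<psi>p \<psi>m by (auto simp: ep_vec_def cutoff_at_1_def cutoff_at_m1_def split: prod.splits)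

text \<open>The coefficients are set to 0 from n on because the action of \<open>ell\<close> at
  index j looks at index j + 1.\<close>

lemma ep_sum_at_1:
  "\<forall>\<^sub>F x in at_left 1. (\<Sum>i\<in>ep_index. c i * ep_vec i x) =
     tsum n (\<lambda>j. if j < n then c (j, False, True) else 0) (\<lambda>j. if j < n then c (j, True, True) else 0) x"
proof -
  have "\<forall>\<^sub>F x in at_left 1. \<forall>j\<in>{..<n}. \<phi>p j x = of_real ((1 - x) ^ j) \<and> \<psi>p j x = of_real (psi_profile \<alpha> j (1 - x)) \<and>
      \<phi>m j x = 0 \<and> \<psi>m j x = 0"
    using \<phi>p \<phi>m \<psi>p \<psi>m unfolding cutoff_at_1_def cutoff_at_m1_def
    by (intro eventually_ball_finite ballI eventually_conj) auto
  then show ?thesis using eventually_at_left_1_unit_ivl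
  proof eventually_elim
    case (elim x)
    then show ?case
      unfolding ep_sum tsum_def by (simp add: prof_eq)
  qed
qed

lemma ep_sum_at_m1:
  "\<forall>\<^sub>F x in at_left 1. (\<Sum>i\<in>ep_index. c i * ep_vec i (- x)) =
     jacobi.tsum \<beta> n (\<lambda>j. if j < n then c (j, False, False) else 0) (\<lambda>j. if j < n then c (j, True, False) else 0) x"
proof -
  interpret R: jacobi \<beta> \<alpha> "\<lambda>x. - u (- x)" by (rule reflected)
  have "\<forall>\<^sub>F x in at_right (-1). \<forall>j\<in>{..<n}. \<phi>m j x = of_real ((1 + x) ^ j) \<and> \<psi>m j x = of_real (psi_profile \<beta> j (1 + x)) \<and>
      \<phi>p j x = 0 \<and> \<psi>p j x = 0"
    using \<phi>p \<phi>m \<psi>p \<psi>m unfolding cutoff_at_1_def cutoff_at_m1_def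
    by (intro eventually_ball_finite ballI eventually_conj) auto
  then have "\<forall>\<^sub>F x in at_left 1. \<forall>j\<in>{..<n}. \<phi>m j (- x) = of_real ((1 - x) ^ j) \<and> \<psi>m j (- x) = of_real (psi_profile \<beta> j (1 - x)) \<and>
      \<phi>p j (- x) = 0 \<and> \<psi>p j (- x) = 0"
    unfolding at_right_m1 eventually_filtermap by simp
  then show ?thesis using eventually_at_left_1_unit_ivl
  proof eventually_elim
    case (elim x)
    then show ?case
      unfolding ep_sum R.tsum_def by (simp add: R.prof_eq)
  qed
qed

lemma smooth_ep_sum: "smooth_on_ivl (\<lambda>x. \<Sum>i\<in>ep_index. c i * ep_vec i x)"
  unfolding smooth_on_ivl_iff_reg
  using pow_sum(1)[OF finite_ep_index, of ep_vec] smooth_reg[OF ep_vec_props(1)] by blast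

lemma ep_sum_V: "(\<lambda>x. \<Sum>i\<in>ep_index. c i * ep_vec i x) \<in> V"
  by (rule profile_in_V[OF smooth_ep_sum _ ep_sum_at_1 _ ep_sum_at_m1]) (simp_all add: ep_vec_props(2))

lemma ep_vec_V:
  assumes "i \<in> ep_index" shows "ep_vec i \<in> V"
proof -
  have "(\<lambda>x. \<Sum>k\<in>ep_index. of_bool (k = i) * ep_vec k x) = ep_vec i"
    using assms finite_ep_index
    by (simp add: fun_eq_iff of_bool_def if_distrib[of "\<lambda>c. c * _"] sum.delta cong: if_cong)
  then show ?thesis using ep_sum_V[of "\<lambda>k. of_bool (k = i)"] by simp
qed

lemma ep_sum_in_bd_kernel:
  assumes "(\<lambda>x. \<Sum>i\<in>ep_index. c i * ep_vec i x) \<in> bd_kernel"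
  shows "\<forall>i\<in>ep_index. c i = 0"
proof -
  have "c (j, s, e) = 0" if j: "j < n" for j s e
  proof -
    have "(if j < n then c (j, False, True) else 0) = 0 \<and> (if j < n then c (j, True, True) else 0) = 0"
      by (rule profile_bd_kernel(1)[OF assms smooth_ep_sum ep_sum_at_1 _ ep_sum_at_m1 _ j]) simp_all
    moreover have "(if j < n then c (j, False, False) else 0) = 0 \<and> (if j < n then c (j, True, False) else 0) = 0"
      by (rule profile_bd_kernel(2)[OF assms smooth_ep_sum ep_sum_at_1 _ ep_sum_at_m1 _ j]) simp_all
    ultimately have "c (j, False, True) = 0 \<and> c (j, True, True) = 0" "c (j, False, False) = 0 \<and> c (j, True, False) = 0"
      using j by simp_all
    then show ?thesis by (cases s; cases e) auto
  qed
  then show ?thesis by (auto simp: ep_index_def)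
qed

lemma V_ep_decomposition:
  assumes f: "f \<in> V"
  obtains c where "(\<lambda>x. f x - (\<Sum>i\<in>ep_index. c i * ep_vec i x)) \<in> bd_kernel"
  by (rule decompose_mod_bd_kernel[OF finite_ep_index card_ep_index ep_vec_V ep_sum_in_bd_kernel f])

section \<open>Comparison of the two direct sums\<close>

abbreviation "EM \<equiv> endpoint_space n \<phi>m \<psi>m"
abbreviation "EP \<equiv> endpoint_space n \<phi>p \<psi>p"

lemma endpoint_spaces_sum:
  assumes "f \<in> EM" "g \<in> EP"
  obtains c where "\<And>x. f x + g x = (\<Sum>i\<in>ep_index. c i * ep_vec i x)"
    "f = (\<lambda>x. \<Sum>j<n. c (j, False, False) * \<phi>m j x + c (j, True, False) * \<psi>m j x)"
    "g = (\<lambda>x. \<Sum>j<n. c (j, False, True) * \<phi>p j x + c (j, True, True) * \<psi>p j x)"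
proof -
  obtain a b where f: "f = (\<lambda>x. \<Sum>j<n. a j * \<phi>m j x + b j * \<psi>m j x)"
    using assms(1) unfolding endpoint_space_eq by blast
  obtain a' b' where g: "g = (\<lambda>x. \<Sum>j<n. a' j * \<phi>p j x + b' j * \<psi>p j x)"
    using assms(2) unfolding endpoint_space_eq by blast
  define c where "c i = (case i of (j, s, e) \<Rightarrow> if e then (if s then b' j else a' j) else (if s then b j else a j))" for i :: "nat \<times> bool \<times> bool"
  show thesis by (rule that[of c]) (simp_all add: ep_sum c_def f g)
qed

lemma endpoint_spaces_V:
  assumes "f \<in> EM" "g \<in> EP" shows "(\<lambda>x. f x + g x) \<in> V"
proof -
  obtain c where "\<And>x. f x + g x = (\<Sum>i\<in>ep_index. c i * ep_vec i x)"
    using endpoint_spaces_sum[OF assms] by blast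
  then show ?thesis using ep_sum_V[of c] by simp
qed

lemma endpoint_spaces_bd_kernel:
  assumes "f \<in> EM" "g \<in> EP" "(\<lambda>x. f x + g x) \<in> bd_kernel"
  shows "f = (\<lambda>_. 0)" "g = (\<lambda>_. 0)"
proof -
  obtain c where c: "\<And>x. f x + g x = (\<Sum>i\<in>ep_index. c i * ep_vec i x)"
    "f = (\<lambda>x. \<Sum>j<n. c (j, False, False) * \<phi>m j x + c (j, True, False) * \<psi>m j x)"
    "g = (\<lambda>x. \<Sum>j<n. c (j, False, True) * \<phi>p j x + c (j, True, True) * \<psi>p j x)"
    using endpoint_spaces_sum[OF assms(1,2)] by blast
  have "\<forall>i\<in>ep_index. c i = 0" using assms(3) unfolding c(1) by (rule ep_sum_in_bd_kernel)
  then show "f = (\<lambda>_. 0)" "g = (\<lambda>_. 0)" unfolding c(2,3) by (simp_all add: ep_index_def)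
qed

lemma zero_in_endpoint_space: "(\<lambda>_. 0) \<in> endpoint_space n \<phi> \<psi>"
  unfolding endpoint_space_eq by (intro CollectI exI[of _ "\<lambda>_. 0"]) simp

lemma zero_in_defect: "(\<lambda>_. 0) \<in> defect_plus \<alpha> \<beta> n" "(\<lambda>_. 0) \<in> defect_minus \<alpha> \<beta> n"
  by (simp_all add: defect_plus_def defect_minus_def zero_in_V jacobi_pow_zero)

lemma zero_in_D_min: "(\<lambda>_. 0) \<in> D_min \<alpha> \<beta> n"
  by (simp add: D_min_def jacobi_bracket_def zero_in_V jacobi_pow_zero)

lemma defect_inter: "defect_plus \<alpha> \<beta> n \<inter> defect_minus \<alpha> \<beta> n = {\<lambda>_. 0}"
proof
  show "defect_plus \<alpha> \<beta> n \<inter> defect_minus \<alpha> \<beta> n \<subseteq> {\<lambda>_. 0}"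
  proof
    fix f assume f: "f \<in> defect_plus \<alpha> \<beta> n \<inter> defect_minus \<alpha> \<beta> n"
    then have V: "f \<in> V" by (simp add: defect_plus_def)
    have "negligible ({x \<in> unit_ivl. pow n f x \<noteq> \<i> * f x} \<union> {x \<in> unit_ivl. pow n f x \<noteq> - \<i> * f x})"
      using f by (auto simp: defect_plus_def defect_minus_def AE_jacobi_measure_iff)
    then have "negligible {x \<in> unit_ivl. f x \<noteq> 0}" by (rule negligible_subset) auto
    then have "f x = 0" for x
      using AC_loc_AE_zero[OF reg_AC_loc[OF D_maxD(2)[OF V]]] D_maxD(1)[OF V] by blast
    then show "f \<in> {\<lambda>_. 0}" by auto
  qed
qed (use zero_in_defect in simp)

lemma defect_spaces_V: "f \<in> defect_plus \<alpha> \<beta> n \<Longrightarrow> g \<in> defect_minus \<alpha> \<beta> n \<Longrightarrow> (\<lambda>x. f x + g x) \<in> V"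
  using V_lincomb[of f g 1 1] by (simp add: defect_plus_def defect_minus_def)

lemma set_plus_fun_iff:
  "h \<in> A + B \<longleftrightarrow> (\<exists>f\<in>A. \<exists>g\<in>B. h = (\<lambda>x. f x + g x))" for A B :: "(real \<Rightarrow> complex) set"
  by (auto simp: set_plus_def plus_fun_def)

text \<open>Applied to the defect spaces and to the endpoint spaces: the two sums agree modulo the
  minimal domain because each fills the whole maximal domain.\<close>

lemma sum_with_D_min_eq_V:
  assumes "\<And>f g. f \<in> A \<Longrightarrow> g \<in> B \<Longrightarrow> (\<lambda>x. f x + g x) \<in> V"
    and "\<And>f. f \<in> V \<Longrightarrow> \<exists>g\<in>A. \<exists>h\<in>B. (\<lambda>x. f x - (g x + h x)) \<in> bd_kernel"
  shows "D_min \<alpha> \<beta> n + (A + B) = V"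
proof
  show "D_min \<alpha> \<beta> n + (A + B) \<subseteq> V"
  proof
    fix f assume "f \<in> D_min \<alpha> \<beta> n + (A + B)"
    then obtain k s where k: "k \<in> D_min \<alpha> \<beta> n" "s \<in> A + B" "f = (\<lambda>x. k x + s x)"
      unfolding set_plus_fun_iff[of f] by blast
    have "s \<in> V" using k(2) assms(1) unfolding set_plus_fun_iff[of s] by blast
    moreover have "k \<in> V" using k(1) by (simp add: D_min_def)
    ultimately show "f \<in> V" using V_lincomb[of k s 1 1] k(3) by simp
  qed
  show "V \<subseteq> D_min \<alpha> \<beta> n + (A + B)"
  proof
    fix f assume "f \<in> V"
    then obtain g h where gh: "g \<in> A" "h \<in> B" "(\<lambda>x. f x - (g x + h x)) \<in> bd_kernel" using assms(2) by blast
    have gh': "(\<lambda>x. g x + h x) \<in> A + B" unfolding set_plus_fun_iff using gh by blast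
    show "f \<in> D_min \<alpha> \<beta> n + (A + B)"
      unfolding set_plus_fun_iff[of f] D_min_eq_bd_kernel
      by (rule bexI[OF bexI[OF _ gh'] gh(3)]) simp
  qed
qed

theorem direct_sums:
  "direct_sums_eq_mod (D_min \<alpha> \<beta> n) (defect_plus \<alpha> \<beta> n) (defect_minus \<alpha> \<beta> n) EM EP"
proof -
  have z: "(0 :: real \<Rightarrow> complex) = (\<lambda>_. 0)" by (rule zero_fun_def)
  have zs: "(\<lambda>_. 0) \<in> A + B" if "(\<lambda>_. 0) \<in> A" "(\<lambda>_. 0) \<in> B" for A B :: "(real \<Rightarrow> complex) set"
    unfolding set_plus_fun_iff using that by (intro bexI[of _ "\<lambda>_. 0"]) auto
  have CD: "EM \<inter> EP = {\<lambda>_. 0}"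
  proof
    show "EM \<inter> EP \<subseteq> {\<lambda>_. 0}"
    proof
      fix f assume f: "f \<in> EM \<inter> EP"
      then obtain a b where ab: "f = (\<lambda>x. \<Sum>j<n. a j * \<phi>p j x + b j * \<psi>p j x)"
        unfolding endpoint_space_eq by blast
      \<comment> \<open>The second space also contains -f, and f + (-f) = 0 lies in the kernel;
        independence then forces f = 0.\<close>
      have "(\<lambda>x. \<Sum>j<n. (- a j) * \<phi>p j x + (- b j) * \<psi>p j x) \<in> EP"
        unfolding endpoint_space_eq by (intro CollectI exI[of _ "\<lambda>j. - a j"] exI[of _ "\<lambda>j. - b j"]) simp
      moreover have "(\<lambda>x. \<Sum>j<n. (- a j) * \<phi>p j x + (- b j) * \<psi>p j x) = (\<lambda>x. - f x)"
        unfolding ab by (simp add: sum_negf[symmetric])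
      ultimately have "(\<lambda>x. - f x) \<in> EP" by simp
      moreover have "(\<lambda>x. f x + - f x) \<in> bd_kernel" using zero_in_D_min by (simp add: D_min_eq_bd_kernel)
      ultimately show "f \<in> {\<lambda>_. 0}" using endpoint_spaces_bd_kernel(1)[of f "\<lambda>x. - f x"] f by simp
    qed
  qed (use zero_in_endpoint_space in simp)
  have NAB: "D_min \<alpha> \<beta> n \<inter> (defect_plus \<alpha> \<beta> n + defect_minus \<alpha> \<beta> n) = {\<lambda>_. 0}"
  proof
    show "D_min \<alpha> \<beta> n \<inter> (defect_plus \<alpha> \<beta> n + defect_minus \<alpha> \<beta> n) \<subseteq> {\<lambda>_. 0}"
    proof
      fix s assume s: "s \<in> D_min \<alpha> \<beta> n \<inter> (defect_plus \<alpha> \<beta> n + defect_minus \<alpha> \<beta> n)"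
      then obtain f g where fg: "f \<in> defect_plus \<alpha> \<beta> n" "g \<in> defect_minus \<alpha> \<beta> n" "s = (\<lambda>x. f x + g x)"
        unfolding Int_iff set_plus_fun_iff by blast
      then show "s \<in> {\<lambda>_. 0}" using D_min_defect_sum[OF fg(1,2)] s by simp
    qed
  qed (use zs[OF zero_in_defect] zero_in_D_min in simp)
  have NCD: "D_min \<alpha> \<beta> n \<inter> (EM + EP) = {\<lambda>_. 0}"
  proof
    show "D_min \<alpha> \<beta> n \<inter> (EM + EP) \<subseteq> {\<lambda>_. 0}"
    proof
      fix s assume s: "s \<in> D_min \<alpha> \<beta> n \<inter> (EM + EP)"
      then obtain f g where fg: "f \<in> EM" "g \<in> EP" "s = (\<lambda>x. f x + g x)"
        unfolding Int_iff set_plus_fun_iff by blast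
      then show "s \<in> {\<lambda>_. 0}"
        using endpoint_spaces_bd_kernel[OF fg(1,2)] s by (simp add: D_min_eq_bd_kernel)
    qed
  qed (use zs[OF zero_in_endpoint_space zero_in_endpoint_space] zero_in_D_min in simp)
  have "D_min \<alpha> \<beta> n + (defect_plus \<alpha> \<beta> n + defect_minus \<alpha> \<beta> n) = V"
  proof (rule sum_with_D_min_eq_V[OF defect_spaces_V])
    fix f assume "f \<in> V"
    then obtain c where c: "(\<lambda>x. f x - (\<Sum>i\<in>eig_index. c i * eigf (fst i) (snd i) x)) \<in> bd_kernel"
      using V_eig_decomposition by blast
    obtain g h where gh: "g \<in> defect_plus \<alpha> \<beta> n" "h \<in> defect_minus \<alpha> \<beta> n"
      "\<And>x. (\<Sum>i\<in>eig_index. c i * eigf (fst i) (snd i) x) = g x + h x"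
      using eig_sum_split[of c] by blast
    then show "\<exists>g\<in>defect_plus \<alpha> \<beta> n. \<exists>h\<in>defect_minus \<alpha> \<beta> n. (\<lambda>x. f x - (g x + h x)) \<in> bd_kernel"
      using c unfolding gh(3) by blast
  qed
  moreover have "D_min \<alpha> \<beta> n + (EM + EP) = V"
  proof (rule sum_with_D_min_eq_V[OF endpoint_spaces_V])
    fix f assume "f \<in> V"
    then obtain c where c: "(\<lambda>x. f x - (\<Sum>i\<in>ep_index. c i * ep_vec i x)) \<in> bd_kernel"
      using V_ep_decomposition by blast
    let ?g = "\<lambda>x. \<Sum>j<n. c (j, False, False) * \<phi>m j x + c (j, True, False) * \<psi>m j x"
    let ?h = "\<lambda>x. \<Sum>j<n. c (j, False, True) * \<phi>p j x + c (j, True, True) * \<psi>p j x"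
    have gh: "?g \<in> EM" "?h \<in> EP"
      unfolding endpoint_space_eq mem_Collect_eq
      by (intro exI[of _ "\<lambda>j. c (j, False, False)"] exI[of _ "\<lambda>j. c (j, True, False)"] conjI refl TrueI,
          intro exI[of _ "\<lambda>j. c (j, False, True)"] exI[of _ "\<lambda>j. c (j, True, True)"] conjI refl TrueI)
    have "(\<lambda>x. f x - (?g x + ?h x)) \<in> bd_kernel" using c unfolding ep_sum .
    then show "\<exists>g\<in>EM. \<exists>h\<in>EP. (\<lambda>x. f x - (g x + h x)) \<in> bd_kernel"
      by (intro bexI[OF _ gh(1)] bexI[OF _ gh(2)])
  qed
  ultimately show ?thesis
    unfolding direct_sums_eq_mod_def z using defect_inter CD NAB NCD by simp
qed

end

theorem corollary4p8:
  fixes \<alpha> \<beta> :: real and n :: nat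
    and \<phi>p \<phi>m \<psi>p \<psi>m :: "nat \<Rightarrow> real \<Rightarrow> complex"
  assumes "0 \<le> \<alpha>" "\<alpha> < 1" "0 \<le> \<beta>" "\<beta> < 1" "n \<ge> 1"
    and "\<And>j. cutoff_at_1 (\<lambda>t. t ^ j) (\<phi>p j)"
    and "\<And>j. cutoff_at_m1 (\<lambda>t. t ^ j) (\<phi>m j)"
    and "\<And>j. cutoff_at_1 (psi_profile \<alpha> j) (\<psi>p j)"
    and "\<And>j. cutoff_at_m1 (psi_profile \<beta> j) (\<psi>m j)"
  shows "direct_sums_eq_mod (D_min \<alpha> \<beta> n)
           (defect_plus \<alpha> \<beta> n) (defect_minus \<alpha> \<beta> n)
           (endpoint_space n \<phi>m \<psi>m) (endpoint_space n \<phi>p \<psi>p)"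
proof -
  obtain u where "second_solution \<alpha> \<beta> u" using second_solution_exists by blast
  then interpret jacobi_profiles \<alpha> \<beta> u n \<phi>p \<phi>m \<psi>p \<psi>m
    using assms by unfold_locales auto
  show ?thesis by (rule direct_sums)
qed

end
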